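(* Let $\Gamma \subset \mathsf{Homeo}(M)$ be a non-elementary convergence group and let $\sigma \colon \Gamma \times M \to \mathbb{R}$ be an expanding coarse-cocycle with $\delta:=\delta_\sigma(\Gamma) < +\infty$. Let $\mu$ be a $C$-coarse $\sigma$-Patterson--Sullivan measure of dimension $\delta$, and suppose $$\sum_{\gamma \in \Gamma} e^{-\delta \|\gamma\|_\sigma} = + \infty.$$ Then: (1) $\Gamma$ acts ergodically on $(M, \mu)$. (2) $\mu$ is coarsely unique in the following sense: if $\lambda$ is a $C$-coarse $\sigma$-Patterson--Sullivan measure of dimension $\delta$, then $e^{-4C} \mu \leq \lambda \leq e^{4C}\mu$. (3) The conical limit set $\Lambda^{\rm con}(\Gamma)$ has full $\mu$-measure.
   Context: Convergence groups. $M$ is a compact metrizable space. A subgroup $\Gamma\subset\mathsf{Homeo}(M)$ is a (discrete) convergence group if for every sequence $\{\gamma_n\}$ of distinct elements of $\Gamma$ there are $x,y\in M$ and a subsequence $\{\gamma_{n_j}\}$ such that $\gamma_{n_j}|_{M\smallsetminus\{y\}}$ converges locally uniformly to the constant $x$. The limit set $\Lambda(\Gamma)$ is the set of $x\in M$ for which there are $y\in M$ and a sequence $\{\gamma_n\}\subset\Gamma$ with $\gamma_n|_{M\smallsetminus\{y\}}\to x$ locally uniformly. $\Gamma$ is non-elementary if $\#\Lambda(\Gamma)\ge 3$. A point $x\in\Lambda(\Gamma)$ is a conical limit point if there are distinct $a,b\in M$ and $\{\gamma_n\}\subset\Gamma$ with $\gamma_n(x)\to a$ and $\gamma_n(y)\to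 b$ for all $y\in M\smallsetminus\{x\}$; $\Lambda^{\rm con}(\Gamma)$ is the set of conical limit points. An element $\gamma$ is loxodromic if it has two fixed points $\gamma^+\ne\gamma^-$ in $\Lambda(\Gamma)$ such that $\gamma^{\pm n}|_{M\smallsetminus\{\gamma^{\mp}\}}$ converges locally uniformly to $\gamma^{\pm}$ as $n\to+\infty$. Compatible metrics. $\Gamma\sqcup M$ carries a unique compact metrizable topology for which the inclusions of $\Gamma$ (discrete) and of $M$ are embeddings and the natural action of $\Gamma$ (left multiplication on $\Gamma$) is a convergence group action. A compatible metric $\mathrm{d}$ is a metric on $\Gamma\sqcup M$ inducing this topology; fix one. Coarse-cocycles. For $\kappa\ge0$, $\sigma\colon\Gamma\times M\to\mathbb{R}$ is a $\kappa$-coarse-cocycle if (i) $\limsup_{x\to x_0}|\sigma(\gamma,x_0)-\sigma(\gamma,x)|\le\kappa$ for all $\gamma\in\Gamma$, $x_0\in M$, and (ii) $|\sigma(\gamma_1\gamma_2,x)-(\sigma(\gamma_1,\gamma_2x)+\sigma(\gamma_2,x))|\le\kappa$ for all $\gamma_1,\gamma_2\in\Gamma$, $x\in M$. A coarse-cocycle is a $\kappa$-coarse-cocycle for some $\kappa$. It is proper if $\sigma(\gamma_n,\gamma_n^+)\to+\infty$ whenever $\{\gamma_n\}\subset\Gamma$ is a sequence of distinct loxodromic elements with $\liminf_n\mathrm{d}(\gamma_n^-,\gamma_n^+)>0$. It is expanding if it is proper and for each $\gamma\in\Gamma$ there is a number $\|\gamma\|_\sigma\in\mathbb{R}$ (the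 $\sigma$-magnitude) such that for every $\epsilon>0$ there is $C>0$ with $\|\gamma\|_\sigma-C\le\sigma(\gamma,x)\le\|\gamma\|_\sigma+C$ whenever $x\in M$, $\gamma\in\Gamma$ and $\mathrm{d}(x,\gamma^{-1})>\epsilon$ (here $\gamma^{-1}$ is a point of $\Gamma\sqcup M$). The magnitude function is any fixed choice; two choices differ by a bounded amount. Critical exponent: $\delta_\sigma(\Gamma)=\inf\{s>0:\sum_{\gamma\in\Gamma}e^{-s\|\gamma\|_\sigma}<+\infty\}\in[0,+\infty]$. Patterson--Sullivan measures: a Borel probability measure $\mu$ on $M$ is a $C$-coarse $\sigma$-Patterson--Sullivan measure of dimension $\delta$ if for every $\gamma\in\Gamma$ the measures $\mu$ and $\gamma_*\mu$ are mutually absolutely continuous and $e^{-C-\delta\sigma(\gamma^{-1},\cdot)}\le\frac{d\gamma_*\mu}{d\mu}\le e^{C-\delta\sigma(\gamma^{-1},\cdot)}$ $\mu$-almost everywhere. *)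

theory Defs
  imports "HOL-Probability.Probability" "HOL-Algebra.Group"
begin

text \<open>
  A compact metrizable space \<open>M\<close> is modelled by a type \<open>'m\<close> of class \<^class>\<open>polish_space\<close> such that
  \<^term>\<open>compact UNIV\<close>. This is no restriction, as every compact metric space is complete and second
  countable. No definition below depends on the metric \<^const>\<open>dist\<close>, only on its topology.

  The symbol \<open>inv\<close> is claimed by the inverse in a group, so the inverse of a bijection \<open>g\<close> is written
  \<^term>\<open>inv_into UNIV g\<close>.
\<close>

subsection \<open>Convergence groups\<close>

definition homeo_group :: "('m::topological_space \<Rightarrow> 'm) monoid" where
  "homeo_group = \<lparr>carrier = {f. \<exists>g. homeomorphism UNIV UNIV f g}, mult = (\<circ>), one = id\<rparr>"

text \<open>
  Locally uniform convergence on \<open>A\<close> to the constant \<open>x\<close>. For a constant limit, uniform convergence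
  depends only on the topology of the target; see \<open>loc_unif_to_const_euclidean\<close> below.
\<close>

definition loc_unif_to_const ::
  "'a topology \<Rightarrow> 'a set \<Rightarrow> (nat \<Rightarrow> 'a \<Rightarrow> 'a) \<Rightarrow> 'a \<Rightarrow> bool" where
  "loc_unif_to_const X A f x \<longleftrightarrow>
     (\<forall>z\<in>A. \<exists>U. openin X U \<and> z \<in> U \<and>
        (\<forall>V. openin X V \<and> x \<in> V \<longrightarrow> (\<forall>\<^sub>F n in sequentially. \<forall>w\<in>U \<inter> A. f n w \<in> V)))"

lemma loc_unif_to_const_euclidean:
  fixes f :: "nat \<Rightarrow> 'm::metric_space \<Rightarrow> 'm"
  shows "loc_unif_to_const euclidean A f x \<longleftrightarrow>
     (\<forall>z\<in>A. \<exists>U. open U \<and> z \<in> U \<and> uniform_limit (U \<inter> A) f (\<lambda>_. x) sequentially)"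
proof -
  have "(\<forall>V. open V \<and> x \<in> V \<longrightarrow> (\<forall>\<^sub>F n in sequentially. \<forall>w\<in>B. f n w \<in> V)) \<longleftrightarrow>
        uniform_limit B f (\<lambda>_. x) sequentially" for B
  proof
    assume L: "\<forall>V. open V \<and> x \<in> V \<longrightarrow> (\<forall>\<^sub>F n in sequentially. \<forall>w\<in>B. f n w \<in> V)"
    show "uniform_limit B f (\<lambda>_. x) sequentially"
    proof (rule uniform_limitI)
      fix e :: real assume "0 < e"
      then have "\<forall>\<^sub>F n in sequentially. \<forall>w\<in>B. f n w \<in> ball x e"
        using L[rule_format, of "ball x e"] by simp
      then show "\<forall>\<^sub>F n in sequentially. \<forall>w\<in>B. dist (f n w) x < e"
        by (simp add: dist_commute)
    qed
  next
    assume R: "uniform_limit B f (\<lambda>_. x) sequentially"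
    show "\<forall>V. open V \<and> x \<in> V \<longrightarrow> (\<forall>\<^sub>F n in sequentially. \<forall>w\<in>B. f n w \<in> V)"
    proof (intro allI impI)
      fix V assume "open V \<and> x \<in> V"
      then obtain e where e: "0 < e" "ball x e \<subseteq> V"
        using openE by blast
      then have "\<forall>\<^sub>F n in sequentially. \<forall>w\<in>B. dist (f n w) x < e"
        using R by (auto dest: uniform_limitD)
      then show "\<forall>\<^sub>F n in sequentially. \<forall>w\<in>B. f n w \<in> V"
        by (rule eventually_mono) (use e in \<open>auto simp: dist_commute\<close>)
    qed
  qed
  then show ?thesis
    unfolding loc_unif_to_const_def by simp
qed

definition convergence_action :: "'g set \<Rightarrow> ('g \<Rightarrow> 'a \<Rightarrow> 'a) \<Rightarrow> 'a topology \<Rightarrow> bool" where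
  "convergence_action \<Gamma> act X \<longleftrightarrow>
     (\<forall>\<gamma>\<in>\<Gamma>. homeomorphic_map X X (act \<gamma>)) \<and>
     (\<forall>\<gamma>. range \<gamma> \<subseteq> \<Gamma> \<and> inj \<gamma> \<longrightarrow>
        (\<exists>x\<in>topspace X. \<exists>y\<in>topspace X. \<exists>r. strict_mono (r :: nat \<Rightarrow> nat) \<and>
           loc_unif_to_const X (topspace X - {y}) (\<lambda>j. act (\<gamma> (r j))) x))"

definition convergence_group :: "('m::topological_space \<Rightarrow> 'm) set \<Rightarrow> bool" where
  "convergence_group \<Gamma> \<longleftrightarrow>
     subgroup \<Gamma> homeo_group \<and> convergence_action \<Gamma> (\<lambda>\<gamma>. \<gamma>) euclidean"

definition limit_set :: "('m::topological_space \<Rightarrow> 'm) set \<Rightarrow> 'm set" where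
  "limit_set \<Gamma> =
     {x. \<exists>y \<gamma>. range \<gamma> \<subseteq> \<Gamma> \<and> loc_unif_to_const euclidean (- {y}) \<gamma> x}"

definition non_elementary :: "('m::topological_space \<Rightarrow> 'm) set \<Rightarrow> bool" where
  "non_elementary \<Gamma> \<longleftrightarrow> infinite (limit_set \<Gamma>) \<or> card (limit_set \<Gamma>) \<ge> 3"

definition conical_limit_set :: "('m::topological_space \<Rightarrow> 'm) set \<Rightarrow> 'm set" where
  "conical_limit_set \<Gamma> =
     {x \<in> limit_set \<Gamma>. \<exists>a b \<gamma>. a \<noteq> b \<and> range \<gamma> \<subseteq> \<Gamma> \<and>
        (\<lambda>n. \<gamma> n x) \<longlonglongrightarrow> a \<and> (\<forall>y. y \<noteq> x \<longrightarrow> (\<lambda>n. \<gamma> n y) \<longlonglongrightarrow> b)}"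

text \<open>\<open>loxodromic \<Gamma> g p q\<close>: the element \<open>g\<close> is loxodromic with \<open>g\<^sup>+ = p\<close> and \<open>g\<^sup>- = q\<close>.\<close>

definition loxodromic ::
  "('m::topological_space \<Rightarrow> 'm) set \<Rightarrow> ('m \<Rightarrow> 'm) \<Rightarrow> 'm \<Rightarrow> 'm \<Rightarrow> bool" where
  "loxodromic \<Gamma> g p q \<longleftrightarrow>
     p \<in> limit_set \<Gamma> \<and> q \<in> limit_set \<Gamma> \<and> p \<noteq> q \<and> g p = p \<and> g q = q \<and>
     loc_unif_to_const euclidean (- {q}) (\<lambda>n. g ^^ n) p \<and>
     loc_unif_to_const euclidean (- {p}) (\<lambda>n. inv_into UNIV g ^^ n) q"


subsection \<open>Compatible metrics\<close>

text \<open>The disjoint union of \<open>\<Gamma>\<close> and \<open>M\<close> is \<^term>\<open>\<Gamma> <+> UNIV\<close>, with \<open>\<Gamma>\<close> embedded by \<^const>\<open>Inl\<close>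
  and \<open>M\<close> by \<^const>\<open>Inr\<close>.\<close>

fun sum_action :: "('m \<Rightarrow> 'm) \<Rightarrow> ('m \<Rightarrow> 'm) + 'm \<Rightarrow> ('m \<Rightarrow> 'm) + 'm" where
  "sum_action \<gamma> (Inl g) = Inl (\<gamma> \<circ> g)"
| "sum_action \<gamma> (Inr x) = Inr (\<gamma> x)"

definition compactifying_topology ::
  "('m::topological_space \<Rightarrow> 'm) set \<Rightarrow> (('m \<Rightarrow> 'm) + 'm) topology \<Rightarrow> bool" where
  "compactifying_topology \<Gamma> T \<longleftrightarrow>
     topspace T = \<Gamma> <+> UNIV \<and> compact_space T \<and> metrizable_space T \<and>
     embedding_map (discrete_topology \<Gamma>) T Inl \<and>
     embedding_map euclidean T Inr \<and>
     convergence_action \<Gamma> sum_action T"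

definition compatible_metric ::
  "('m::topological_space \<Rightarrow> 'm) set \<Rightarrow> (('m \<Rightarrow> 'm) + 'm \<Rightarrow> ('m \<Rightarrow> 'm) + 'm \<Rightarrow> real) \<Rightarrow> bool" where
  "compatible_metric \<Gamma> d \<longleftrightarrow>
     Metric_space (\<Gamma> <+> UNIV) d \<and>
     compactifying_topology \<Gamma> (Metric_space.mtopology (\<Gamma> <+> UNIV) d)"


subsection \<open>Coarse-cocycles\<close>

definition coarse_cocycle_const ::
  "('m::topological_space \<Rightarrow> 'm) set \<Rightarrow> (('m \<Rightarrow> 'm) \<Rightarrow> 'm \<Rightarrow> real) \<Rightarrow> real \<Rightarrow> bool" where
  "coarse_cocycle_const \<Gamma> \<sigma> \<kappa> \<longleftrightarrow>
     (\<forall>\<gamma>\<in>\<Gamma>. \<forall>x0. Limsup (at x0) (\<lambda>x. ereal \<bar>\<sigma> \<gamma> x0 - \<sigma> \<gamma> x\<bar>) \<le> ereal \<kappa>) \<and>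
     (\<forall>\<gamma>1\<in>\<Gamma>. \<forall>\<gamma>2\<in>\<Gamma>. \<forall>x. \<bar>\<sigma> (\<gamma>1 \<circ> \<gamma>2) x - (\<sigma> \<gamma>1 (\<gamma>2 x) + \<sigma> \<gamma>2 x)\<bar> \<le> \<kappa>)"

definition coarse_cocycle ::
  "('m::topological_space \<Rightarrow> 'm) set \<Rightarrow> (('m \<Rightarrow> 'm) \<Rightarrow> 'm \<Rightarrow> real) \<Rightarrow> bool" where
  "coarse_cocycle \<Gamma> \<sigma> \<longleftrightarrow> (\<exists>\<kappa>\<ge>0. coarse_cocycle_const \<Gamma> \<sigma> \<kappa>)"

definition proper_cocycle ::
  "('m::topological_space \<Rightarrow> 'm) set \<Rightarrow> (('m \<Rightarrow> 'm) + 'm \<Rightarrow> ('m \<Rightarrow> 'm) + 'm \<Rightarrow> real) \<Rightarrow>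
     (('m \<Rightarrow> 'm) \<Rightarrow> 'm \<Rightarrow> real) \<Rightarrow> bool" where
  "proper_cocycle \<Gamma> d \<sigma> \<longleftrightarrow>
     (\<forall>\<gamma> p q. range \<gamma> \<subseteq> \<Gamma> \<and> inj \<gamma> \<and> (\<forall>n::nat. loxodromic \<Gamma> (\<gamma> n) (p n) (q n)) \<and>
        liminf (\<lambda>n. ereal (d (Inr (q n)) (Inr (p n)))) > 0 \<longrightarrow>
        filterlim (\<lambda>n. \<sigma> (\<gamma> n) (p n)) at_top sequentially)"

definition magnitude ::
  "('m::topological_space \<Rightarrow> 'm) set \<Rightarrow> (('m \<Rightarrow> 'm) + 'm \<Rightarrow> ('m \<Rightarrow> 'm) + 'm \<Rightarrow> real) \<Rightarrow>
     (('m \<Rightarrow> 'm) \<Rightarrow> 'm \<Rightarrow> real) \<Rightarrow> (('m \<Rightarrow> 'm) \<Rightarrow> real) \<Rightarrow> bool" where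
  "magnitude \<Gamma> d \<sigma> mag \<longleftrightarrow>
     (\<forall>\<epsilon>>0. \<exists>C>0. \<forall>\<gamma>\<in>\<Gamma>. \<forall>x. d (Inr x) (Inl (inv_into UNIV \<gamma>)) > \<epsilon> \<longrightarrow>
        mag \<gamma> - C \<le> \<sigma> \<gamma> x \<and> \<sigma> \<gamma> x \<le> mag \<gamma> + C)"

definition expanding_coarse_cocycle ::
  "('m::topological_space \<Rightarrow> 'm) set \<Rightarrow> (('m \<Rightarrow> 'm) + 'm \<Rightarrow> ('m \<Rightarrow> 'm) + 'm \<Rightarrow> real) \<Rightarrow>
     (('m \<Rightarrow> 'm) \<Rightarrow> 'm \<Rightarrow> real) \<Rightarrow> bool" where
  "expanding_coarse_cocycle \<Gamma> d \<sigma> \<longleftrightarrow>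
     coarse_cocycle \<Gamma> \<sigma> \<and> proper_cocycle \<Gamma> d \<sigma> \<and> (\<exists>mag. magnitude \<Gamma> d \<sigma> mag)"

definition poincare_series :: "'g set \<Rightarrow> ('g \<Rightarrow> real) \<Rightarrow> real \<Rightarrow> ennreal" where
  "poincare_series \<Gamma> mag s = (\<Sum>\<^sub>\<infinity>\<gamma>\<in>\<Gamma>. ennreal (exp (- s * mag \<gamma>)))"

definition critical_exponent :: "'g set \<Rightarrow> ('g \<Rightarrow> real) \<Rightarrow> ereal" where
  "critical_exponent \<Gamma> mag = Inf {ereal s | s. s > 0 \<and> poincare_series \<Gamma> mag s < \<infinity>}"


subsection \<open>Patterson--Sullivan measures and ergodicity\<close>

definition patterson_sullivan ::
  "('m::topological_space \<Rightarrow> 'm) set \<Rightarrow> (('m \<Rightarrow> 'm) \<Rightarrow> 'm \<Rightarrow> real) \<Rightarrow> real \<Rightarrow> real \<Rightarrow>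
     'm measure \<Rightarrow> bool" where
  "patterson_sullivan \<Gamma> \<sigma> C \<delta> \<mu> \<longleftrightarrow>
     prob_space \<mu> \<and> sets \<mu> = sets borel \<and>
     (\<forall>\<gamma>\<in>\<Gamma>.
        absolutely_continuous \<mu> (distr \<mu> borel \<gamma>) \<and>
        absolutely_continuous (distr \<mu> borel \<gamma>) \<mu> \<and>
        (AE x in \<mu>.
           ennreal (exp (- C - \<delta> * \<sigma> (inv_into UNIV \<gamma>) x)) \<le> RN_deriv \<mu> (distr \<mu> borel \<gamma>) x \<and>
           RN_deriv \<mu> (distr \<mu> borel \<gamma>) x \<le> ennreal (exp (C - \<delta> * \<sigma> (inv_into UNIV \<gamma>) x))))"

definition acts_ergodically :: "('m \<Rightarrow> 'm) set \<Rightarrow> 'm measure \<Rightarrow> bool" where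
  "acts_ergodically \<Gamma> \<mu> \<longleftrightarrow>
     (\<forall>A\<in>sets \<mu>. (\<forall>\<gamma>\<in>\<Gamma>. \<gamma> ` A = A) \<longrightarrow> A \<in> null_sets \<mu> \<or> space \<mu> - A \<in> null_sets \<mu>)"

end

(*
  The shadow of an element g is the set of points g y with y bounded away from the point g^-1 of the
  compactification. On it sigma(g, .) is the magnitude of g up to a constant, so a Patterson-Sullivan
  measure mu gives it mass comparable to exp(-delta |g|); this needs that mu is not a point mass, which
  holds because a non-elementary group with an expanding coarse-cocycle has no global fixed point. A
  point is conical iff, for some size parameter, it lies in infinitely many shadows. If the shadows of g
  and h with |g| <= |h| overlap, then |g^-1 h| <= |h| - |g| + K, and the shadow of h lies in a larger
  shadow of g. The first fact makes the shadows quasi-independent, so divergence of the Poincare series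
  and a second moment argument give positive mass to the conical limit set; applied to the restriction
  of mu to the complement, which is an invariant set, this shows that the conical limit set is full. The
  second fact is a Vitali covering property: any two measures obeying the shadow estimates and invariant
  up to null sets have the same null sets. Applied to the restrictions of mu to an invariant set and to
  its complement it gives ergodicity. Finally, the density of one Patterson-Sullivan measure with respect
  to another is invariant up to the factor exp(2 C), hence by ergodicity almost everywhere within
  this factor of 1.
*)

theory Submission
  imports Defs
begin

text \<open>Two obstacles shape the argument. A Patterson-Sullivan measure cut down to an invariant
  set is in general not a probability measure, so everything up to ergodicity is proved for the
  wider class \<open>quasi_conformal\<close>, which records only estimates that survive restriction.
  And the lower bound on the mass of shadows holds only for sizes below some \<open>e0\<close> that
  depends on the measure; sets of points in infinitely many shadows are therefore treated one size
  at a time, and the conical limit set is their countable union. The comparison of null sets needs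
  an upper bound for one measure on enlarged shadows and a lower bound for the other on the
  original, disjoint ones; the weights then cancel. In the second moment the overlaps are summed up
  to magnitude t + K instead of t. This loss is absorbed because shadows whose magnitudes lie in an
  interval of length K have bounded multiplicity, so that such a layer has bounded total weight. In
  the estimates the dynamics enters in one uniform form, \<open>finite_exceptions\<close>, and
  finiteness of the critical exponent enters as finiteness of the sets of elements of bounded
  magnitude.\<close>

abbreviation iv :: "('m \<Rightarrow> 'm) \<Rightarrow> 'm \<Rightarrow> 'm" where
  "iv g \<equiv> inv_into UNIV g"

section \<open>Three-point sets and subsequences of distinct terms\<close>

lemma three_points:
  assumes "infinite S \<or> card S \<ge> 3"
  shows "\<exists>z\<in>S. z \<noteq> x \<and> z \<noteq> y"
proof (rule ccontr)
  assume "\<not> ?thesis"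
  then have "S \<subseteq> {x, y}" by auto
  then have "finite S" "card S \<le> card {x, y}"
    by (auto intro: finite_subset card_mono)
  then show False
    using assms card_insert_le_m1[of 2 "{y}" x] by auto
qed

lemma distinct_subseq:
  assumes "infinite (range f)"
  obtains r where "strict_mono (r :: nat \<Rightarrow> nat)" "inj (f \<circ> r)"
proof -
  \<comment> \<open>The indices at which a value occurs for the first time: f is injective on them
    and they still produce the whole range.\<close>
  define I where "I = {n. \<forall>m<n. f m \<noteq> f n}"
  have "f n \<in> f ` I" for n
  proof -
    define k where "k = (LEAST k. f k = f n)"
    have k: "f k = f n" unfolding k_def by (rule LeastI) simp
    have "f m \<noteq> f k" if "m < k" for m
      using not_less_Least[of m "\<lambda>k. f k = f n"] that k unfolding k_def by simp
    then have "k \<in> I" by (simp add: I_def)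
    then show ?thesis using k by (metis imageI)
  qed
  then have "infinite I" using assms finite_subset[of "range f" "f ` I"] by blast
  from infinite_enumerate[OF this] obtain r where r: "strict_mono (r :: nat \<Rightarrow> nat)" "\<forall>n. r n \<in> I"
    by blast
  have "inj (f \<circ> r)"
  proof (rule linorder_injI)
    fix m n :: nat assume "m < n"
    then have "r m < r n" using r(1) by (simp add: strict_mono_def)
    then show "(f \<circ> r) m \<noteq> (f \<circ> r) n" using r(2) by (auto simp: I_def)
  qed
  with r(1) show ?thesis by (rule that)
qed

subsection \<open>Convergence groups and their compactification\<close>

locale compactified_group =
  fixes \<Gamma> :: "('m::polish_space \<Rightarrow> 'm) set"
    and d :: "('m \<Rightarrow> 'm) + 'm \<Rightarrow> ('m \<Rightarrow> 'm) + 'm \<Rightarrow> real"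
  assumes compact_UNIV: "compact (UNIV :: 'm set)"
    and convergence: "convergence_group \<Gamma>"
    and nonelementary: "non_elementary \<Gamma>"
    and compatible: "compatible_metric \<Gamma> d"
begin

section \<open>Group operations and inverses\<close>

lemma subgroup_homeo: "subgroup \<Gamma> homeo_group"
  using convergence by (simp add: convergence_group_def)

lemma homeo:
  assumes "g \<in> \<Gamma>"
  shows "homeomorphism UNIV UNIV g (iv g)"
proof -
  obtain h where h: "homeomorphism UNIV UNIV g h"
    using assms subgroup.subset[OF subgroup_homeo] by (auto simp: homeo_group_def)
  have "iv g = h"
    by (rule inv_equality) (use h in \<open>auto simp: homeomorphism_def\<close>)
  with h show ?thesis by simp
qed

lemma bij_elem: "g \<in> \<Gamma> \<Longrightarrow> bij g"
  using homeo[of g] unfolding homeomorphism_def by (intro o_bij[of "iv g"]) auto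

lemma inv_app [simp]: "g \<in> \<Gamma> \<Longrightarrow> iv g (g x) = x" "g \<in> \<Gamma> \<Longrightarrow> g (iv g x) = x"
  by (simp_all add: bij_elem bij_is_inj bij_is_surj surj_f_inv_f)

lemma inv_comp [simp]: "g \<in> \<Gamma> \<Longrightarrow> iv g \<circ> g = id" "g \<in> \<Gamma> \<Longrightarrow> g \<circ> iv g = id"
  by auto

lemma cont_elem: "g \<in> \<Gamma> \<Longrightarrow> continuous_on UNIV g"
  using homeo by (auto simp: homeomorphism_def)

lemma id_mem [simp]: "id \<in> \<Gamma>"
  using subgroup.one_closed[OF subgroup_homeo] by (simp add: homeo_group_def)

lemma comp_mem [simp]: "g \<in> \<Gamma> \<Longrightarrow> h \<in> \<Gamma> \<Longrightarrow> g \<circ> h \<in> \<Gamma>"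
  using subgroup.m_closed[OF subgroup_homeo, of g h] by (simp add: homeo_group_def)

lemma inv_mem [simp]:
  assumes "g \<in> \<Gamma>"
  shows "iv g \<in> \<Gamma>"
proof -
  have "iv g \<in> carrier homeo_group" "g \<in> carrier homeo_group"
    using homeo[OF assms] homeomorphism_sym[of UNIV UNIV g "iv g"]
    unfolding homeo_group_def by (simp, blast)+
  then have "inv\<^bsub>homeo_group\<^esub> g = iv g"
    unfolding m_inv_def using assms
    by (intro the_equality) (auto simp: homeo_group_def fun_eq_iff, metis inv_app(1)[OF assms])
  then show ?thesis
    using subgroup.m_inv_closed[OF subgroup_homeo assms] by simp
qed

lemma inv_inv_elem [simp]: "g \<in> \<Gamma> \<Longrightarrow> iv (iv g) = g"
  by (simp add: bij_elem inv_inv_eq)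

lemma inv_comp_elem: "g \<in> \<Gamma> \<Longrightarrow> h \<in> \<Gamma> \<Longrightarrow> iv (g \<circ> h) = iv h \<circ> iv g"
  by (simp add: bij_elem o_inv_distrib)

lemma three_points_M: "\<exists>z::'m. z \<noteq> x \<and> z \<noteq> y"
  using three_points[of "limit_set \<Gamma>" x y] nonelementary unfolding non_elementary_def by blast

section \<open>Convergent sequences in the compactification\<close>

abbreviation XX :: "(('m \<Rightarrow> 'm) + 'm) set" where
  "XX \<equiv> \<Gamma> <+> UNIV"

lemma mem_XX [simp]: "Inl g \<in> XX \<longleftrightarrow> g \<in> \<Gamma>" "Inr x \<in> XX"
  by auto

sublocale X: Metric_space XX d
  using compatible by (simp add: compatible_metric_def)

abbreviation lim :: "(nat \<Rightarrow> ('m \<Rightarrow> 'm) + 'm) \<Rightarrow> ('m \<Rightarrow> 'm) + 'm \<Rightarrow> bool" where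
  "lim z p \<equiv> limitin X.mtopology z p sequentially"

lemma compactifying: "compactifying_topology \<Gamma> X.mtopology"
  using compatible by (simp add: compatible_metric_def)

lemma act_mem [simp]: "g \<in> \<Gamma> \<Longrightarrow> z \<in> XX \<Longrightarrow> sum_action g z \<in> XX"
  by (cases z) auto

lemma compact_X: "compact_space X.mtopology"
  using compactifying by (simp add: compactifying_topology_def)

lemma homeomorphic_act: "g \<in> \<Gamma> \<Longrightarrow> homeomorphic_map X.mtopology X.mtopology (sum_action g)"
  using compactifying by (simp add: compactifying_topology_def convergence_action_def)

lemma subseq_lim:
  assumes "range z \<subseteq> XX"
  obtains p r where "p \<in> XX" "strict_mono (r :: nat \<Rightarrow> nat)" "lim (z \<circ> r) p"
  using compact_X assms unfolding X.compact_space_sequentially by metis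

lemma lim_subseq: "lim z p \<Longrightarrow> strict_mono r \<Longrightarrow> lim (z \<circ> r) p"
  by (rule limitin_subsequence)

lemma lim_act:
  assumes "g \<in> \<Gamma>" "lim z p"
  shows "lim (\<lambda>n. sum_action g (z n)) (sum_action g p)"
proof -
  have "continuous_map X.mtopology X.mtopology (sum_action g)"
    using homeomorphic_act[OF assms(1)] homeomorphic_imp_continuous_map by blast
  from continuous_map_limit[OF this assms(2)] show ?thesis by (simp add: o_def)
qed

lemma lim_unique: "lim z p \<Longrightarrow> lim z q \<Longrightarrow> p = q"
  using X.limitin_metric_unique[OF _ _ trivial_limit_sequentially] by blast

lemma lim_d:
  assumes "lim z p" "lim w q" "range z \<subseteq> XX" "range w \<subseteq> XX"
  shows "(\<lambda>n. d (z n) (w n)) \<longlonglongrightarrow> d p q"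
proof -
  have p: "p \<in> XX" "q \<in> XX"
    using assms(1,2) limitin_topspace by (metis X.topspace_mtopology)+
  have "(\<lambda>n. d (z n) p) \<longlonglongrightarrow> 0" "(\<lambda>n. d (w n) q) \<longlonglongrightarrow> 0"
    using assms(1,2) by (simp_all add: X.limitin_metric_dist_null)
  then have l: "(\<lambda>n. d (z n) p + d (w n) q) \<longlonglongrightarrow> 0"
    using tendsto_add by fastforce
  show ?thesis
  proof (rule Lim_transform[OF tendsto_const tendsto_0_le[OF l, of _ 1]])
    show "\<forall>\<^sub>F n in sequentially. norm (d (z n) (w n) - d p q) \<le> norm (d (z n) p + d (w n) q) * 1"
    proof (rule always_eventually, rule allI)
      fix n
      have m: "z n \<in> XX" "w n \<in> XX" using assms by auto
      show "norm (d (z n) (w n) - d p q) \<le> norm (d (z n) p + d (w n) q) * 1"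
        using X.triangle[OF m(1) p(1) m(2)] X.triangle[OF p(1) p(2) m(2)]
          X.triangle[OF p(1) m(1) p(2)] X.triangle[OF m(1) m(2) p(2)]
          X.commute[of p "z n"] X.commute[of q "w n"]
          X.nonneg[of p "z n"] X.nonneg[of q "w n"] by auto
    qed
  qed
qed

lemma embed_M: "embedding_map euclidean X.mtopology Inr"
  using compactifying by (simp add: compactifying_topology_def)

lemma embed_Gamma: "embedding_map (discrete_topology \<Gamma>) X.mtopology Inl"
  using compactifying by (simp add: compactifying_topology_def)

lemma lim_Inr: "lim (\<lambda>n. Inr (x n)) (Inr p) \<longleftrightarrow> x \<longlonglongrightarrow> p"
proof -
  obtain h where h: "homeomorphic_maps euclidean (subtopology X.mtopology (range Inr)) Inr h"
    using embed_M by (auto simp: embedding_map_def homeomorphic_map_maps)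
  then have hc: "continuous_map euclidean (subtopology X.mtopology (range Inr)) Inr"
    "continuous_map (subtopology X.mtopology (range Inr)) euclidean h" "\<And>x. h (Inr x) = x"
    by (auto simp: homeomorphic_maps_def)
  show ?thesis
  proof
    assume "lim (\<lambda>n. Inr (x n)) (Inr p)"
    then have "limitin (subtopology X.mtopology (range Inr)) (\<lambda>n. Inr (x n)) (Inr p) sequentially"
      by (simp add: limitin_subtopology)
    from continuous_map_limit[OF hc(2) this] show "x \<longlonglongrightarrow> p"
      by (simp add: o_def hc(3))
  next
    assume "x \<longlonglongrightarrow> p"
    then have "limitin euclidean x p sequentially" by simp
    from continuous_map_limit[OF hc(1) this] show "lim (\<lambda>n. Inr (x n)) (Inr p)"
      by (simp add: o_def limitin_subtopology)
  qed
qed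

lemma continuous_Inr: "continuous_map euclidean X.mtopology Inr"
  using embed_M by (auto simp: embedding_map_def dest: homeomorphic_imp_continuous_map
      continuous_map_into_fulltopology)

text \<open>The embedding of the discrete group gives openness only relative to its image. The image
  itself is open because its complement is a compact copy of M in a Hausdorff space.\<close>

lemma openin_singleton:
  assumes "g \<in> \<Gamma>"
  shows "openin X.mtopology {Inl g}"
proof -
  have "closedin X.mtopology (range Inr)"
    using compact_UNIV continuous_Inr image_compactin[of euclidean UNIV X.mtopology Inr]
      compactin_imp_closedin[OF X.Hausdorff_space_mtopology] by simp
  from openin_diff[OF openin_topspace this] have "openin X.mtopology (XX - range Inr)"
    by simp
  moreover have "XX - range Inr = Inl ` \<Gamma>" by auto
  ultimately have o: "openin X.mtopology (Inl ` \<Gamma>)" by simp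
  have "homeomorphic_map (discrete_topology \<Gamma>) (subtopology X.mtopology (Inl ` \<Gamma>)) Inl"
    using embed_Gamma by (simp add: embedding_map_def)
  then have "openin (subtopology X.mtopology (Inl ` \<Gamma>)) (Inl ` {g})"
    using assms by (subst homeomorphic_map_openness) auto
  then show ?thesis using o by (simp add: openin_open_subtopology)
qed

lemma lim_Inl_eventually:
  assumes "lim z (Inl g)" "g \<in> \<Gamma>"
  shows "\<forall>\<^sub>F n in sequentially. z n = Inl g"
proof -
  have "\<forall>\<^sub>F n in sequentially. z n \<in> {Inl g}"
    using assms(1) openin_singleton[OF assms(2)] unfolding limitin_def by blast
  then show ?thesis by simp
qed

lemma lim_distinct:
  assumes "inj \<gamma>" "range \<gamma> \<subseteq> \<Gamma>" "lim (\<lambda>n. Inl (\<gamma> n)) p"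
  obtains q where "p = Inr q"
proof (cases p)
  case (Inl g)
  then have "g \<in> \<Gamma>" using limitin_topspace[OF assms(3)] by auto
  then have "\<forall>\<^sub>F n in sequentially. Inl (\<gamma> n) = (Inl g :: _ + 'm)"
    using lim_Inl_eventually assms(3) Inl by blast
  then obtain N where "\<And>n. n \<ge> N \<Longrightarrow> \<gamma> n = g" by (auto simp: eventually_sequentially)
  then have "\<gamma> N = \<gamma> (Suc N)" by simp
  with injD[OF assms(1)] have "N = Suc N" by blast
  then show ?thesis by simp
next
  case (Inr q)
  then show ?thesis by (rule that)
qed

section \<open>Dynamics of sequences of distinct elements\<close>

text \<open>Local uniformity is what allows the argument of \<open>f n\<close> to move with n. Since
  the uniformity only covers a neighbourhood of p with y removed, the closedness of {y} is used to
  keep \<open>z n\<close> away from y eventually.\<close>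

lemma loc_unif_lim:
  assumes "loc_unif_to_const X.mtopology (XX - {y}) f x" "lim z p" "p \<noteq> y" "x \<in> XX"
  shows "lim (\<lambda>n. f n (z n)) x"
proof -
  have "p \<in> XX" using limitin_topspace[OF assms(2)] by simp
  with assms(3) have "p \<in> XX - {y}" by blast
  from bspec[OF assms(1)[unfolded loc_unif_to_const_def] this]
  obtain U where U: "openin X.mtopology U" "p \<in> U"
    "\<forall>V. openin X.mtopology V \<and> x \<in> V \<longrightarrow>
      (\<forall>\<^sub>F n in sequentially. \<forall>w\<in>U \<inter> (XX - {y}). f n w \<in> V)"
    by (elim exE conjE)
  have cl: "closedin X.mtopology ({y} \<inter> XX)"
    by (intro compactin_imp_closedin X.Hausdorff_space_mtopology finite_imp_compactin) simp_all
  have "openin X.mtopology (U - ({y} \<inter> XX))"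
    using U(1) cl by (rule openin_diff)
  then have ev: "\<forall>\<^sub>F n in sequentially. z n \<in> U - ({y} \<inter> XX)"
    using limitinD[OF assms(2), of "U - ({y} \<inter> XX)"] assms(3) U(2) by simp
  show ?thesis
    unfolding limitin_def
  proof (intro conjI allI impI)
    fix V assume V: "openin X.mtopology V \<and> x \<in> V"
    then have "\<forall>\<^sub>F n in sequentially. \<forall>w\<in>U \<inter> (XX - {y}). f n w \<in> V" using U(3) by simp
    with ev show "\<forall>\<^sub>F n in sequentially. f n (z n) \<in> V"
      by eventually_elim (use openin_subset[OF U(1)] in auto)
  qed (use assms in simp)
qed

text \<open>The abstract attracting and repelling points are identified as the limits, in the
  compactification, of the elements and of their inverses. Applying the sequence to the fixed point
  id shows that the elements themselves tend to the attracting point.\<close>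

lemma convergence_subseq:
  assumes "inj \<gamma>" "range \<gamma> \<subseteq> \<Gamma>"
  obtains a b r where "strict_mono (r :: nat \<Rightarrow> nat)"
    "lim (\<lambda>n. Inl (\<gamma> (r n))) (Inr a)" "lim (\<lambda>n. Inl (iv (\<gamma> (r n)))) (Inr b)"
    "\<And>z p. lim z p \<Longrightarrow> p \<noteq> Inr b \<Longrightarrow> lim (\<lambda>n. sum_action (\<gamma> (r n)) (z n)) (Inr a)"
proof -
  have "convergence_action \<Gamma> sum_action X.mtopology"
    using compactifying by (simp add: compactifying_topology_def)
  then obtain x y r1 where 1: "x \<in> XX" "y \<in> XX" "strict_mono (r1 :: nat \<Rightarrow> nat)"
    "loc_unif_to_const X.mtopology (XX - {y}) (\<lambda>j. sum_action (\<gamma> (r1 j))) x"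
    using assms unfolding convergence_action_def X.topspace_mtopology
    by (elim conjE allE[of _ \<gamma>]) (elim impE bexE exE conjE, blast, rule that)
  have mem: "\<gamma> n \<in> \<Gamma>" for n using assms(2) by auto
  obtain w r2 where 2: "w \<in> XX" "strict_mono (r2 :: nat \<Rightarrow> nat)"
    "lim ((\<lambda>n. Inl (iv (\<gamma> (r1 n)))) \<circ> r2) w"
    by (rule subseq_lim[of "\<lambda>n. Inl (iv (\<gamma> (r1 n)))"]) (use mem in auto)
  define r where "r = r1 \<circ> r2"
  have r: "strict_mono r" using 1 2 by (simp add: r_def strict_mono_o)
  have loc: "loc_unif_to_const X.mtopology (XX - {y}) (\<lambda>j. sum_action (\<gamma> (r j))) x"
    unfolding loc_unif_to_const_def
  proof
    fix z assume "z \<in> XX - {y}"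
    from bspec[OF 1(4)[unfolded loc_unif_to_const_def] this]
    obtain U where U: "openin X.mtopology U" "z \<in> U"
      "\<forall>V. openin X.mtopology V \<and> x \<in> V \<longrightarrow>
        (\<forall>\<^sub>F n in sequentially. \<forall>w\<in>U \<inter> (XX - {y}). sum_action (\<gamma> (r1 n)) w \<in> V)"
      by (elim exE conjE)
    have "\<forall>\<^sub>F n in sequentially. \<forall>w\<in>U \<inter> (XX - {y}). sum_action (\<gamma> (r n)) w \<in> V"
      if "openin X.mtopology V \<and> x \<in> V" for V
      using eventually_subseq[OF 2(2) U(3)[rule_format, OF that]] by (simp add: r_def)
    with U(1,2) show "\<exists>U. openin X.mtopology U \<and> z \<in> U \<and> (\<forall>V. openin X.mtopology V \<and> x \<in> V \<longrightarrow>
        (\<forall>\<^sub>F n in sequentially. \<forall>w\<in>U \<inter> (XX - {y}). sum_action (\<gamma> (r n)) w \<in> V))"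
      by (intro exI[of _ U] conjI allI impI)
  qed
  have attract: "lim (\<lambda>n. sum_action (\<gamma> (r n)) (z n)) x" if "lim z p" "p \<noteq> y" for z p
    using loc_unif_lim[OF loc that 1(1)] .
  have w: "lim (\<lambda>n. Inl (iv (\<gamma> (r n)))) w" using 2(3) by (simp add: r_def o_def)
  have injr: "inj (\<gamma> \<circ> r)" using assms(1) r by (simp add: inj_compose strict_mono_imp_inj_on)
  \<comment> \<open>Images of a point of M stay in M, while points of the group are isolated, so the
    attracting point cannot be a group element.\<close>
  have "x \<in> range Inr"
  proof -
    obtain z where z: "Inr z \<noteq> y" by (metis three_points_M sum.inject(2))
    show ?thesis
    proof (cases x)
      case (Inl g)
      then have "g \<in> \<Gamma>" using 1(1) by auto
      moreover have "lim (\<lambda>n. sum_action (\<gamma> (r n)) (Inr z)) (Inl g)"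
        using attract[of "\<lambda>_. Inr z" "Inr z"] z Inl by auto
      ultimately have "\<forall>\<^sub>F n in sequentially. sum_action (\<gamma> (r n)) (Inr z) = Inl g"
        using lim_Inl_eventually by blast
      then show ?thesis by (auto dest: eventually_happens)
    qed auto
  qed
  then obtain a where a: "x = Inr a" by auto
  \<comment> \<open>Otherwise the inverses would be attracted: \<open>\<gamma> (r n)\<close> applied
    to its own inverse is the constant id, which does not tend to a point of M.\<close>
  have "w = y"
  proof (rule ccontr)
    assume "w \<noteq> y"
    from attract[OF w this] have "lim (\<lambda>n. Inl id) x"
      using mem by simp
    then have "x = Inl id" using lim_unique[of "\<lambda>n. Inl id" x "Inl id"] by simp
    with a show False by simp
  qed
  moreover obtain b where b: "w = Inr b"
  proof (rule lim_distinct[of "\<lambda>n. iv (\<gamma> (r n))"])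
    show "inj (\<lambda>n. iv (\<gamma> (r n)))"
      using injr mem by (metis (mono_tags, lifting) comp_apply inj_def inv_inv_elem)
  qed (use mem w in auto)
  moreover have "lim (\<lambda>n. Inl (\<gamma> (r n))) x"
    using attract[of "\<lambda>_. Inl id" "Inl id"] b \<open>w = y\<close> by simp
  ultimately show ?thesis
    using that[OF r] a w attract by blast
qed

text \<open>The uniform form of the convergence property: apart from finitely many g, whatever is
  e-far from the inverse of g is sent e-close to g. Along a sequence of counterexamples the
  witnesses converge to a point other than the repelling one, so their images and the elements share
  the limit a.\<close>

lemma finite_exceptions:
  assumes "e > 0"
  shows "finite {g \<in> \<Gamma>. \<exists>z\<in>XX. d z (Inl (iv g)) \<ge> e \<and> d (sum_action g z) (Inl g) \<ge> e}" (is "finite ?S")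
proof (rule ccontr)
  assume "infinite ?S"
  from infinite_countable_subset[OF this]
  obtain \<gamma> :: "nat \<Rightarrow> 'm \<Rightarrow> 'm" where \<gamma>: "inj \<gamma>" "range \<gamma> \<subseteq> ?S"
    by (elim exE conjE)
  have S: "\<gamma> n \<in> ?S" for n using subsetD[OF \<gamma>(2) rangeI] .
  then have "\<forall>n. \<exists>z. z \<in> XX \<and> d z (Inl (iv (\<gamma> n))) \<ge> e \<and> d (sum_action (\<gamma> n) z) (Inl (\<gamma> n)) \<ge> e"
    unfolding mem_Collect_eq Bex_def by (intro allI) (rule conjunct2)
  from choice[OF this] obtain z where "\<forall>n. z n \<in> XX \<and> d (z n) (Inl (iv (\<gamma> n))) \<ge> e \<and>
      d (sum_action (\<gamma> n) (z n)) (Inl (\<gamma> n)) \<ge> e" ..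
  then have z: "\<And>n. z n \<in> XX" "\<And>n. d (z n) (Inl (iv (\<gamma> n))) \<ge> e"
    "\<And>n. d (sum_action (\<gamma> n) (z n)) (Inl (\<gamma> n)) \<ge> e" by simp_all
  have sub: "range \<gamma> \<subseteq> \<Gamma>" using S by (simp add: image_subset_iff)
  obtain q r0 where q: "strict_mono (r0 :: nat \<Rightarrow> nat)" "lim (z \<circ> r0) q"
    by (rule subseq_lim[of z]) (use z(1) in auto)
  define \<eta> where "\<eta> = \<gamma> \<circ> r0"
  have \<eta>: "inj \<eta>" "range \<eta> \<subseteq> \<Gamma>"
    unfolding \<eta>_def using \<gamma>(1) q(1) sub by (simp_all add: inj_compose strict_mono_imp_inj_on image_subset_iff)
  have mem: "\<eta> n \<in> \<Gamma>" for n using \<eta>(2) by blast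
  have z': "(z \<circ> r0) n \<in> XX" "d ((z \<circ> r0) n) (Inl (iv (\<eta> n))) \<ge> e"
    "d (sum_action (\<eta> n) ((z \<circ> r0) n)) (Inl (\<eta> n)) \<ge> e" for n
    using z[of "r0 n"] by (simp_all add: \<eta>_def)
  obtain a b r where r: "strict_mono (r :: nat \<Rightarrow> nat)"
    "lim (\<lambda>n. Inl (\<eta> (r n))) (Inr a)" "lim (\<lambda>n. Inl (iv (\<eta> (r n)))) (Inr b)"
    "\<And>z p. lim z p \<Longrightarrow> p \<noteq> Inr b \<Longrightarrow> lim (\<lambda>n. sum_action (\<eta> (r n)) (z n)) (Inr a)"
    by (rule convergence_subseq[OF \<eta>]) (rule that)
  have zq: "lim (\<lambda>n. (z \<circ> r0) (r n)) q"
    using lim_subseq[OF q(2) r(1)] unfolding o_def .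
  have "(\<lambda>n. d ((z \<circ> r0) (r n)) (Inl (iv (\<eta> (r n))))) \<longlonglongrightarrow> d q (Inr b)"
    by (rule lim_d[OF zq r(3)]) (use z'(1) mem in \<open>auto intro: InlI\<close>)
  then have "d q (Inr b) \<ge> e" by (rule LIMSEQ_le_const) (use z'(2) in blast)
  then have "q \<noteq> Inr b" using assms X.mdist_zero[of "Inr b"] by auto
  from r(4)[OF zq this]
  have "(\<lambda>n. d (sum_action (\<eta> (r n)) ((z \<circ> r0) (r n))) (Inl (\<eta> (r n)))) \<longlonglongrightarrow> d (Inr a) (Inr a)"
    by (rule lim_d[OF _ r(2)]) (use act_mem[OF mem z'(1)] mem in \<open>auto intro: InlI\<close>)
  then have "d (Inr a) (Inr a) \<ge> e" by (rule LIMSEQ_le_const) (use z'(3) in blast)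
  then show False using assms X.mdist_zero[of "Inr a"] by auto
qed

section \<open>Limit points and accumulation points of the group\<close>

text \<open>The sequences in the definitions of limit points and conical points may repeat elements,
  whereas the convergence property concerns distinct ones. An element repeated infinitely often
  would be constant off x, and injectivity excludes this as M has two more points.\<close>

lemma infinite_range_if_collapsing:
  assumes "range \<gamma> \<subseteq> \<Gamma>" "\<And>y. y \<noteq> x \<Longrightarrow> (\<lambda>n. \<gamma> n y) \<longlonglongrightarrow> b"
  shows "infinite (range \<gamma>)"
proof
  assume "finite (range \<gamma>)"
  then obtain n0 where "infinite {n \<in> UNIV. \<gamma> n = \<gamma> n0}"
    using pigeonhole_infinite[OF infinite_UNIV_nat, of \<gamma>] by auto
  from infinite_enumerate[OF this] obtain r where r: "strict_mono (r :: nat \<Rightarrow> nat)"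
    "\<And>n. \<gamma> (r n) = \<gamma> n0" by auto
  have fix_b: "\<gamma> n0 y = b" if "y \<noteq> x" for y
  proof -
    have "(\<lambda>n. \<gamma> (r n) y) \<longlonglongrightarrow> b"
      using LIMSEQ_subseq_LIMSEQ[OF assms(2)[OF that] r(1)] by (simp add: o_def)
    then show ?thesis by (simp add: r(2) LIMSEQ_const_iff)
  qed
  obtain y where y: "y \<noteq> x" using three_points_M by blast
  obtain y' where y': "y' \<noteq> x" "y' \<noteq> y" using three_points_M by blast
  have "inj (\<gamma> n0)" using assms(1) bij_elem[of "\<gamma> n0"] by (simp add: bij_is_inj image_subset_iff)
  then show False using fix_b[OF y] fix_b[OF y'(1)] y'(2) by (metis injD)
qed

text \<open>The convergence property holds for the action on M and for the action on the
  compactification; the two attracting points agree because both describe the images of one point of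
  M.\<close>

lemma limit_point_in_limit_set:
  assumes "inj \<gamma>" "range \<gamma> \<subseteq> \<Gamma>" "lim (\<lambda>n. Inl (\<gamma> n)) (Inr a)"
  shows "a \<in> limit_set \<Gamma>"
proof -
  have "convergence_action \<Gamma> (\<lambda>\<gamma>. \<gamma>) euclidean"
    using convergence by (simp add: convergence_group_def)
  with assms obtain x y r where r: "strict_mono (r :: nat \<Rightarrow> nat)"
    "loc_unif_to_const euclidean (UNIV - {y}) (\<lambda>j. \<gamma> (r j)) x"
    unfolding convergence_action_def topspace_euclidean by metis
  have x: "x \<in> limit_set \<Gamma>"
    unfolding limit_set_def using r(2) assms(2)
    by (auto simp: Compl_eq_Diff_UNIV image_subset_iff intro!: exI[of _ y] exI[of _ "\<lambda>j. \<gamma> (r j)"])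
  have inj: "inj (\<gamma> \<circ> r)" using assms(1) r(1) by (simp add: inj_compose strict_mono_imp_inj_on)
  have sub: "range (\<gamma> \<circ> r) \<subseteq> \<Gamma>" using assms(2) by (simp add: image_subset_iff)
  obtain a' b r' where r': "strict_mono (r' :: nat \<Rightarrow> nat)"
    "lim (\<lambda>n. Inl ((\<gamma> \<circ> r) (r' n))) (Inr a')"
    "\<And>z p. lim z p \<Longrightarrow> p \<noteq> Inr b \<Longrightarrow> lim (\<lambda>n. sum_action ((\<gamma> \<circ> r) (r' n)) (z n)) (Inr a')"
    by (rule convergence_subseq[OF inj sub]) (rule that)
  \<comment> \<open>A test point avoiding the repelling points of both actions.\<close>
  obtain z where z: "z \<noteq> b" "z \<noteq> y" using three_points_M by blast
  have "lim (\<lambda>n. sum_action ((\<gamma> \<circ> r) (r' n)) (Inr z)) (Inr a')"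
    by (rule r'(3)[of "\<lambda>_. Inr z" "Inr z"]) (use z(1) in simp_all)
  then have 1: "(\<lambda>n. \<gamma> (r (r' n)) z) \<longlonglongrightarrow> a'" by (simp add: lim_Inr)
  have "(\<lambda>n. \<gamma> (r n) z) \<longlonglongrightarrow> x"
    using r(2) z(2) unfolding loc_unif_to_const_def tendsto_def
    by (force elim: eventually_mono)
  then have "(\<lambda>n. \<gamma> (r (r' n)) z) \<longlonglongrightarrow> x" using LIMSEQ_subseq_LIMSEQ[OF _ r'(1)] by (simp add: o_def)
  then have "a' = x" using 1 LIMSEQ_unique by blast
  moreover have "lim (\<lambda>n. Inl ((\<gamma> \<circ> r) (r' n))) (Inr a)"
    using lim_subseq[OF assms(3) strict_mono_o[OF r(1) r'(1)]] by (simp add: o_def)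
  from lim_unique[OF r'(2) this] have "a' = a" by simp
  ultimately show ?thesis using x by simp
qed

lemma limit_set_approx:
  assumes "q \<in> limit_set \<Gamma>" "e > 0"
  shows "infinite {g \<in> \<Gamma>. d (Inl g) (Inr q) < e}"
proof -
  from assms(1) obtain y \<gamma> where g: "range \<gamma> \<subseteq> \<Gamma>" "loc_unif_to_const euclidean (- {y}) \<gamma> q"
    unfolding limit_set_def by blast
  have conv: "(\<lambda>n. \<gamma> n z) \<longlonglongrightarrow> q" if "z \<noteq> y" for z
    using g(2) that unfolding loc_unif_to_const_def tendsto_def
    by (force elim: eventually_mono)
  obtain r where r: "strict_mono (r :: nat \<Rightarrow> nat)" "inj (\<gamma> \<circ> r)"
    by (rule distinct_subseq[OF infinite_range_if_collapsing[OF g(1) conv]])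
  have sub: "range (\<gamma> \<circ> r) \<subseteq> \<Gamma>" using g(1) by (simp add: image_subset_iff)
  obtain a b r' where r': "strict_mono (r' :: nat \<Rightarrow> nat)"
    "lim (\<lambda>n. Inl ((\<gamma> \<circ> r) (r' n))) (Inr a)"
    "\<And>z p. lim z p \<Longrightarrow> p \<noteq> Inr b \<Longrightarrow> lim (\<lambda>n. sum_action ((\<gamma> \<circ> r) (r' n)) (z n)) (Inr a)"
    by (rule convergence_subseq[OF r(2) sub]) (rule that)
  obtain z where z: "z \<noteq> b" "z \<noteq> y" using three_points_M by blast
  have "lim (\<lambda>n. sum_action ((\<gamma> \<circ> r) (r' n)) (Inr z)) (Inr a)"
    by (rule r'(3)[of "\<lambda>_. Inr z" "Inr z"]) (use z(1) in simp_all)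
  then have "(\<lambda>n. \<gamma> (r (r' n)) z) \<longlonglongrightarrow> a" by (simp add: lim_Inr)
  moreover have "(\<lambda>n. \<gamma> (r (r' n)) z) \<longlonglongrightarrow> q"
    using LIMSEQ_subseq_LIMSEQ[OF conv[OF z(2)] strict_mono_o[OF r(1) r'(1)]] by (simp add: o_def)
  ultimately have "a = q" using LIMSEQ_unique by blast
  have mem: "\<gamma> n \<in> \<Gamma>" for n using g(1) by (simp add: image_subset_iff)
  have "(\<lambda>n. d (Inl ((\<gamma> \<circ> r) (r' n))) (Inr q)) \<longlonglongrightarrow> d (Inr q) (Inr q)"
    by (rule lim_d[OF r'(2)[unfolded \<open>a = q\<close>]]) (simp_all add: image_subset_iff mem)
  then have "\<forall>\<^sub>F n in sequentially. d (Inl ((\<gamma> \<circ> r) (r' n))) (Inr q) < e"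
    by (rule order_tendstoD(2)) (use assms(2) X.mdist_zero[of "Inr q"] in simp)
  then obtain N where N: "\<And>n. n \<ge> N \<Longrightarrow> d (Inl ((\<gamma> \<circ> r) (r' n))) (Inr q) < e"
    by (auto simp: eventually_sequentially)
  have "inj ((\<gamma> \<circ> r) \<circ> r')" using r(2) r'(1) by (simp add: inj_compose strict_mono_imp_inj_on del: o_apply)
  then have "infinite (((\<gamma> \<circ> r) \<circ> r') ` {N..})"
    using finite_imageD[of "(\<gamma> \<circ> r) \<circ> r'" "{N..}"] infinite_Ici[of N] by (meson inj_on_subset subset_UNIV)
  moreover have "((\<gamma> \<circ> r) \<circ> r') ` {N..} \<subseteq> {g \<in> \<Gamma>. d (Inl g) (Inr q) < e}"
    using N mem by (simp add: image_subset_iff)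
  ultimately show ?thesis using finite_subset by blast
qed

subsection \<open>Shadows and conical limit points\<close>

text \<open>Membership is tested at \<open>iv g x\<close>, so a shadow is a preimage under a
  continuous map; \<open>shadow_image\<close> gives the image form suited to measures. A smaller e
  makes a larger shadow.\<close>

definition shadow :: "real \<Rightarrow> ('m \<Rightarrow> 'm) \<Rightarrow> 'm set" where
  "shadow e g = {x. d (Inr (iv g x)) (Inl (iv g)) > e}"

lemma closed_d_le:
  assumes "p \<in> XX"
  shows "closed {y. d (Inr y) p \<le> c}"
  unfolding closed_sequential_limits
proof (intro allI impI, elim conjE)
  fix x l assume x: "\<forall>n. x n \<in> {y. d (Inr y) p \<le> c}" "x \<longlonglongrightarrow> l"
  have "(\<lambda>n. d (Inr (x n)) p) \<longlonglongrightarrow> d (Inr l) p"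
    by (rule lim_d) (use x(2) assms in \<open>simp_all add: lim_Inr image_subset_iff\<close>)
  then have "d (Inr l) p \<le> c" by (rule LIMSEQ_le_const2) (use x(1) in simp)
  then show "l \<in> {y. d (Inr y) p \<le> c}" by simp
qed

lemma open_d_greater:
  assumes "p \<in> XX"
  shows "open {y. d (Inr y) p > c}"
proof -
  have "{y. d (Inr y) p > c} = - {y. d (Inr y) p \<le> c}" by auto
  then show ?thesis using open_Compl[OF closed_d_le[OF assms, of c]] by simp
qed

lemma open_shadow:
  assumes "g \<in> \<Gamma>"
  shows "open (shadow e g)"
proof -
  have "open (iv g -` {y. d (Inr y) (Inl (iv g)) > e})"
    using cont_elem[OF inv_mem[OF assms]] open_d_greater[of "Inl (iv g)" e] assms
    by (intro open_vimage) simp_all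
  then show ?thesis by (simp add: shadow_def vimage_def)
qed

lemma shadow_image:
  assumes "g \<in> \<Gamma>"
  shows "shadow e g = g ` {y. d (Inr y) (Inl (iv g)) > e}"
proof (intro subset_antisym subsetI)
  fix x assume "x \<in> shadow e g"
  then show "x \<in> g ` {y. d (Inr y) (Inl (iv g)) > e}"
    using assms by (intro image_eqI[of _ _ "iv g x"]) (simp_all add: shadow_def)
qed (use assms in \<open>auto simp: shadow_def\<close>)

lemma shadow_mono: "e \<le> e' \<Longrightarrow> shadow e' g \<subseteq> shadow e g"
  by (auto simp: shadow_def)

lemma shadow_small:
  assumes "e > 0" "e' > 0"
  shows "finite {g \<in> \<Gamma>. \<exists>x\<in>shadow e g. d (Inr x) (Inl g) \<ge> e'}"
proof (rule finite_subset)
  show "finite {g \<in> \<Gamma>. \<exists>z\<in>XX. d z (Inl (iv g)) \<ge> min e e' \<and> d (sum_action g z) (Inl g) \<ge> min e e'}"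
    by (rule finite_exceptions) (use assms in simp)
  show "{g \<in> \<Gamma>. \<exists>x\<in>shadow e g. d (Inr x) (Inl g) \<ge> e'} \<subseteq>
    {g \<in> \<Gamma>. \<exists>z\<in>XX. d z (Inl (iv g)) \<ge> min e e' \<and> d (sum_action g z) (Inl g) \<ge> min e e'}"
  proof (intro subsetI CollectI, elim CollectE conjE bexE, intro conjI)
    fix g x assume g: "g \<in> \<Gamma>" "x \<in> shadow e g" "d (Inr x) (Inl g) \<ge> e'"
    show "\<exists>z\<in>XX. d z (Inl (iv g)) \<ge> min e e' \<and> d (sum_action g z) (Inl g) \<ge> min e e'"
      by (rule bexI[of _ "Inr (iv g x)"]) (use g in \<open>simp_all add: shadow_def min_le_iff_disj\<close>)
  qed
qed

section \<open>Conical points as points in infinitely many shadows\<close>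

definition limsup_shadow :: "real \<Rightarrow> 'm set" where
  "limsup_shadow e = {x. infinite {g \<in> \<Gamma>. x \<in> shadow e g}}"

lemma limsup_shadow_mono: "e \<le> e' \<Longrightarrow> limsup_shadow e' \<subseteq> limsup_shadow e"
  unfolding limsup_shadow_def
  by (intro subsetI CollectI, drule CollectD, erule infinite_super[rotated]) (auto dest: subsetD[OF shadow_mono])

text \<open>Pass to the inverses \<open>\<eta>\<close>. They tend to b, yet
  \<open>\<eta> n x\<close> stays at distance e from \<open>\<eta> n\<close>, so x is not attracted
  to b. Hence x is the repelling point q, which is the limit of the original elements and so a limit
  point; every other point is attracted to b.\<close>

lemma limsup_shadow_conical:
  assumes "e > 0" "x \<in> limsup_shadow e"
  shows "x \<in> conical_limit_set \<Gamma>"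
proof -
  from infinite_countable_subset[OF assms(2)[unfolded limsup_shadow_def mem_Collect_eq]]
  obtain \<gamma> :: "nat \<Rightarrow> 'm \<Rightarrow> 'm" where \<gamma>: "inj \<gamma>" "range \<gamma> \<subseteq> {g \<in> \<Gamma>. x \<in> shadow e g}"
    by (elim exE conjE)
  have S: "\<gamma> n \<in> \<Gamma>" "x \<in> shadow e (\<gamma> n)" for n using \<gamma>(2) by (simp_all add: image_subset_iff)
  define \<eta> where "\<eta> = (\<lambda>n. iv (\<gamma> n))"
  have mem: "\<eta> n \<in> \<Gamma>" for n using S by (simp add: \<eta>_def)
  then have sub: "range \<eta> \<subseteq> \<Gamma>" by (simp add: image_subset_iff)
  have inj: "inj \<eta>"
    by (rule injI, rule injD[OF \<gamma>(1)]) (metis S(1) \<eta>_def inv_inv_elem)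
  obtain b q r where r: "strict_mono (r :: nat \<Rightarrow> nat)"
    "lim (\<lambda>n. Inl (\<eta> (r n))) (Inr b)" "lim (\<lambda>n. Inl (iv (\<eta> (r n)))) (Inr q)"
    "\<And>z p. lim z p \<Longrightarrow> p \<noteq> Inr q \<Longrightarrow> lim (\<lambda>n. sum_action (\<eta> (r n)) (z n)) (Inr b)"
    by (rule convergence_subseq[OF inj sub]) (rule that)
  have seq: "(\<lambda>n. \<eta> (r n) y) \<longlonglongrightarrow> b" if "y \<noteq> q" for y
  proof -
    have "lim (\<lambda>n. sum_action (\<eta> (r n)) (Inr y)) (Inr b)"
      by (rule r(4)[of "\<lambda>_. Inr y" "Inr y"]) (use that in simp_all)
    then show ?thesis by (simp add: lim_Inr)
  qed
  obtain a r2 where r2: "strict_mono (r2 :: nat \<Rightarrow> nat)" "((\<lambda>n. \<eta> (r n) x) \<circ> r2) \<longlonglongrightarrow> a"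
    using compact_imp_seq_compact[OF compact_UNIV] unfolding seq_compact_def by (metis UNIV_I)
  then have a: "(\<lambda>n. \<eta> (r (r2 n)) x) \<longlonglongrightarrow> a" by (simp add: o_def)
  have "(\<lambda>n. d (Inr (\<eta> (r (r2 n)) x)) (Inl (\<eta> (r (r2 n))))) \<longlonglongrightarrow> d (Inr a) (Inr b)"
  proof (rule lim_d)
    show "lim (\<lambda>n. Inl (\<eta> (r (r2 n)))) (Inr b)"
      using lim_subseq[OF r(2) r2(1)] by (simp add: o_def)
  qed (use a in \<open>simp_all add: lim_Inr image_subset_iff mem\<close>)
  then have "e \<le> d (Inr a) (Inr b)"
    by (rule LIMSEQ_le_const) (use S(2) in \<open>auto simp: shadow_def \<eta>_def less_imp_le\<close>)
  then have ab: "a \<noteq> b" using assms(1) X.mdist_zero[of "Inr b"] by auto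
  have xq: "x = q"
  proof (rule ccontr)
    assume "x \<noteq> q"
    from LIMSEQ_subseq_LIMSEQ[OF seq[OF this] r2(1)] have "(\<lambda>n. \<eta> (r (r2 n)) x) \<longlonglongrightarrow> b"
      by (simp add: o_def)
    with a ab show False using LIMSEQ_unique by blast
  qed
  have "x \<in> limit_set \<Gamma>"
    unfolding xq
  proof (rule limit_point_in_limit_set)
    show "inj (\<lambda>n. \<gamma> (r n))" using inj_compose[OF \<gamma>(1) strict_mono_imp_inj_on[OF r(1)]] by (simp add: o_def)
    show "lim (\<lambda>n. Inl (\<gamma> (r n))) (Inr q)" using r(3) S(1) by (simp add: \<eta>_def)
  qed (use S(1) in \<open>simp add: image_subset_iff\<close>)
  moreover have "(\<lambda>n. \<eta> (r (r2 n)) y) \<longlonglongrightarrow> b" if "y \<noteq> x" for y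
    using LIMSEQ_subseq_LIMSEQ[OF seq r2(1), of y] that xq by (simp add: o_def)
  ultimately show ?thesis
    unfolding conical_limit_set_def using a ab mem
    by (intro CollectI conjI exI[of _ a] exI[of _ b] exI[of _ "\<lambda>n. \<eta> (r (r2 n))"])
       (simp_all add: image_subset_iff)
qed

text \<open>In the compactification the elements of a conical sequence subconverge to the same b as
  the images of points other than x. Thus the images of x, which tend to a, stay away from the
  elements themselves, and x lies in the shadows of the inverses.\<close>

lemma conical_limsup_shadow:
  assumes "x \<in> conical_limit_set \<Gamma>"
  shows "\<exists>n. x \<in> limsup_shadow (1 / Suc n)"
proof -
  obtain a b \<gamma> where g: "a \<noteq> b" "range \<gamma> \<subseteq> \<Gamma>" "(\<lambda>n. \<gamma> n x) \<longlonglongrightarrow> a"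
    "\<And>y. y \<noteq> x \<Longrightarrow> (\<lambda>n. \<gamma> n y) \<longlonglongrightarrow> b"
    using assms unfolding conical_limit_set_def by blast
  obtain r where r: "strict_mono (r :: nat \<Rightarrow> nat)" "inj (\<gamma> \<circ> r)"
    by (rule distinct_subseq[OF infinite_range_if_collapsing[OF g(2,4)]])
  have mem: "\<gamma> n \<in> \<Gamma>" for n using g(2) by (simp add: image_subset_iff)
  have sub: "range (\<gamma> \<circ> r) \<subseteq> \<Gamma>" by (simp add: image_subset_iff mem)
  obtain a' b' r' where r': "strict_mono (r' :: nat \<Rightarrow> nat)"
    "lim (\<lambda>n. Inl ((\<gamma> \<circ> r) (r' n))) (Inr a')"
    "\<And>z p. lim z p \<Longrightarrow> p \<noteq> Inr b' \<Longrightarrow> lim (\<lambda>n. sum_action ((\<gamma> \<circ> r) (r' n)) (z n)) (Inr a')"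
    by (rule convergence_subseq[OF r(2) sub]) (rule that)
  define \<eta> where "\<eta> = \<gamma> \<circ> r \<circ> r'"
  have rr: "strict_mono (r \<circ> r')" using r(1) r'(1) by (rule strict_mono_o)
  have \<eta>: "\<eta> n \<in> \<Gamma>" for n by (simp add: \<eta>_def mem)
  have inj: "inj \<eta>" unfolding \<eta>_def using r(2) r'(1)
    by (simp add: inj_compose strict_mono_imp_inj_on del: o_apply)
  have 1: "(\<lambda>n. \<eta> n x) \<longlonglongrightarrow> a"
    using LIMSEQ_subseq_LIMSEQ[OF g(3) rr] by (simp add: o_def \<eta>_def)
  have 2: "(\<lambda>n. \<eta> n y) \<longlonglongrightarrow> b" if "y \<noteq> x" for y
    using LIMSEQ_subseq_LIMSEQ[OF g(4)[OF that] rr] by (simp add: o_def \<eta>_def)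
  have 3: "(\<lambda>n. \<eta> n y) \<longlonglongrightarrow> a'" if "y \<noteq> b'" for y
  proof -
    have "lim (\<lambda>n. sum_action ((\<gamma> \<circ> r) (r' n)) (Inr y)) (Inr a')"
      by (rule r'(3)[of "\<lambda>_. Inr y" "Inr y"]) (use that in simp_all)
    then show ?thesis by (simp add: lim_Inr \<eta>_def)
  qed
  obtain z where z: "z \<noteq> x" "z \<noteq> b'" using three_points_M by blast
  have a': "a' = b" using 2[OF z(1)] 3[OF z(2)] LIMSEQ_unique by blast
  have "(\<lambda>n. d (Inr (\<eta> n x)) (Inl (\<eta> n))) \<longlonglongrightarrow> d (Inr a) (Inr b)"
    by (rule lim_d) (use 1 r'(2) \<eta> in \<open>simp_all add: lim_Inr image_subset_iff a' \<eta>_def\<close>)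
  moreover have "d (Inr a) (Inr b) > 0"
    using g(1) X.mdist_pos_eq[of "Inr a" "Inr b"] by simp
  then obtain k where k: "1 / Suc k < d (Inr a) (Inr b)"
    using nat_approx_posE by blast
  ultimately have "\<forall>\<^sub>F n in sequentially. d (Inr (\<eta> n x)) (Inl (\<eta> n)) > 1 / Suc k"
    using order_tendstoD(1) by blast
  then obtain N where N: "\<And>n. n \<ge> N \<Longrightarrow> d (Inr (\<eta> n x)) (Inl (\<eta> n)) > 1 / Suc k"
    by (auto simp: eventually_sequentially)
  have "inj (\<lambda>n. iv (\<eta> n))"
    by (rule injI, rule injD[OF inj]) (metis \<eta> inv_inv_elem)
  then have "infinite ((\<lambda>n. iv (\<eta> n)) ` {N..})"
    using finite_imageD[of "\<lambda>n. iv (\<eta> n)" "{N..}"] infinite_Ici[of N] by (meson inj_on_subset subset_UNIV)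
  moreover have "(\<lambda>n. iv (\<eta> n)) ` {N..} \<subseteq> {g \<in> \<Gamma>. x \<in> shadow (1 / Suc k) g}"
    using N \<eta> by (simp add: image_subset_iff shadow_def)
  ultimately show ?thesis unfolding limsup_shadow_def using finite_subset by blast
qed

lemma conical_eq: "conical_limit_set \<Gamma> = (\<Union>n. limsup_shadow (1 / Suc n))"
  using conical_limsup_shadow limsup_shadow_conical[of "1 / Suc n" for n] by fastforce

section \<open>Invariance of the limit sets\<close>

lemma limit_set_image:
  assumes "h \<in> \<Gamma>" "x \<in> limit_set \<Gamma>"
  shows "h x \<in> limit_set \<Gamma>"
proof -
  from assms(2) obtain y \<gamma> where g: "range \<gamma> \<subseteq> \<Gamma>" "loc_unif_to_const euclidean (- {y}) \<gamma> x"
    unfolding limit_set_def by blast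
  have "loc_unif_to_const euclidean (- {y}) (\<lambda>n. h \<circ> \<gamma> n) (h x)"
    unfolding loc_unif_to_const_def
  proof
    fix z assume "z \<in> - {y}"
    from bspec[OF g(2)[unfolded loc_unif_to_const_def] this]
    obtain U where U: "openin euclidean U" "z \<in> U"
      "\<And>V. open V \<Longrightarrow> x \<in> V \<Longrightarrow> (\<forall>\<^sub>F n in sequentially. \<forall>w\<in>U \<inter> - {y}. \<gamma> n w \<in> V)"
      by auto
    have "\<forall>\<^sub>F n in sequentially. \<forall>w\<in>U \<inter> - {y}. (h \<circ> \<gamma> n) w \<in> V" if "openin euclidean V \<and> h x \<in> V" for V
      using U(3)[of "h -` V"] that open_vimage[OF _ cont_elem[OF assms(1)], of V] by simp
    with U(1,2) show "\<exists>U. openin euclidean U \<and> z \<in> U \<and> (\<forall>V. openin euclidean V \<and> h x \<in> V \<longrightarrow>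
        (\<forall>\<^sub>F n in sequentially. \<forall>w\<in>U \<inter> - {y}. (h \<circ> \<gamma> n) w \<in> V))"
      by (intro exI[of _ U] conjI allI impI)
  qed
  moreover have "range (\<lambda>n. h \<circ> \<gamma> n) \<subseteq> \<Gamma>" using g(1) assms(1) by (simp add: image_subset_iff)
  ultimately show ?thesis unfolding limit_set_def by blast
qed

lemma invariantI:
  assumes "\<And>h x. h \<in> \<Gamma> \<Longrightarrow> x \<in> A \<Longrightarrow> h x \<in> A" "g \<in> \<Gamma>"
  shows "g ` A = A"
proof
  show "A \<subseteq> g ` A"
  proof
    fix x assume "x \<in> A"
    then have "iv g x \<in> A" using assms by simp
    then show "x \<in> g ` A" using assms(2) by (intro image_eqI[of _ _ "iv g x"]) simp_all
  qed
qed (use assms in auto)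

lemma conical_invariant:
  assumes "g \<in> \<Gamma>"
  shows "g ` conical_limit_set \<Gamma> = conical_limit_set \<Gamma>"
proof (rule invariantI[OF _ assms])
  fix h x assume h: "h \<in> \<Gamma>" and x: "x \<in> conical_limit_set \<Gamma>"
  obtain a b \<gamma> where g: "x \<in> limit_set \<Gamma>" "a \<noteq> b" "range \<gamma> \<subseteq> \<Gamma>" "(\<lambda>n. \<gamma> n x) \<longlonglongrightarrow> a"
    "\<And>y. y \<noteq> x \<Longrightarrow> (\<lambda>n. \<gamma> n y) \<longlonglongrightarrow> b"
    using x unfolding conical_limit_set_def by blast
  have 1: "range (\<lambda>n. \<gamma> n \<circ> iv h) \<subseteq> \<Gamma>" using g(3) h by (simp add: image_subset_iff)
  have 2: "(\<lambda>n. (\<gamma> n \<circ> iv h) (h x)) \<longlonglongrightarrow> a" using g(4) h by simp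
  have "(\<lambda>n. (\<gamma> n \<circ> iv h) y) \<longlonglongrightarrow> b" if "y \<noteq> h x" for y
    unfolding o_apply by (rule g(5)) (use inv_app(2)[OF h, of y] that in fastforce)
  with 1 2 g(2) limit_set_image[OF h g(1)] show "h x \<in> conical_limit_set \<Gamma>"
    unfolding conical_limit_set_def by blast
qed

end

subsection \<open>Overlapping shadows of an expanding coarse-cocycle\<close>

locale expanding_group = compactified_group \<Gamma> d
  for \<Gamma> :: "('m::polish_space \<Rightarrow> 'm) set"
    and d :: "('m \<Rightarrow> 'm) + 'm \<Rightarrow> ('m \<Rightarrow> 'm) + 'm \<Rightarrow> real" +
  fixes \<sigma> :: "('m \<Rightarrow> 'm) \<Rightarrow> 'm \<Rightarrow> real"
    and mag :: "('m \<Rightarrow> 'm) \<Rightarrow> real"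
    and \<delta> :: real
  assumes expanding: "expanding_coarse_cocycle \<Gamma> d \<sigma>"
    and magnitude: "magnitude \<Gamma> d \<sigma> mag"
    and exponent: "critical_exponent \<Gamma> mag = ereal \<delta>"
begin

section \<open>Cocycle estimates and finiteness of magnitude sublevels\<close>

definition \<kappa> :: real where
  "\<kappa> = (SOME \<kappa>. \<kappa> \<ge> 0 \<and> coarse_cocycle_const \<Gamma> \<sigma> \<kappa>)"

lemma kappa: "\<kappa> \<ge> 0" "coarse_cocycle_const \<Gamma> \<sigma> \<kappa>"
proof -
  have "\<exists>\<kappa>. \<kappa> \<ge> 0 \<and> coarse_cocycle_const \<Gamma> \<sigma> \<kappa>"
    using expanding by (auto simp: expanding_coarse_cocycle_def coarse_cocycle_def)
  from someI_ex[OF this] show "\<kappa> \<ge> 0" "coarse_cocycle_const \<Gamma> \<sigma> \<kappa>"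
    by (simp_all add: \<kappa>_def)
qed

lemma cocycle:
  assumes "g \<in> \<Gamma>" "h \<in> \<Gamma>"
  shows "\<bar>\<sigma> (g \<circ> h) x - (\<sigma> g (h x) + \<sigma> h x)\<bar> \<le> \<kappa>"
  using kappa(2) assms unfolding coarse_cocycle_const_def by blast

lemma sigma_id: "\<bar>\<sigma> id x\<bar> \<le> \<kappa>"
  using cocycle[OF id_mem id_mem, of x] by simp

lemma sigma_inv:
  assumes "g \<in> \<Gamma>"
  shows "\<bar>\<sigma> (iv g) (g x) + \<sigma> g x\<bar> \<le> 2 * \<kappa>"
  using cocycle[OF inv_mem[OF assms] assms, of x] sigma_id[of x] assms by simp

lemma mag_bound:
  assumes "e > 0"
  obtains C where "C > 0"
    "\<And>g x. g \<in> \<Gamma> \<Longrightarrow> d (Inr x) (Inl (iv g)) > e \<Longrightarrow> \<bar>\<sigma> g x - mag g\<bar> \<le> C"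
proof -
  obtain C where C: "C > 0" "\<And>g x. g \<in> \<Gamma> \<Longrightarrow> d (Inr x) (Inl (iv g)) > e \<Longrightarrow>
      mag g - C \<le> \<sigma> g x \<and> \<sigma> g x \<le> mag g + C"
    using magnitude assms unfolding magnitude_def by blast
  show ?thesis
    by (rule that[OF C(1)]) (drule (1) C(2), simp add: abs_le_iff)
qed

text \<open>A finite exponent means that the series converges for some s > 0, the infimum of the
  empty set being infinite; infinitely many terms of size at least exp(-s t) would make it
  diverge.\<close>

lemma finite_mag: "finite {g \<in> \<Gamma>. mag g \<le> t}"
proof (rule ccontr)
  assume inf: "infinite {g \<in> \<Gamma>. mag g \<le> t}"
  have "{ereal s | s. s > 0 \<and> poincare_series \<Gamma> mag s < \<infinity>} \<noteq> {}"
    using exponent unfolding critical_exponent_def by (metis Inf_empty PInfty_neq_ereal(1) top_ereal_def)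
  then obtain s where s: "s > 0" "poincare_series \<Gamma> mag s < \<infinity>" by auto
  have "infsum (\<lambda>g. ennreal (exp (- s * mag g))) {g \<in> \<Gamma>. mag g \<le> t} = \<infinity>"
    by (rule infsum_superconst_infinite_ennreal[of _ "ennreal (exp (- s * t))"])
       (use s(1) inf in \<open>auto intro!: ennreal_leI\<close>)
  moreover have "infsum (\<lambda>g. ennreal (exp (- s * mag g))) {g \<in> \<Gamma>. mag g \<le> t} \<le> poincare_series \<Gamma> mag s"
    unfolding poincare_series_def by (rule infsum_mono_neutral[OF nonneg_summable_on_complete nonneg_summable_on_complete]) auto
  ultimately show False using s(2) by simp
qed

lemma finite_mag_inv: "finite {g \<in> \<Gamma>. mag (iv g) \<le> t}"
proof -
  have "{g \<in> \<Gamma>. mag (iv g) \<le> t} \<subseteq> inv_into UNIV ` {g \<in> \<Gamma>. mag g \<le> t}"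
    by (intro subsetI, rule_tac x = "iv x" in image_eqI) auto
  then show ?thesis using finite_mag finite_subset by blast
qed

lemma countable_Gamma: "countable \<Gamma>"
proof -
  have "\<Gamma> = (\<Union>n::nat. {g \<in> \<Gamma>. mag g \<le> real n})"
    using real_arch_simple by blast
  moreover have "countable (\<Union>n::nat. {g \<in> \<Gamma>. mag g \<le> real n})"
    using finite_mag by (intro countable_UN) (auto intro: countable_finite)
  ultimately show ?thesis by simp
qed

lemma delta_nonneg: "\<delta> \<ge> 0"
proof -
  have "ereal 0 \<le> critical_exponent \<Gamma> mag"
    unfolding critical_exponent_def by (rule Inf_greatest) auto
  then show ?thesis using exponent by simp
qed

section \<open>Geometry of overlapping shadows\<close>

text \<open>For b = g^-1 h and y = h^-1 x the cocycle identity gives \<sigma>(b, y) = mag h - mag g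
  up to a constant. This bounds mag b once y is far from b^-1. That holds because b^-1 sends g^-1 to
  h^-1: if g^-1 is far from b, then h^-1 is close to b^-1, and y is far from h^-1. The set F
  collects the finitely many b for which this fails. The position estimates for b outside F are
  exported for the enlargement of shadows.\<close>

lemma shadow_transition:
  assumes "e > 0"
  obtains F K where "finite F" "K \<ge> 0"
    "\<And>g h x. g \<in> \<Gamma> \<Longrightarrow> h \<in> \<Gamma> \<Longrightarrow> mag g \<le> mag h \<Longrightarrow> x \<in> shadow e g \<Longrightarrow> x \<in> shadow e h \<Longrightarrow>
      mag (iv g \<circ> h) \<le> mag h - mag g + K"
    "\<And>g h x. g \<in> \<Gamma> \<Longrightarrow> h \<in> \<Gamma> \<Longrightarrow> mag g \<le> mag h \<Longrightarrow> x \<in> shadow e g \<Longrightarrow> x \<in> shadow e h \<Longrightarrow>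
      iv g \<circ> h \<notin> F \<Longrightarrow> d (Inl (iv g)) (Inl (iv g \<circ> h)) \<ge> e / 2
        \<and> d (Inl (iv h)) (Inl (iv (iv g \<circ> h))) < e / 2"
proof -
  obtain C1 where C1: "C1 > 0"
    "\<And>g x. g \<in> \<Gamma> \<Longrightarrow> d (Inr x) (Inl (iv g)) > e \<Longrightarrow> \<bar>\<sigma> g x - mag g\<bar> \<le> C1"
    using mag_bound[OF assms] by metis
  have e2: "e / 2 > 0" using assms by simp
  obtain C2 where C2: "C2 > 0"
    "\<And>g x. g \<in> \<Gamma> \<Longrightarrow> d (Inr x) (Inl (iv g)) > e / 2 \<Longrightarrow> \<bar>\<sigma> g x - mag g\<bar> \<le> C2"
    using mag_bound[OF e2] by metis
  define B where "B = {g \<in> \<Gamma>. \<exists>z\<in>XX. d z (Inl (iv g)) \<ge> e / 2 \<and> d (sum_action g z) (Inl g) \<ge> e / 2}"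
  have finB: "finite B" unfolding B_def by (rule finite_exceptions[OF e2])
  \<comment> \<open>The bound on mag b^-1 when g^-1 is close to b: 2 C1 from the two shadows,
    \<kappa> from the cocycle identity, 2 \<kappa> from inverting b, and C2 for reading off the
    magnitude at b y.\<close>
  define L where "L = 2 * C1 + 3 * \<kappa> + C2"
  define F where "F = inv_into UNIV ` B \<union> {b \<in> \<Gamma>. mag (iv b) \<le> L}"
  have finF: "finite F" using finB finite_mag_inv by (simp add: F_def)
  define K0 where "K0 = Max (insert 0 (mag ` F))"
  have K0: "K0 \<ge> 0" "\<And>b. b \<in> F \<Longrightarrow> mag b \<le> K0" using finF by (simp_all add: K0_def)
  define K where "K = K0 + 2 * C1 + \<kappa> + C2"
  have K_ge: "K \<ge> 0" using K0 C1 C2 kappa by (simp add: K_def)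
  have main: "(b \<notin> F \<longrightarrow> d (Inl (iv g)) (Inl b) \<ge> e / 2 \<and> d (Inl (iv h)) (Inl (iv b)) < e / 2)
      \<and> mag b \<le> mag h - mag g + K"
    if g: "g \<in> \<Gamma>" and h: "h \<in> \<Gamma>" and le: "mag g \<le> mag h" and x: "x \<in> shadow e g" "x \<in> shadow e h"
      and b_def: "b = iv g \<circ> h" for g h x b
  proof -
    have b: "b \<in> \<Gamma>" using g h by (simp add: b_def)
    define y where "y = iv h x"
    have byx: "b y = iv g x" using h by (simp add: b_def y_def)
    have hb: "h = g \<circ> b" using g by (simp add: b_def o_assoc)
    have s1: "\<bar>\<sigma> g (b y) - mag g\<bar> \<le> C1" using C1(2)[OF g, of "b y"] x(1) by (simp add: byx shadow_def)
    have s2: "\<bar>\<sigma> h y - mag h\<bar> \<le> C1" using C1(2)[OF h, of y] x(2) by (simp add: y_def shadow_def)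
    have sb: "\<bar>\<sigma> b y - (mag h - mag g)\<bar> \<le> 2 * C1 + \<kappa>"
      using cocycle[OF g b, of y] s1 s2 unfolding hb[symmetric] by (simp add: abs_le_iff)
    have X: "Inr y \<in> XX" "Inr (b y) \<in> XX" "Inl (iv g) \<in> XX" "Inl (iv h) \<in> XX" "Inl b \<in> XX" "Inl (iv b) \<in> XX"
      using g h b by simp_all
    show ?thesis
    proof (cases "b \<in> F")
      case True
      then show ?thesis using K0(2) C1(1) C2(1) kappa(1) le by (fastforce simp: K_def)
    next
      case False
      \<comment> \<open>If g^-1 were close to b, then b y would be far from b, so \<sigma>(b^-1, b
        y) would be mag b^-1 up to a constant. It is also about mag g - mag h, hence bounded above,
        and b would belong to F.\<close>
      have far: "d (Inl (iv g)) (Inl b) \<ge> e / 2"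
      proof (rule ccontr)
        assume near: "\<not> d (Inl (iv g)) (Inl b) \<ge> e / 2"
        have "d (Inr (b y)) (Inl (iv g)) > e" using x(1) by (simp add: byx shadow_def)
        then have "d (Inr (b y)) (Inl b) > e / 2"
          using X.triangle[OF X(2,5,3)] near X.commute[of "Inl b" "Inl (iv g)"] by linarith
        then have "\<bar>\<sigma> (iv b) (b y) - mag (iv b)\<bar> \<le> C2"
          using C2(2)[OF inv_mem[OF b], of "b y"] b by simp
        then have "mag (iv b) \<le> L"
          using sigma_inv[OF b, of y] sb le unfolding L_def by (simp add: abs_le_iff)
        then show False using False b by (simp add: F_def)
      qed
      \<comment> \<open>The uniform dynamics is applied to b^-1 at the group point g^-1, whose image
        is h^-1.\<close>
      have "iv b \<notin> B"
      proof
        assume "iv b \<in> B"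
        then have "b \<in> F" using b by (auto simp: F_def intro!: image_eqI[of _ _ "iv b"])
        with False show False by simp
      qed
      then have "\<not> (d (Inl (iv g)) (Inl (iv (iv b))) \<ge> e / 2 \<and>
          d (sum_action (iv b) (Inl (iv g))) (Inl (iv b)) \<ge> e / 2)"
        using \<open>iv b \<notin> B\<close> X(3) inv_mem[OF b] unfolding B_def mem_Collect_eq by metis
      moreover have "iv b \<circ> iv g = iv h" using g b by (simp add: hb inv_comp_elem)
      ultimately have near: "d (Inl (iv h)) (Inl (iv b)) < e / 2" using far b by simp
      have "d (Inr y) (Inl (iv h)) > e" using x(2) by (simp add: y_def shadow_def)
      then have "d (Inr y) (Inl (iv b)) > e / 2"
        using X.triangle[OF X(1,6,4)] near X.commute[of "Inl (iv b)" "Inl (iv h)"] by linarith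
      from C2(2)[OF b this] have "mag b \<le> mag h - mag g + K"
        using sb K0(1) unfolding K_def by (simp add: abs_le_iff)
      with far near show ?thesis by simp
    qed
  qed
  show ?thesis
    by (rule that[OF finF K_ge]) (use main in blast)+
qed

lemma uniform_act:
  assumes "g \<in> \<Gamma>" "e > 0"
  obtains e' where "e' > 0"
    "\<And>z w. z \<in> XX \<Longrightarrow> w \<in> XX \<Longrightarrow> d z w \<le> e' \<Longrightarrow> d (sum_action g z) (sum_action g w) \<le> e"
proof (rule ccontr)
  assume "\<not> thesis"
  then have "\<forall>n. \<exists>zw. fst zw \<in> XX \<and> snd zw \<in> XX \<and> d (fst zw) (snd zw) \<le> 1 / Suc n \<and>
      d (sum_action g (fst zw)) (sum_action g (snd zw)) > e"
    using that[of "1 / Suc n" for n] by (metis fst_conv snd_conv linorder_not_le of_nat_0_less_iff zero_less_Suc zero_less_divide_1_iff)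
  from choice[OF this] obtain zw where zw: "\<And>n. fst (zw n) \<in> XX \<and> snd (zw n) \<in> XX \<and>
      d (fst (zw n)) (snd (zw n)) \<le> 1 / Suc n \<and> d (sum_action g (fst (zw n))) (sum_action g (snd (zw n))) > e"
    by blast
  define z w where "z n = fst (zw n)" and "w n = snd (zw n)" for n
  have zw: "z n \<in> XX" "w n \<in> XX" "d (z n) (w n) \<le> 1 / Suc n"
    "d (sum_action g (z n)) (sum_action g (w n)) > e" for n
    using zw[of n] by (simp_all add: z_def w_def)
  obtain p r where r: "p \<in> XX" "strict_mono (r :: nat \<Rightarrow> nat)" "lim (z \<circ> r) p"
    by (rule subseq_lim[of z]) (use zw(1) in \<open>auto\<close>)
  obtain q r' where r': "q \<in> XX" "strict_mono (r' :: nat \<Rightarrow> nat)" "lim ((w \<circ> r) \<circ> r') q"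
    by (rule subseq_lim[of "w \<circ> r"]) (use zw(2) in \<open>auto\<close>)
  have p: "lim ((z \<circ> r) \<circ> r') p" by (rule lim_subseq[OF r(3) r'(2)])
  have "(\<lambda>n. d (((z \<circ> r) \<circ> r') n) (((w \<circ> r) \<circ> r') n)) \<longlonglongrightarrow> d p q"
    by (rule lim_d[OF p r'(3)]) (use zw(1,2) in \<open>simp_all add: image_subset_iff\<close>)
  moreover have "(\<lambda>n. d (((z \<circ> r) \<circ> r') n) (((w \<circ> r) \<circ> r') n)) \<longlonglongrightarrow> 0"
  proof (rule tendsto_sandwich[OF _ _ tendsto_const])
    show "(\<lambda>n. 1 / real (Suc ((r \<circ> r') n))) \<longlonglongrightarrow> 0"
      using LIMSEQ_subseq_LIMSEQ[OF lim_inverse_n'[THEN LIMSEQ_Suc] strict_mono_o[OF r(2) r'(2)]]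
      by (simp add: o_def)
  qed (use zw(3) in \<open>auto simp: o_def\<close>)
  ultimately have "d p q = 0" using LIMSEQ_unique by blast
  then have "p = q" using r(1) r'(1) X.mdist_zero X.zero by blast
  have "(\<lambda>n. d (sum_action g (((z \<circ> r) \<circ> r') n)) (sum_action g (((w \<circ> r) \<circ> r') n)))
      \<longlonglongrightarrow> d (sum_action g p) (sum_action g q)"
    by (rule lim_d[OF lim_act[OF assms(1) p] lim_act[OF assms(1) r'(3)]])
       (use zw(1,2) assms(1) in \<open>simp_all add: image_subset_iff\<close>)
  then have "e \<le> d (sum_action g p) (sum_action g q)"
    by (rule LIMSEQ_le_const) (use zw(4) in \<open>auto intro!: less_imp_le\<close>)
  then show False
    using \<open>p = q\<close> assms X.mdist_zero[OF act_mem[OF assms(1) r(1)]] by simp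
qed

text \<open>With b = g^-1 h, a point y far from h^-1 has to be sent by b away from g^-1. For generic
  b the image is close to b while g^-1 is not. For the finitely many other b, uniform continuity of
  b^-1 suffices: if b y were very close to g^-1, then y would be close to h^-1.\<close>

lemma shadow_enlargement:
  assumes "e > 0"
  obtains e' where "e' > 0"
    "\<And>g h. g \<in> \<Gamma> \<Longrightarrow> h \<in> \<Gamma> \<Longrightarrow> mag g \<le> mag h \<Longrightarrow> shadow e g \<inter> shadow e h \<noteq> {} \<Longrightarrow>
      shadow e h \<subseteq> shadow e' g"
proof -
  obtain F K where F: "finite F"
    "\<And>g h x. g \<in> \<Gamma> \<Longrightarrow> h \<in> \<Gamma> \<Longrightarrow> mag g \<le> mag h \<Longrightarrow> x \<in> shadow e g \<Longrightarrow> x \<in> shadow e h \<Longrightarrow>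
      iv g \<circ> h \<notin> F \<Longrightarrow> d (Inl (iv g)) (Inl (iv g \<circ> h)) \<ge> e / 2
        \<and> d (Inl (iv h)) (Inl (iv (iv g \<circ> h))) < e / 2"
    by (rule shadow_transition[OF assms]) (rule that)
  have e4: "e / 4 > 0" using assms by simp
  define B where "B = F \<inter> \<Gamma> \<union> {g \<in> \<Gamma>. \<exists>z\<in>XX. d z (Inl (iv g)) \<ge> e / 4 \<and> d (sum_action g z) (Inl g) \<ge> e / 4}"
  have finB: "finite B" unfolding B_def using F(1) finite_exceptions[OF e4] by blast
  have "\<forall>b. \<exists>c. b \<in> \<Gamma> \<longrightarrow> c > 0 \<and> (\<forall>z\<in>XX. \<forall>w\<in>XX. d z w \<le> c \<longrightarrow>
      d (sum_action (iv b) z) (sum_action (iv b) w) \<le> e)"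
    using uniform_act[OF inv_mem assms] by metis
  then obtain c where c: "\<And>b. b \<in> \<Gamma> \<Longrightarrow> c b > 0"
    "\<And>b z w. b \<in> \<Gamma> \<Longrightarrow> z \<in> XX \<Longrightarrow> w \<in> XX \<Longrightarrow> d z w \<le> c b \<Longrightarrow>
      d (sum_action (iv b) z) (sum_action (iv b) w) \<le> e"
    by metis
  \<comment> \<open>Halving the minimum makes e' strictly smaller than e / 4 and than every modulus
    of continuity.\<close>
  define e' where "e' = Min (insert (e / 4) (c ` B)) / 2"
  have BG: "B \<subseteq> \<Gamma>" by (auto simp: B_def)
  have pos: "Min (insert (e / 4) (c ` B)) > 0" using finB e4 c(1) BG by (subst Min_gr_iff) auto
  then have e': "e' > 0" by (simp add: e'_def)
  have le: "e' < e / 4" "\<And>b. b \<in> B \<Longrightarrow> e' < c b"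
  proof -
    have "Min (insert (e / 4) (c ` B)) \<le> e / 4" using finB by (intro Min_le) auto
    then show "e' < e / 4" using pos by (simp add: e'_def)
    fix b assume "b \<in> B"
    then have "Min (insert (e / 4) (c ` B)) \<le> c b" using finB by (intro Min_le) auto
    then show "e' < c b" using pos by (simp add: e'_def)
  qed
  show ?thesis
  proof (rule that[OF e'])
    fix g h assume g: "g \<in> \<Gamma>" and h: "h \<in> \<Gamma>" and mag: "mag g \<le> mag h"
      and ne: "shadow e g \<inter> shadow e h \<noteq> {}"
    obtain x where x: "x \<in> shadow e g" "x \<in> shadow e h" using ne by blast
    define b where "b = iv g \<circ> h"
    have b: "b \<in> \<Gamma>" using g h by (simp add: b_def)
    have hb: "h = g \<circ> b" using g by (simp add: b_def o_assoc)
    have ivh: "iv b \<circ> iv g = iv h" using g b by (simp add: hb inv_comp_elem)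
    show "shadow e h \<subseteq> shadow e' g"
    proof
      fix w assume w: "w \<in> shadow e h"
      define y where "y = iv h w"
      have byx: "b y = iv g w" using h by (simp add: b_def y_def)
      have dy: "d (Inr y) (Inl (iv h)) > e" using w by (simp add: y_def shadow_def)
      have X: "Inr y \<in> XX" "Inr (b y) \<in> XX" "Inl (iv g) \<in> XX" "Inl (iv h) \<in> XX" "Inl b \<in> XX" "Inl (iv b) \<in> XX"
        using g h b by simp_all
      have "d (Inr (b y)) (Inl (iv g)) > e'"
      proof (cases "b \<in> B")
        case True
        show ?thesis
        proof (rule ccontr)
          assume "\<not> ?thesis"
          then have "d (Inr (b y)) (Inl (iv g)) \<le> c b" using le(2)[OF True] by simp
          from c(2)[OF b X(2,3) this] show False using dy b ivh by simp
        qed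
      next
        case False
        then have "b \<notin> F" using b by (simp add: B_def)
        from F(2)[OF g h mag x this[unfolded b_def]]
        have 1: "d (Inl (iv g)) (Inl b) \<ge> e / 2" "d (Inl (iv h)) (Inl (iv b)) < e / 2"
          by (simp_all add: b_def)
        have "d (Inr y) (Inl (iv b)) > e / 2"
          using X.triangle[OF X(1,6,4)] 1(2) dy X.commute[of "Inl (iv b)" "Inl (iv h)"] by linarith
        moreover have "\<not> (d (Inr y) (Inl (iv b)) \<ge> e / 4 \<and> d (sum_action b (Inr y)) (Inl b) \<ge> e / 4)"
          using False b X(1) unfolding B_def Un_iff mem_Collect_eq by metis
        ultimately have "d (Inr (b y)) (Inl b) < e / 4" using assms by simp
        then show ?thesis
          using X.triangle[OF X(3,2,5)] 1(1) le(1) X.commute[of "Inr (b y)" "Inl (iv g)"] by linarith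
      qed
      then show "w \<in> shadow e' g" by (simp add: shadow_def byx)
    qed
  qed
qed

text \<open>Greedy selection: an element of least magnitude is taken, the elements whose shadows
  meet its shadow are absorbed by the enlargement, and the induction continues with those whose
  shadows are disjoint from it.\<close>

lemma finite_vitali:
  assumes enl: "\<And>g h. g \<in> \<Gamma> \<Longrightarrow> h \<in> \<Gamma> \<Longrightarrow> mag g \<le> mag h \<Longrightarrow> shadow e g \<inter> shadow e h \<noteq> {} \<Longrightarrow>
      shadow e h \<subseteq> shadow e' g"
    and "finite F" "F \<subseteq> \<Gamma>"
  shows "\<exists>G\<subseteq>F. disjoint_family_on (shadow e) G \<and> (\<Union>g\<in>F. shadow e g) \<subseteq> (\<Union>g\<in>G. shadow e' g) \<union> (\<Union>g\<in>G. shadow e g)"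
  using assms(2,3)
proof (induction F rule: finite_psubset_induct)
  case (psubset F)
  show ?case
  proof (cases "F = {}")
    case False
    define g where "g = arg_min_on mag F"
    have g: "g \<in> F" "\<And>h. h \<in> F \<Longrightarrow> mag g \<le> mag h"
      unfolding g_def by (rule arg_min_if_finite(1)[OF psubset(1) False])
        (rule arg_min_least[OF psubset(1) False])
    \<comment> \<open>The clause \<open>h \<noteq> g\<close> makes F' a proper subset even if the
      shadow of g is empty.\<close>
    define F' where "F' = {h \<in> F. h \<noteq> g \<and> shadow e g \<inter> shadow e h = {}}"
    have F': "F' \<subset> F" using g(1) by (auto simp: F'_def)
    have "F' \<subseteq> \<Gamma>" using psubset(3) by (auto simp: F'_def)
    from psubset(2)[OF F' this] obtain G where G: "G \<subseteq> F'" "disjoint_family_on (shadow e) G"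
      "(\<Union>g\<in>F'. shadow e g) \<subseteq> (\<Union>g\<in>G. shadow e' g) \<union> (\<Union>g\<in>G. shadow e g)"
      by (elim exE conjE)
    show ?thesis
    proof (intro exI[of _ "insert g G"] conjI)
      show "insert g G \<subseteq> F" using g(1) F' G(1) by auto
      show "disjoint_family_on (shadow e) (insert g G)"
      proof (subst disjoint_family_on_insert)
        show "g \<notin> G" using G(1) by (auto simp: F'_def)
        have "shadow e g \<inter> shadow e h = {}" if "h \<in> G" for h
          using subsetD[OF G(1) that] by (simp add: F'_def)
        then show "shadow e g \<inter> (\<Union>h\<in>G. shadow e h) = {} \<and> disjoint_family_on (shadow e) G"
          using G(2) by (simp add: Int_UN_distrib)
      qed
      show "(\<Union>g\<in>F. shadow e g) \<subseteq> (\<Union>g\<in>insert g G. shadow e' g) \<union> (\<Union>g\<in>insert g G. shadow e g)"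
      proof (rule UN_least)
        fix h assume h: "h \<in> F"
        show "shadow e h \<subseteq> (\<Union>g\<in>insert g G. shadow e' g) \<union> (\<Union>g\<in>insert g G. shadow e g)"
        proof (cases "h \<in> F'")
          case True
          then have "shadow e h \<subseteq> (\<Union>g\<in>F'. shadow e g)" by (rule UN_upper)
          also note G(3)
          finally show ?thesis by (rule order_trans) (intro Un_mono UN_mono, auto)
        next
          case False
          then consider "h = g" | "shadow e g \<inter> shadow e h \<noteq> {}" using h by (auto simp: F'_def)
          then show ?thesis
          proof cases
            case 2
            have "shadow e h \<subseteq> shadow e' g"
              by (rule enl) (use g(1) h 2 psubset(3) g(2)[OF h] in auto)
            then show ?thesis by simp (rule le_supI1, rule le_supI1)
          next
            case 1
            then show ?thesis by (intro le_supI2) simp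
          qed
        qed
      qed
    qed
  qed (auto simp: disjoint_family_on_def)
qed

section \<open>Absence of a global fixed point\<close>

lemma funpow_mem [simp]: "g \<in> \<Gamma> \<Longrightarrow> g ^^ n \<in> \<Gamma>"
  by (induction n) simp_all

lemma funpow_inv_cancel:
  assumes "g \<in> \<Gamma>"
  shows "(iv g ^^ m) ((g ^^ (m + n)) x) = (g ^^ n) x"
proof (induction m)
  case (Suc m)
  have "(iv g ^^ Suc m) ((g ^^ (Suc m + n)) x) = (iv g ^^ m) (iv g (g ((g ^^ (m + n)) x)))"
    by (simp add: funpow_swap1)
  then show ?case using Suc assms by simp
qed simp

text \<open>Ping-pong with two elements \<open>g\<close>, \<open>h\<close> that contract the complement of a fixed point \<open>p\<close>
  produces infinitely many elements \<open>g\<^sup>k h\<^sup>-\<^sup>l\<close> on which \<open>\<sigma>(\<cdot>, p)\<close> is bounded; as these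
  converge to \<open>p\<close> away from \<open>p\<close>, they cannot map a point near \<open>r\<close> to one near \<open>q\<close>.\<close>

lemma no_global_fixed_point: "\<not> (\<forall>g\<in>\<Gamma>. g p = p)"
proof
  assume fixp: "\<forall>g\<in>\<Gamma>. g p = p"
  \<comment> \<open>At a global fixed point the cocycle becomes a quasimorphism with defect
    \<kappa>.\<close>
  define S where "S g = \<sigma> g p" for g
  have S_comp: "\<bar>S (g \<circ> h) - (S g + S h)\<bar> \<le> \<kappa>" if "g \<in> \<Gamma>" "h \<in> \<Gamma>" for g h
    using cocycle[OF that, of p] bspec[OF fixp that(2)] by (simp add: S_def)
  have S_inv: "\<bar>S (iv g) + S g\<bar> \<le> 2 * \<kappa>" if "g \<in> \<Gamma>" for g
    using sigma_inv[OF that, of p] bspec[OF fixp that] by (simp add: S_def)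
  \<comment> \<open>If p is away from g^-1, then S g is the magnitude up to a constant, so an upper
    bound on S leaves finitely many g. With the inverse version below, all but finitely many
    elements on which S is bounded on both sides have both g and g^-1 near p.\<close>
  have fin: "finite {g \<in> \<Gamma>. S g \<le> K \<and> d (Inr p) (Inl (iv g)) > e}" if epos: "e > 0" for K e
  proof -
    obtain C where C: "C > 0"
      "\<And>g x. g \<in> \<Gamma> \<Longrightarrow> d (Inr x) (Inl (iv g)) > e \<Longrightarrow> \<bar>\<sigma> g x - mag g\<bar> \<le> C"
      using mag_bound[OF epos] by metis
    have "{g \<in> \<Gamma>. S g \<le> K \<and> d (Inr p) (Inl (iv g)) > e} \<subseteq> {g \<in> \<Gamma>. mag g \<le> K + C}"
      using C(2)[of _ p] by (fastforce simp: S_def abs_le_iff)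
    then show ?thesis using finite_mag finite_subset by blast
  qed
  have fin_inv: "finite {g \<in> \<Gamma>. S g \<ge> K \<and> d (Inr p) (Inl g) > e}" if "e > 0" for K e
  proof -
    have "{g \<in> \<Gamma>. S g \<ge> K \<and> d (Inr p) (Inl g) > e} \<subseteq>
        inv_into UNIV ` {g \<in> \<Gamma>. S g \<le> 2 * \<kappa> - K \<and> d (Inr p) (Inl (iv g)) > e}"
    proof
      fix g assume g: "g \<in> {g \<in> \<Gamma>. S g \<ge> K \<and> d (Inr p) (Inl g) > e}"
      then have "S (iv g) \<le> 2 * \<kappa> - K" using S_inv[of g] by (simp add: abs_le_iff)
      then show "g \<in> inv_into UNIV ` {g \<in> \<Gamma>. S g \<le> 2 * \<kappa> - K \<and> d (Inr p) (Inl (iv g)) > e}"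
        using g by (intro image_eqI[of _ _ "iv g"]) simp_all
    qed
    then show ?thesis using fin[OF that] finite_subset by blast
  qed
  have ne: "infinite (limit_set \<Gamma>) \<or> card (limit_set \<Gamma>) \<ge> 3"
    using nonelementary by (simp add: non_elementary_def)
  obtain q where q: "q \<in> limit_set \<Gamma>" "q \<noteq> p" using three_points[OF ne, of p p] by metis
  obtain r where r: "r \<in> limit_set \<Gamma>" "r \<noteq> p" "r \<noteq> q" using three_points[OF ne, of p q] by metis
  \<comment> \<open>An eighth of the least distance: the 2e-balls about q and r are disjoint and
    stay more than 2e away from p.\<close>
  define e where "e = Min {d (Inr q) (Inr p), d (Inr r) (Inr p), d (Inr r) (Inr q)} / 8"
  have dpos: "d (Inr q) (Inr p) > 0" "d (Inr r) (Inr p) > 0" "d (Inr r) (Inr q) > 0"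
    using q r by (subst X.mdist_pos_eq; simp)+
  have e: "e > 0" "d (Inr q) (Inr p) \<ge> 8 * e" "d (Inr r) (Inr p) \<ge> 8 * e" "d (Inr r) (Inr q) \<ge> 8 * e"
    unfolding e_def using dpos by (simp_all add: min_def)
  define A where "A = {z. d (Inr z) (Inr p) > 2 * e}"
  define Bq where "Bq = {z. d (Inr z) (Inr q) < 2 * e}"
  define Br where "Br = {z. d (Inr z) (Inr r) < 2 * e}"
  have XM: "Inr z \<in> XX" for z by simp
  have BqA: "Bq \<subseteq> A"
  proof
    fix z assume "z \<in> Bq"
    then show "z \<in> A" using X.triangle[OF XM XM XM, of q p z] X.commute[of "Inr q" "Inr z"] e(1,2)
      by (simp add: A_def Bq_def)
  qed
  have BrA: "Br \<subseteq> A"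
  proof
    fix z assume "z \<in> Br"
    then show "z \<in> A" using X.triangle[OF XM XM XM, of r p z] X.commute[of "Inr r" "Inr z"] e(1,3)
      by (simp add: A_def Br_def)
  qed
  have disj: "z \<notin> Bq" if "z \<in> Br" for z
    using that X.triangle[OF XM XM XM, of r q z] X.commute[of "Inr r" "Inr z"] e(1,4)
    by (simp add: Br_def Bq_def)
  have bad: "finite {g \<in> \<Gamma>. \<exists>z\<in>XX. d z (Inl (iv g)) \<ge> e \<and> d (sum_action g z) (Inl g) \<ge> e}"
    by (rule finite_exceptions[OF e(1)])
  \<comment> \<open>Elements near s are far from p, so up to finitely many S is below N, hence their
    inverses are near p and they contract A towards s. Of the constant, -\<kappa> - 1 pays for the
    defect and a decrease by 1 with each power; the other -2 \<kappa> is lost in passing to the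
    inverse.\<close>
  have contract: "\<exists>g\<in>\<Gamma>. S g \<le> - \<kappa> - 1 - 2 * \<kappa> \<and> (\<forall>z\<in>A. d (Inr (g z)) (Inr s) < 2 * e)"
    if s: "s \<in> limit_set \<Gamma>" "d (Inr s) (Inr p) \<ge> 8 * e" for s
  proof -
    define N where "N = - \<kappa> - 1 - 2 * \<kappa>"
    have "infinite ({g \<in> \<Gamma>. d (Inl g) (Inr s) < e} -
        ({g \<in> \<Gamma>. S g \<ge> N \<and> d (Inr p) (Inl g) > e} \<union> {g \<in> \<Gamma>. S g \<le> N \<and> d (Inr p) (Inl (iv g)) > e} \<union>
         {g \<in> \<Gamma>. \<exists>z\<in>XX. d z (Inl (iv g)) \<ge> e \<and> d (sum_action g z) (Inl g) \<ge> e}))" (is "infinite ?T")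
      by (intro Diff_infinite_finite finite_UnI fin fin_inv bad limit_set_approx s(1) e(1))
    from infinite_imp_nonempty[OF this] obtain g where gT: "g \<in> ?T"
      unfolding ex_in_conv[symmetric] ..
    have g: "g \<in> \<Gamma>" "d (Inl g) (Inr s) < e" "\<not> (S g \<ge> N \<and> d (Inr p) (Inl g) > e)"
      "\<not> (S g \<le> N \<and> d (Inr p) (Inl (iv g)) > e)"
      using gT by simp_all
    have gb: "d (sum_action g z) (Inl g) < e" if "z \<in> XX" "d z (Inl (iv g)) \<ge> e" for z
    proof (rule ccontr)
      assume n: "\<not> ?thesis"
      have "g \<in> {g \<in> \<Gamma>. \<exists>z\<in>XX. d z (Inl (iv g)) \<ge> e \<and> d (sum_action g z) (Inl g) \<ge> e}"
        by (intro CollectI conjI bexI[of _ z]) (use that g(1) n in simp_all)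
      with gT show False by (simp only: Diff_iff Un_iff simp_thms)
    qed
    have X: "Inl g \<in> XX" "Inl (iv g) \<in> XX" using g(1) by simp_all
    have "d (Inr p) (Inl g) > e"
      using X.triangle[OF XM X(1) XM, of s p] s(2) g(2) e(1) X.commute[of "Inl g" "Inr s"] X.commute[of "Inl g" "Inr p"]
      by linarith
    then have SN: "S g \<le> N" using g(3) by linarith
    then have near: "d (Inr p) (Inl (iv g)) \<le> e" using g(4) by linarith
    have "d (Inr (g z)) (Inr s) < 2 * e" if "z \<in> A" for z
    proof -
      have "d (Inr z) (Inl (iv g)) \<ge> e"
        using that near X.triangle[OF XM X(2) XM, of z p] X.commute[of "Inr p" "Inl (iv g)"]
        unfolding A_def by simp
      from gb[OF XM this] have "d (Inr (g z)) (Inl g) < e" by simp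
      then show ?thesis using X.triangle[OF XM X(1) XM, of "g z" s] g(2) by linarith
    qed
    then show ?thesis using g(1) SN unfolding N_def by (intro bexI[of _ g]) simp_all
  qed
  obtain g where g: "g \<in> \<Gamma>" "S g \<le> - \<kappa> - 1 - 2 * \<kappa>" "\<And>z. z \<in> A \<Longrightarrow> g z \<in> Bq"
    using contract[OF q(1) e(2)] by (auto simp: Bq_def)
  obtain h where h: "h \<in> \<Gamma>" "S h \<le> - \<kappa> - 1 - 2 * \<kappa>" "\<And>z. z \<in> A \<Longrightarrow> h z \<in> Br"
    using contract[OF r(1) e(3)] by (auto simp: Br_def)
  have gk: "(g ^^ k) z \<in> (if k = 0 then A else Bq)" if "z \<in> A" for k z
  proof (induction k)
    case (Suc k)
    then have "(g ^^ k) z \<in> A" using BqA by (auto split: if_splits)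
    then show ?case using g(3) by simp
  qed (use that in simp)
  have rBr: "r \<in> Br" using e(1) X.mdist_zero[of "Inr r"] by (simp add: Br_def)
  have hk: "(h ^^ k) r \<in> Br" for k
    by (induction k) (use rBr h(3) BrA in auto)
  \<comment> \<open>S decreases along powers of g and increases along powers of \<open>iv h\<close>
    in steps of at most J, so for every large k some l puts S (u k l) between 0 and J.\<close>
  define u where "u k l = (g ^^ k) \<circ> (iv h ^^ l)" for k l
  have u_mem: "u k l \<in> \<Gamma>" for k l using g(1) h(1) by (simp add: u_def)
  have Sg: "S (g ^^ k) \<le> \<kappa> - real k" for k
  proof (induction k)
    case 0
    show ?case using sigma_id[of p] by (simp add: S_def abs_le_iff id_def)
  next
    case (Suc k)
    have "S (g \<circ> g ^^ k) \<le> S g + S (g ^^ k) + \<kappa>"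
      using S_comp[OF g(1) funpow_mem[OF g(1)], of k] by (simp add: abs_le_iff)
    then show ?case unfolding funpow.simps(2) of_nat_Suc using Suc g(2) kappa(1) by linarith
  qed
  define J where "J = S (iv h) + \<kappa>"
  have Sh: "S (iv h) \<ge> \<kappa> + 1" using S_inv[OF h(1)] h(2) by (simp add: abs_le_iff)
  have step: "S (u k l) + 1 \<le> S (u k (Suc l))" "S (u k (Suc l)) \<le> S (u k l) + J" for k l
  proof -
    have eq: "u k (Suc l) = u k l \<circ> iv h" by (simp add: u_def fun_eq_iff funpow_swap1)
    show "S (u k l) + 1 \<le> S (u k (Suc l))" "S (u k (Suc l)) \<le> S (u k l) + J"
      using S_comp[OF u_mem inv_mem[OF h(1)], of k l] Sh unfolding J_def eq
      by (simp_all add: abs_le_iff)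
  qed
  have J: "J \<ge> 0" using Sh kappa(1) by (simp add: J_def)
  have ex_l: "\<exists>l. 0 \<le> S (u k l) \<and> S (u k l) \<le> J" if "real k \<ge> \<kappa>" for k
  proof -
    have up: "S (u k 0) + real l \<le> S (u k l)" for l
    proof (induction l)
      case (Suc l)
      then show ?case using step(1)[of k l] by simp
    qed simp
    obtain l1 :: nat where "- S (u k 0) \<le> real l1" using real_arch_simple by blast
    then have "0 \<le> S (u k l1)" using up[of l1] by linarith
    define l where "l = (LEAST l. 0 \<le> S (u k l))"
    have l: "0 \<le> S (u k l)" unfolding l_def by (rule LeastI) fact
    have "S (u k l) \<le> J"
    proof (cases l)
      case 0
      have "S (u k 0) \<le> 0" using Sg[of k] that by (simp add: u_def)
      then show ?thesis using J 0 by simp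
    next
      case (Suc m)
      then have "\<not> 0 \<le> S (u k m)" using not_less_Least[of m "\<lambda>l. 0 \<le> S (u k l)"] by (simp add: l_def)
      then show ?thesis using step(2)[of k m] Suc by simp
    qed
    with l show ?thesis by blast
  qed
  obtain k0 :: nat where "\<kappa> \<le> real k0" using real_arch_simple by blast
  then have "\<forall>k. \<exists>l. 0 \<le> S (u (k + k0) l) \<and> S (u (k + k0) l) \<le> J"
    using ex_l by simp
  from choice[OF this] obtain l where l: "\<And>k. 0 \<le> S (u (k + k0) (l k)) \<and> S (u (k + k0) (l k)) \<le> J"
    by blast
  \<comment> \<open>The shift by k0 makes S of the pure power of g nonpositive; the successor
    guarantees at least one factor g, which moves A into Bq.\<close>
  define w where "w k = u (Suc k + k0) (l (Suc k))" for k
  have w_point: "w k ((h ^^ (l (Suc k) + n)) r) = (g ^^ (Suc k + k0)) ((h ^^ n) r)" for k n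
    unfolding w_def u_def o_apply funpow_inv_cancel[OF h(1)] ..
  have "inj w"
  proof (rule linorder_injI)
    fix j k :: nat assume "j < k"
    show "w j \<noteq> w k"
    proof
      assume eq: "w j = w k"
      \<comment> \<open>Enough powers of h for both inverse powers to cancel. If w j = w k, then
        cancelling the common power of g leaves a point of Br equal to a point moved into Bq by the
        k - j > 0 remaining factors.\<close>
      define m where "m = l (Suc j) + l (Suc k)"
      have 1: "w j ((h ^^ m) r) = (g ^^ (Suc j + k0)) ((h ^^ l (Suc k)) r)"
        unfolding m_def by (rule w_point)
      have 2: "w k ((h ^^ m) r) = (g ^^ (Suc k + k0)) ((h ^^ l (Suc j)) r)"
        unfolding m_def add.commute[of "l (Suc j)"] by (rule w_point)
      have "(g ^^ (Suc k + k0)) x = (g ^^ (Suc j + k0)) ((g ^^ (k - j)) x)" for x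
      proof -
        have "Suc k + k0 = (Suc j + k0) + (k - j)" using \<open>j < k\<close> by simp
        then show ?thesis using funpow_add[of "Suc j + k0" "k - j" g] by (simp only: o_apply)
      qed
      then have eq': "(g ^^ (Suc j + k0)) ((h ^^ l (Suc k)) r) = (g ^^ (Suc j + k0)) ((g ^^ (k - j)) ((h ^^ l (Suc j)) r))"
        using eq 1 2 by (simp only:)
      have "inj (g ^^ (Suc j + k0))"
        by (rule bij_is_inj[OF bij_elem[OF funpow_mem[OF g(1)]]])
      from injD[OF this eq'] have "(h ^^ l (Suc k)) r = (g ^^ (k - j)) ((h ^^ l (Suc j)) r)" .
      moreover have "(g ^^ (k - j)) ((h ^^ l (Suc j)) r) \<in> Bq"
        using gk[OF subsetD[OF BrA hk], of "k - j"] \<open>j < k\<close> by simp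
      ultimately show False using disj[OF hk[of "l (Suc k)"]] by simp
    qed
  qed
  have w_mem: "w k \<in> \<Gamma>" for k by (simp add: w_def u_mem)
  have wS: "0 \<le> S (w k)" "S (w k) \<le> J" for k using l[of "Suc k"] by (simp_all add: w_def)
  have "infinite (range w - ({g \<in> \<Gamma>. S g \<ge> 0 \<and> d (Inr p) (Inl g) > e} \<union>
      {g \<in> \<Gamma>. S g \<le> J \<and> d (Inr p) (Inl (iv g)) > e} \<union>
      {g \<in> \<Gamma>. \<exists>z\<in>XX. d z (Inl (iv g)) \<ge> e \<and> d (sum_action g z) (Inl g) \<ge> e}))" (is "infinite ?T")
    by (intro Diff_infinite_finite finite_UnI fin fin_inv bad e(1) range_inj_infinite \<open>inj w\<close>)
  from infinite_imp_nonempty[OF this] obtain v where vT: "v \<in> ?T"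
    unfolding ex_in_conv[symmetric] ..
  then have "v \<in> range w" by simp
  then obtain k where vk: "v = w k" ..
  have v: "d (Inr p) (Inl (w k)) \<le> e" "d (Inr p) (Inl (iv (w k))) \<le> e"
    using vT wS[of k] w_mem[of k] by (simp_all add: vk not_less)
  have vb: "d (sum_action (w k) z) (Inl (w k)) < e" if "z \<in> XX" "d z (Inl (iv (w k))) \<ge> e" for z
  proof (rule ccontr)
    assume n: "\<not> ?thesis"
    have "w k \<in> {g \<in> \<Gamma>. \<exists>z\<in>XX. d z (Inl (iv g)) \<ge> e \<and> d (sum_action g z) (Inl g) \<ge> e}"
      by (intro CollectI conjI bexI[of _ z]) (use that w_mem n in simp_all)
    with vT vk show False by (simp only: Diff_iff Un_iff simp_thms)
  qed
  have X: "Inl (w k) \<in> XX" "Inl (iv (w k)) \<in> XX" using w_mem by simp_all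
  \<comment> \<open>This point lies in Br, hence away from p and from the inverse of w k. The
    dynamics sends it near w k, that is near p, but cancelling the powers of h shows that its image
    lies in Bq.\<close>
  define z where "z = (h ^^ (l (Suc k) + 0)) r"
  have "z \<in> A" unfolding z_def using BrA hk by blast
  then have "d (Inr z) (Inl (iv (w k))) \<ge> e"
    using v(2) X.triangle[OF XM X(2) XM, of z p] X.commute[of "Inr p" "Inl (iv (w k))"]
    unfolding A_def by simp
  from vb[OF XM this] have "d (Inr (w k z)) (Inl (w k)) < e" by simp
  then have "d (Inr (w k z)) (Inr p) < 2 * e"
    using v(1) X.triangle[OF XM X(1) XM, of "w k z" p] X.commute[of "Inr p" "Inl (w k)"] by linarith
  moreover have "w k z \<in> Bq"
    unfolding z_def w_point using gk[of r "Suc k + k0"] rBr BrA by auto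
  ultimately show False using BqA by (auto simp: A_def)
qed

subsection \<open>Quasi-conformal measures and the shadow lemma\<close>

definition wt :: "('m \<Rightarrow> 'm) \<Rightarrow> real" where
  "wt g = exp (- \<delta> * mag g)"

text \<open>The properties of Patterson--Sullivan measures that pass to restrictions to invariant sets.\<close>

definition quasi_conformal :: "'m measure \<Rightarrow> bool" where
  "quasi_conformal \<nu> \<longleftrightarrow> finite_measure \<nu> \<and> sets \<nu> = sets borel \<and>
     (\<forall>g\<in>\<Gamma>. \<forall>A\<in>sets borel. measure \<nu> A = 0 \<longrightarrow> measure \<nu> (g ` A) = 0) \<and>
     (\<forall>e>0. \<exists>D>0. \<forall>g\<in>\<Gamma>. \<forall>A\<in>sets borel. A \<subseteq> {y. d (Inr y) (Inl (iv g)) > e} \<longrightarrow>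
        measure \<nu> (g ` A) \<le> D * wt g * measure \<nu> A \<and> wt g * measure \<nu> A \<le> D * measure \<nu> (g ` A))"

lemma wt_pos: "wt g > 0" by (simp add: wt_def)

lemma quasi_conformalD:
  assumes "quasi_conformal \<nu>"
  shows "finite_measure \<nu>" "sets \<nu> = sets borel"
    "\<And>g A. g \<in> \<Gamma> \<Longrightarrow> A \<in> sets borel \<Longrightarrow> measure \<nu> A = 0 \<Longrightarrow> measure \<nu> (g ` A) = 0"
  using assms by (simp_all add: quasi_conformal_def)

lemma quasi_conformal_bound:
  assumes "quasi_conformal \<nu>" "e > 0"
  obtains D where "D > 0"
    "\<And>g A. g \<in> \<Gamma> \<Longrightarrow> A \<in> sets borel \<Longrightarrow> A \<subseteq> {y. d (Inr y) (Inl (iv g)) > e} \<Longrightarrow>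
        measure \<nu> (g ` A) \<le> D * wt g * measure \<nu> A \<and> wt g * measure \<nu> A \<le> D * measure \<nu> (g ` A)"
proof -
  from assms have "\<exists>D>0. \<forall>g\<in>\<Gamma>. \<forall>A\<in>sets borel. A \<subseteq> {y. d (Inr y) (Inl (iv g)) > e} \<longrightarrow>
        measure \<nu> (g ` A) \<le> D * wt g * measure \<nu> A \<and> wt g * measure \<nu> A \<le> D * measure \<nu> (g ` A)"
    unfolding quasi_conformal_def by (elim conjE allE[of _ e] impE)
  then obtain D where D: "D > 0" "\<forall>g\<in>\<Gamma>. \<forall>A\<in>sets borel. A \<subseteq> {y. d (Inr y) (Inl (iv g)) > e} \<longrightarrow>
        measure \<nu> (g ` A) \<le> D * wt g * measure \<nu> A \<and> wt g * measure \<nu> A \<le> D * measure \<nu> (g ` A)"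
    by (elim exE conjE)
  show ?thesis
    by (rule that[OF D(1)]) (drule (1) D(2)[THEN bspec, THEN bspec, THEN mp])
qed

section \<open>Measurability of images, shadows and the conical limit set\<close>

lemma image_eq_vimage:
  assumes "g \<in> \<Gamma>"
  shows "g ` A = iv g -` A"
  using bij_elem[OF assms] by (simp add: bij_vimage_eq_inv_image inv_mem assms bij_elem)

lemma borel_image:
  assumes "g \<in> \<Gamma>" "A \<in> sets borel"
  shows "g ` A \<in> sets borel"
proof -
  have "iv g \<in> borel_measurable borel"
    using cont_elem[OF inv_mem[OF assms(1)]] by (rule borel_measurable_continuous_onI)
  from measurable_sets[OF this assms(2)] show ?thesis
    by (simp add: image_eq_vimage assms)
qed

lemma borel_shadow [measurable]: "g \<in> \<Gamma> \<Longrightarrow> shadow e g \<in> sets borel"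
  using open_shadow by simp

text \<open>As only finitely many elements have bounded magnitude, lying in infinitely many shadows
  means lying in shadows of arbitrarily large magnitude. The right side is a decreasing intersection
  of open sets, which serves both measurability and continuity of measures.\<close>

lemma limsup_shadow_eq: "limsup_shadow e = (\<Inter>n::nat. \<Union>g\<in>{g \<in> \<Gamma>. mag g > n}. shadow e g)"
proof (intro subset_antisym subsetI INT_I)
  fix x and n :: nat assume x: "x \<in> limsup_shadow e"
  have "infinite ({g \<in> \<Gamma>. x \<in> shadow e g} - {g \<in> \<Gamma>. mag g \<le> n})"
    using x by (intro Diff_infinite_finite finite_mag) (simp add: limsup_shadow_def)
  from infinite_imp_nonempty[OF this]
  obtain g where "g \<in> {g \<in> \<Gamma>. x \<in> shadow e g} - {g \<in> \<Gamma>. mag g \<le> n}"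
    unfolding ex_in_conv[symmetric] ..
  then show "x \<in> (\<Union>g\<in>{g \<in> \<Gamma>. mag g > n}. shadow e g)"
    by (intro UN_I[of g]) (simp_all add: not_le)
next
  fix x assume x: "x \<in> (\<Inter>n::nat. \<Union>g\<in>{g \<in> \<Gamma>. mag g > n}. shadow e g)"
  show "x \<in> limsup_shadow e"
    unfolding limsup_shadow_def mem_Collect_eq
  proof
    assume fin: "finite {g \<in> \<Gamma>. x \<in> shadow e g}"
    obtain n :: nat where n: "Max (insert 0 (mag ` {g \<in> \<Gamma>. x \<in> shadow e g})) \<le> n"
      using real_arch_simple by blast
    from x have "x \<in> (\<Union>g\<in>{g \<in> \<Gamma>. mag g > n}. shadow e g)" by (rule INT_D) simp
    then obtain g where g: "g \<in> \<Gamma>" "mag g > n" "x \<in> shadow e g" by auto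
    have "mag g \<le> Max (insert 0 (mag ` {g \<in> \<Gamma>. x \<in> shadow e g}))"
      using fin g by (intro Max_ge) auto
    with n g(2) show False by simp
  qed
qed

lemma open_tail: "open (\<Union>g\<in>{g \<in> \<Gamma>. mag g > t}. shadow e g)"
  by (intro open_UN ballI open_shadow) simp

lemma borel_limsup_shadow [measurable]: "limsup_shadow e \<in> sets borel"
  unfolding limsup_shadow_eq using open_tail by (intro sets.countable_INT) auto

lemma borel_conical: "conical_limit_set \<Gamma> \<in> sets borel"
  unfolding conical_eq using borel_limsup_shadow by (intro sets.countable_UN) auto

section \<open>Restriction to invariant sets and the mass of shadows\<close>

text \<open>The image of A \<inter> B under g is the image of A intersected with the invariant set
  B, so each estimate for the restriction at A is the original one at A \<inter> B.\<close>

lemma quasi_conformal_restrict: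
  assumes "quasi_conformal \<nu>" "B \<in> sets borel" "\<And>g. g \<in> \<Gamma> \<Longrightarrow> g ` B = B"
  shows "quasi_conformal (density \<nu> (indicator B))"
    and "A \<in> sets borel \<Longrightarrow> measure (density \<nu> (indicator B)) A = measure \<nu> (A \<inter> B)"
proof -
  have s: "sets \<nu> = sets borel" and f: "finite_measure \<nu>"
    using assms(1) by (simp_all add: quasi_conformal_def)
  interpret finite_measure \<nu> by (rule f)
  have m: "measure (density \<nu> (indicator B)) A = measure \<nu> (A \<inter> B)" if "A \<in> sets borel" for A
    using measure_restricted[of B \<nu> A] that assms(2) s by (simp add: Int_commute)
  then show "A \<in> sets borel \<Longrightarrow> measure (density \<nu> (indicator B)) A = measure \<nu> (A \<inter> B)" .
  have im: "g ` A \<inter> B = g ` (A \<inter> B)" if "g \<in> \<Gamma>" for g A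
    using assms(3)[OF that] bij_elem[OF that] by (metis bij_def image_Int)
  show "quasi_conformal (density \<nu> (indicator B))"
    unfolding quasi_conformal_def
  proof (intro conjI ballI impI allI)
    show "finite_measure (density \<nu> (indicator B))"
      using finite_measure_restricted[of B] assms(2) s by simp
    show "sets (density \<nu> (indicator B)) = sets borel" using s by simp
  next
    fix g A assume g: "g \<in> \<Gamma>" and A: "A \<in> sets borel" and z: "measure (density \<nu> (indicator B)) A = 0"
    have "A \<inter> B \<in> sets borel" using A assms(2) by simp
    then show "measure (density \<nu> (indicator B)) (g ` A) = 0"
      using z g A borel_image[OF g A] quasi_conformalD(3)[OF assms(1) g] by (simp add: m im)
  next
    fix e :: real assume epos: "e > 0"
    obtain D where D: "D > 0" "\<And>g A. g \<in> \<Gamma> \<Longrightarrow> A \<in> sets borel \<Longrightarrow> A \<subseteq> {y. d (Inr y) (Inl (iv g)) > e} \<Longrightarrow>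
        measure \<nu> (g ` A) \<le> D * wt g * measure \<nu> A \<and> wt g * measure \<nu> A \<le> D * measure \<nu> (g ` A)"
      by (rule quasi_conformal_bound[OF assms(1) epos]) (rule that)
    have "measure (density \<nu> (indicator B)) (g ` A) \<le> D * wt g * measure (density \<nu> (indicator B)) A \<and>
        wt g * measure (density \<nu> (indicator B)) A \<le> D * measure (density \<nu> (indicator B)) (g ` A)"
      if g: "g \<in> \<Gamma>" and A: "A \<in> sets borel" and sub: "A \<subseteq> {y. d (Inr y) (Inl (iv g)) > e}" for g A
    proof -
      have "A \<inter> B \<in> sets borel" "A \<inter> B \<subseteq> {y. d (Inr y) (Inl (iv g)) > e}"
        using A assms(2) sub by auto
      from D(2)[OF g this] show ?thesis
        using A borel_image[OF g A] g by (simp add: m im)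
    qed
    with D(1) show "\<exists>D>0. \<forall>g\<in>\<Gamma>. \<forall>A\<in>sets borel. A \<subseteq> {y. d (Inr y) (Inl (iv g)) > e} \<longrightarrow>
        measure (density \<nu> (indicator B)) (g ` A) \<le> D * wt g * measure (density \<nu> (indicator B)) A \<and>
        wt g * measure (density \<nu> (indicator B)) A \<le> D * measure (density \<nu> (indicator B)) (g ` A)"
      by (intro exI[of _ D] conjI[of "D > 0"] ballI impI)
  qed
qed

lemma borel_far: "p \<in> XX \<Longrightarrow> {y. d (Inr y) p > e} \<in> sets borel"
  using open_d_greater by simp

lemma shadow_upper:
  assumes "quasi_conformal \<nu>" "e > 0"
  obtains D where "D > 0" "\<And>g. g \<in> \<Gamma> \<Longrightarrow> measure \<nu> (shadow e g) \<le> D * wt g"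
proof -
  obtain D where D: "D > 0" "\<And>g A. g \<in> \<Gamma> \<Longrightarrow> A \<in> sets borel \<Longrightarrow> A \<subseteq> {y. d (Inr y) (Inl (iv g)) > e} \<Longrightarrow>
        measure \<nu> (g ` A) \<le> D * wt g * measure \<nu> A \<and> wt g * measure \<nu> A \<le> D * measure \<nu> (g ` A)"
    by (rule quasi_conformal_bound[OF assms]) (rule that)
  interpret finite_measure \<nu> by (rule quasi_conformalD(1)[OF assms(1)])
  have sp: "sets \<nu> = sets borel" by (rule quasi_conformalD(2)[OF assms(1)])
  show ?thesis
  proof (rule that)
    \<comment> \<open>The summand 1 keeps the constant positive for the zero measure.\<close>
    show "D * (measure \<nu> (space \<nu>) + 1) > 0" using D(1) by (simp add: add_nonneg_pos)
    fix g assume g: "g \<in> \<Gamma>"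
    have "measure \<nu> (shadow e g) \<le> D * wt g * measure \<nu> {y. d (Inr y) (Inl (iv g)) > e}"
      unfolding shadow_image[OF g] by (rule D(2)[THEN conjunct1]) (use g borel_far in auto)
    also have "\<dots> \<le> D * wt g * (measure \<nu> (space \<nu>) + 1)"
      using D(1) wt_pos[of g] bounded_measure[of "{y. d (Inr y) (Inl (iv g)) > e}"]
      by (intro mult_left_mono) auto
    finally show "measure \<nu> (shadow e g) \<le> D * (measure \<nu> (space \<nu>) + 1) * wt g"
      by (simp add: mult_ac)
  qed
qed

text \<open>Otherwise there are group elements g n such that almost all mass lies in shrinking balls
  about g n. By compactness they subconverge to some p whose complement in M is null, which forces
  either the zero measure or a point mass.\<close>

lemma not_concentrated:
  assumes "quasi_conformal \<nu>" "measure \<nu> UNIV > 0"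
  obtains e c where "e > 0" "c > 0" "\<And>g. g \<in> \<Gamma> \<Longrightarrow> measure \<nu> {y. d (Inr y) (Inl g) > e} \<ge> c"
proof (rule ccontr)
  assume no: "\<not> thesis"
  interpret finite_measure \<nu> by (rule quasi_conformalD(1)[OF assms(1)])
  have sp: "sets \<nu> = sets borel" by (rule quasi_conformalD(2)[OF assms(1)])
  have "\<exists>g. g \<in> \<Gamma> \<and> measure \<nu> {y. d (Inr y) (Inl g) > 1 / Suc n} < 1 / Suc n" for n
  proof (rule ccontr)
    assume "\<not> ?thesis"
    then have "\<And>g. g \<in> \<Gamma> \<Longrightarrow> measure \<nu> {y. d (Inr y) (Inl g) > 1 / Suc n} \<ge> 1 / Suc n"
      by (meson not_le)
    with no that[of "1 / Suc n" "1 / Suc n"] show False by simp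
  qed
  then have "\<forall>n. \<exists>g. g \<in> \<Gamma> \<and> measure \<nu> {y. d (Inr y) (Inl g) > 1 / Suc n} < 1 / Suc n" by blast
  from choice[OF this] obtain g where
    "\<forall>n. g n \<in> \<Gamma> \<and> measure \<nu> {y. d (Inr y) (Inl (g n)) > 1 / Suc n} < 1 / Suc n" ..
  then have g: "g n \<in> \<Gamma>" "measure \<nu> {y. d (Inr y) (Inl (g n)) > 1 / Suc n} < 1 / Suc n" for n
    by simp_all
  have "range (\<lambda>n. Inl (g n)) \<subseteq> XX" by (simp add: image_subset_iff g(1))
  then obtain p r where r: "p \<in> XX" "strict_mono (r :: nat \<Rightarrow> nat)" "lim ((\<lambda>n. Inl (g n)) \<circ> r) p"
    by (rule subseq_lim)
  have null: "measure \<nu> {y. d (Inr y) p > 1 / Suc k} = 0" for k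
  proof -
    have "(\<lambda>n. d (((\<lambda>n. Inl (g n)) \<circ> r) n) p) \<longlonglongrightarrow> d p p"
      by (rule lim_d[OF r(3)]) (use r(1) g(1) in \<open>simp_all add: image_subset_iff\<close>)
    then have 1: "(\<lambda>n. d (Inl (g (r n))) p + 1 / Suc (r n)) \<longlonglongrightarrow> 0"
      using tendsto_add[OF _ LIMSEQ_subseq_LIMSEQ[OF LIMSEQ_Suc[OF lim_inverse_n'] r(2)]] X.mdist_zero[OF r(1)]
      by (fastforce simp: o_def)
    have ev: "\<forall>\<^sub>F n in sequentially. d (Inl (g (r n))) p + 1 / Suc (r n) < 1 / Suc k"
      by (rule order_tendstoD(2)[OF 1]) simp
    have "measure \<nu> {y. d (Inr y) p > 1 / Suc k} \<le> 0"
    proof (rule tendsto_lowerbound)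
      show "(\<lambda>n. 1 / real (Suc (r n))) \<longlonglongrightarrow> 0"
        using LIMSEQ_subseq_LIMSEQ[OF LIMSEQ_Suc[OF lim_inverse_n'] r(2)] by (simp add: o_def)
      show "\<forall>\<^sub>F n in sequentially. measure \<nu> {y. d (Inr y) p > 1 / Suc k} \<le> 1 / real (Suc (r n))"
        using ev
      proof eventually_elim
        case (elim n)
        have "measure \<nu> {y. d (Inr y) p > 1 / Suc k} \<le> measure \<nu> {y. d (Inr y) (Inl (g (r n))) > 1 / Suc (r n)}"
        proof (rule finite_measure_mono)
          show "{y. d (Inr y) p > 1 / Suc k} \<subseteq> {y. d (Inr y) (Inl (g (r n))) > 1 / Suc (r n)}"
          proof (intro subsetI CollectI, drule CollectD)
            fix y assume y: "d (Inr y) p > 1 / Suc k"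
            have "Inr y \<in> XX" "Inl (g (r n)) \<in> XX" using g(1) by simp_all
            from X.triangle[OF this r(1)] show "d (Inr y) (Inl (g (r n))) > 1 / Suc (r n)"
              using y elim by linarith
          qed
          show "{y. d (Inr y) (Inl (g (r n))) > 1 / Suc (r n)} \<in> sets \<nu>"
            using borel_far g(1) sp by simp
        qed
        with g(2)[of "r n"] show ?case by simp
      qed
    qed simp
    then show ?thesis using measure_nonneg[of \<nu>] by (simp add: antisym)
  qed
  have U: "(\<Union>k. {y. d (Inr y) p > 1 / Suc k}) = {y. Inr y \<noteq> p}"
  proof (intro subset_antisym subsetI)
    fix y assume "y \<in> {y. Inr y \<noteq> p}"
    then have "d (Inr y) p > 0" using X.mdist_pos_eq[of "Inr y" p] r(1) by simp
    then obtain k where "1 / Suc k < d (Inr y) p" using nat_approx_posE by blast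
    then show "y \<in> (\<Union>k. {y. d (Inr y) p > 1 / Suc k})" by blast
  next
    fix y assume "y \<in> (\<Union>k. {y. d (Inr y) p > 1 / Suc k})"
    then obtain k where "d (Inr y) p > 1 / Suc k" by blast
    then have "d (Inr y) p > 0" by (rule less_trans[rotated]) simp
    then show "y \<in> {y. Inr y \<noteq> p}" using X.mdist_zero[OF r(1)] by auto
  qed
  have N: "{y. Inr y \<noteq> p} \<in> null_sets \<nu>"
    unfolding U[symmetric]
  proof (rule null_sets_UN)
    fix k show "{y. d (Inr y) p > 1 / Suc k} \<in> null_sets \<nu>"
      using null[of k] borel_far[OF r(1)] sp by (intro null_setsI) (simp_all add: emeasure_eq_measure)
  qed
  show False
  proof (cases p)
    case (Inl h)
    then have "UNIV \<in> null_sets \<nu>" using N by simp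
    then have "measure \<nu> UNIV = 0" by (simp add: null_setsD1 measure_def)
    with assms(2) show False by simp
  next
    case (Inr q)
    \<comment> \<open>A point mass at q is excluded by moving q: the point g q is null, and
      invariance of null sets under g^-1 makes q null too.\<close>
    have "\<exists>g\<in>\<Gamma>. g q \<noteq> q" using no_global_fixed_point by blast
    then obtain g where g: "g \<in> \<Gamma>" "g q \<noteq> q" by blast
    have Nq: "UNIV - {q} \<in> null_sets \<nu>"
    proof -
      have "{y. Inr y \<noteq> p} = UNIV - {q}" using Inr by auto
      with N show ?thesis by simp
    qed
    have "{g q} \<in> null_sets \<nu>" by (rule null_sets_subset[OF Nq]) (use g(2) sp in auto)
    then have "measure \<nu> {g q} = 0" by (simp add: null_setsD1 measure_def)
    then have "measure \<nu> (iv g ` {g q}) = 0"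
      by (rule quasi_conformalD(3)[OF assms(1) inv_mem[OF g(1)], rotated]) simp
    then have "measure \<nu> {q} = 0" using g(1) by simp
    moreover have "measure \<nu> (UNIV - {q}) = 0" using Nq by (simp add: null_setsD1 measure_def)
    moreover have "measure \<nu> ({q} \<union> (UNIV - {q})) \<le> measure \<nu> {q} + measure \<nu> (UNIV - {q})"
      by (rule measure_Un_le) (simp_all add: sp)
    ultimately show False using assms(2) by simp
  qed
qed

text \<open>The points far from g^-1 carry mass at least c uniformly in g, and g maps them onto its
  shadow, scaling mass by the weight up to a constant. The threshold e0 is the radius of
  non-concentration of the given measure.\<close>

lemma shadow_lower:
  assumes "quasi_conformal \<nu>" "measure \<nu> UNIV > 0"
  obtains e0 where "e0 > 0"
    "\<And>e. 0 < e \<Longrightarrow> e \<le> e0 \<Longrightarrow> \<exists>D>0. \<forall>g\<in>\<Gamma>. wt g \<le> D * measure \<nu> (shadow e g)"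
proof -
  obtain e0 c where e0: "e0 > 0" "c > 0" "\<And>g. g \<in> \<Gamma> \<Longrightarrow> measure \<nu> {y. d (Inr y) (Inl g) > e0} \<ge> c"
    by (rule not_concentrated[OF assms]) (rule that)
  interpret finite_measure \<nu> by (rule quasi_conformalD(1)[OF assms(1)])
  have sp: "sets \<nu> = sets borel" by (rule quasi_conformalD(2)[OF assms(1)])
  show ?thesis
  proof (rule that[OF e0(1)])
    fix e :: real assume e: "0 < e" "e \<le> e0"
    obtain D where D: "D > 0" "\<And>g A. g \<in> \<Gamma> \<Longrightarrow> A \<in> sets borel \<Longrightarrow> A \<subseteq> {y. d (Inr y) (Inl (iv g)) > e} \<Longrightarrow>
        measure \<nu> (g ` A) \<le> D * wt g * measure \<nu> A \<and> wt g * measure \<nu> A \<le> D * measure \<nu> (g ` A)"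
      by (rule quasi_conformal_bound[OF assms(1) e(1)]) (rule that)
    have "wt g \<le> D / c * measure \<nu> (shadow e g)" if g: "g \<in> \<Gamma>" for g
    proof -
      have "c \<le> measure \<nu> {y. d (Inr y) (Inl (iv g)) > e0}" using e0(3) g by simp
      also have "\<dots> \<le> measure \<nu> {y. d (Inr y) (Inl (iv g)) > e}"
        by (rule finite_measure_mono) (use e borel_far g sp in auto)
      finally have "wt g * c \<le> wt g * measure \<nu> {y. d (Inr y) (Inl (iv g)) > e}"
        using wt_pos[of g] by (intro mult_left_mono) auto
      also have "\<dots> \<le> D * measure \<nu> (shadow e g)"
        unfolding shadow_image[OF g] by (rule D(2)[THEN conjunct2]) (use g borel_far in auto)
      finally show ?thesis using e0(2) by (simp add: field_simps)
    qed
    then show "\<exists>D>0. \<forall>g\<in>\<Gamma>. wt g \<le> D * measure \<nu> (shadow e g)"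
      using D(1) e0(2) by (intro exI[of _ "D / c"]) simp
  qed
qed

end

subsection \<open>Divergence at the critical exponent\<close>

locale divergent_group = expanding_group \<Gamma> d \<sigma> mag \<delta>
  for \<Gamma> :: "('m::polish_space \<Rightarrow> 'm) set"
    and d :: "('m \<Rightarrow> 'm) + 'm \<Rightarrow> ('m \<Rightarrow> 'm) + 'm \<Rightarrow> real"
    and \<sigma> :: "('m \<Rightarrow> 'm) \<Rightarrow> 'm \<Rightarrow> real"
    and mag :: "('m \<Rightarrow> 'm) \<Rightarrow> real"
    and \<delta> :: real +
  assumes diverges: "poincare_series \<Gamma> mag \<delta> = \<infinity>"
begin

section \<open>Partial sums of the Poincare series\<close>

definition sublevel :: "real \<Rightarrow> ('m \<Rightarrow> 'm) set" where
  "sublevel t = {g \<in> \<Gamma>. mag g \<le> t}"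

lemma finite_sublevel [simp]: "finite (sublevel t)"
  unfolding sublevel_def by (rule finite_mag)

lemma sublevel_mono: "s \<le> t \<Longrightarrow> sublevel s \<subseteq> sublevel t"
  by (auto simp: sublevel_def)

lemma sublevel_subset: "sublevel t \<subseteq> \<Gamma>"
  by (auto simp: sublevel_def)

text \<open>Every finite set of elements lies in a sublevel set and weights are positive, so a bound
  on the sublevel sums would bound the series.\<close>

lemma partial_sums_unbounded: "\<exists>t0. \<forall>t\<ge>t0. B \<le> sum wt (sublevel t)"
proof (rule ccontr)
  assume no: "\<not> ?thesis"
  have bound: "sum wt (sublevel t) < B" for t
  proof (rule ccontr)
    assume "\<not> ?thesis"
    then have "B \<le> sum wt (sublevel s)" if "s \<ge> t" for s
      using sum_mono2[OF finite_sublevel sublevel_mono[OF that], of wt] wt_pos less_imp_le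
      by (meson not_less order_trans)
    with no show False by blast
  qed
  have "poincare_series \<Gamma> mag \<delta> \<le> ennreal B"
    unfolding poincare_series_def
  proof (subst nonneg_infsum_complete)
    show "(SUP F\<in>{F. finite F \<and> F \<subseteq> \<Gamma>}. \<Sum>\<gamma>\<in>F. ennreal (exp (- \<delta> * mag \<gamma>))) \<le> ennreal B"
    proof (rule SUP_least, elim CollectE conjE)
      fix F assume F: "finite F" "F \<subseteq> \<Gamma>"
      have sub: "F \<subseteq> sublevel (Max (insert 0 (mag ` F)))"
        using F by (auto simp: sublevel_def intro!: Max_ge)
      have "(\<Sum>\<gamma>\<in>F. ennreal (exp (- \<delta> * mag \<gamma>))) = ennreal (sum wt F)"
        by (simp add: wt_def sum_ennreal)
      also have "sum wt F \<le> sum wt (sublevel (Max (insert 0 (mag ` F))))"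
        by (rule sum_mono2[OF finite_sublevel sub]) (use wt_pos in \<open>auto intro: less_imp_le\<close>)
      also have "\<dots> \<le> B" using bound less_imp_le by blast
      finally show "(\<Sum>\<gamma>\<in>F. ennreal (exp (- \<delta> * mag \<gamma>))) \<le> ennreal B"
        by (simp add: ennreal_leI)
    qed
  qed simp
  with diverges show False by (simp add: top_unique)
qed

lemma inj_translate: "g \<in> \<Gamma> \<Longrightarrow> S \<subseteq> \<Gamma> \<Longrightarrow> inj_on (\<lambda>h. iv g \<circ> h) S"
  by (rule inj_on_inverseI[of _ "\<lambda>h. g \<circ> h"]) (simp add: o_assoc)

lemma translate_subset:
  assumes "g \<in> \<Gamma>" "S \<subseteq> \<Gamma>" "\<And>h. h \<in> S \<Longrightarrow> mag (iv g \<circ> h) \<le> T"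
  shows "(\<lambda>h. iv g \<circ> h) ` S \<subseteq> sublevel T"
proof
  fix b assume "b \<in> (\<lambda>h. iv g \<circ> h) ` S"
  then obtain h where "h \<in> S" "b = iv g \<circ> h" by blast
  then show "b \<in> sublevel T" using assms subsetD[OF assms(2)] by (simp add: sublevel_def)
qed

lemma card_translate:
  assumes "g \<in> \<Gamma>" "S \<subseteq> \<Gamma>" "\<And>h. h \<in> S \<Longrightarrow> mag (iv g \<circ> h) \<le> T"
  shows "card S \<le> card (sublevel T)"
  using card_inj_on_le[OF inj_translate[OF assms(1,2)] translate_subset[OF assms] finite_sublevel] .

lemma sum_translate:
  assumes "g \<in> \<Gamma>" "S \<subseteq> \<Gamma>" "\<And>h. h \<in> S \<Longrightarrow> mag (iv g \<circ> h) \<le> T"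
  shows "(\<Sum>h\<in>S. wt (iv g \<circ> h)) \<le> sum wt (sublevel T)"
proof -
  have "(\<Sum>h\<in>S. wt (iv g \<circ> h)) = sum wt ((\<lambda>h. iv g \<circ> h) ` S)"
    using sum.reindex[OF inj_translate[OF assms(1,2)], of wt] by (simp only: o_def)
  also have "\<dots> \<le> sum wt (sublevel T)"
    by (rule sum_mono2[OF finite_sublevel translate_subset[OF assms]]) (use wt_pos in \<open>auto intro: less_imp_le\<close>)
  finally show ?thesis .
qed

lemma wt_submult:
  assumes "mag b \<le> mag h - mag g + K"
  shows "wt h \<le> exp (\<delta> * K) * wt g * wt b"
proof -
  have "\<delta> * (mag g + mag b - K) \<le> \<delta> * mag h"
    using assms delta_nonneg by (intro mult_left_mono) auto
  then have "- \<delta> * mag h \<le> \<delta> * K + (- \<delta> * mag g) + (- \<delta> * mag b)"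
    by (simp add: algebra_simps)
  then show ?thesis unfolding wt_def exp_add[symmetric] by simp
qed

section \<open>Quasi-independence and the second moment argument\<close>

text \<open>Shadows with magnitudes between t and t + K cover each point a bounded number of times,
  so their total mass, and by the lower bound their total weight, is bounded independently of t.
  This compensates the enlarged range of summation in the second moment.\<close>

lemma annulus_bound:
  assumes "quasi_conformal \<nu>" "e > 0" "D > 0" and low: "\<And>g. g \<in> \<Gamma> \<Longrightarrow> wt g \<le> D * measure \<nu> (shadow e g)"
  shows "\<exists>A. \<forall>t. sum wt (sublevel (t + K)) \<le> sum wt (sublevel t) + A"
proof -
  interpret finite_measure \<nu> by (rule quasi_conformalD(1)[OF assms(1)])
  have sp: "sets \<nu> = sets borel" by (rule quasi_conformalD(2)[OF assms(1)])
  obtain F K' where K': "\<And>g h x. g \<in> \<Gamma> \<Longrightarrow> h \<in> \<Gamma> \<Longrightarrow> mag g \<le> mag h \<Longrightarrow> x \<in> shadow e g \<Longrightarrow> x \<in> shadow e h \<Longrightarrow>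
      mag (iv g \<circ> h) \<le> mag h - mag g + K'"
    by (rule shadow_transition[OF assms(2)]) (rule that)
  define N where "N = card (sublevel (K + K'))"
  have "sum wt (sublevel (t + K)) \<le> sum wt (sublevel t) + D * (N * measure \<nu> (space \<nu>))" for t
  proof -
    define Ann where "Ann = sublevel (t + K) - sublevel t"
    have Ann: "finite Ann" "Ann \<subseteq> \<Gamma>" "\<And>g. g \<in> Ann \<Longrightarrow> t < mag g \<and> mag g \<le> t + K"
      by (simp add: Ann_def) (auto simp: Ann_def sublevel_def)
    have m: "shadow e g \<in> sets \<nu>" if "g \<in> Ann" for g using that Ann(2) sp borel_shadow by auto
    have cnt: "(\<Sum>g\<in>Ann. indicator (shadow e g) x) \<le> real N" for x
    proof -
      define G where "G = {g \<in> Ann. x \<in> shadow e g}"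
      have G: "finite G" "G \<subseteq> Ann" using Ann(1) by (auto simp: G_def)
      have "(\<Sum>g\<in>Ann. indicator (shadow e g) x) = (\<Sum>g\<in>Ann. if x \<in> shadow e g then 1 else (0::real))"
        by (intro sum.cong) (auto simp: indicator_def)
      also have "\<dots> = real (card G)" using Ann(1) by (simp add: G_def sum.If_cases Int_def)
      also have "card G \<le> N"
      proof (cases "G = {}")
        case False
        \<comment> \<open>Taking an element of least magnitude lets the transition estimate apply to
          all others over x: translating by g^-1 injects them into a fixed finite sublevel
          set.\<close>
        define g where "g = arg_min_on mag G"
        have g: "g \<in> G" "\<And>h. h \<in> G \<Longrightarrow> mag g \<le> mag h"
          unfolding g_def by (rule arg_min_if_finite(1)[OF G(1) False])
            (rule arg_min_least[OF G(1) False])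
        have gG: "g \<in> \<Gamma>" "G \<subseteq> \<Gamma>" using g(1) G(2) Ann(2) by auto
        show ?thesis unfolding N_def
        proof (rule card_translate[OF gG])
          fix h assume h: "h \<in> G"
          have "mag (iv g \<circ> h) \<le> mag h - mag g + K'"
            by (rule K'[of g h x]) (use g(1) h gG g(2)[OF h] in \<open>auto simp: G_def\<close>)
          then show "mag (iv g \<circ> h) \<le> K + K'"
            using Ann(3)[of g] Ann(3)[of h] g(1) h G(2) by force
        qed
      qed (simp add: N_def)
      finally show ?thesis by simp
    qed
    have "sum wt Ann \<le> D * (\<Sum>g\<in>Ann. measure \<nu> (shadow e g))"
      unfolding sum_distrib_left using low Ann(2) by (intro sum_mono) auto
    also have "(\<Sum>g\<in>Ann. measure \<nu> (shadow e g)) = (\<integral>x. (\<Sum>g\<in>Ann. indicator (shadow e g) x) \<partial>\<nu>)"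
      using m by (subst Bochner_Integration.integral_sum) (auto simp: emeasure_eq_measure)
    also have "\<dots> \<le> (\<integral>x. real N \<partial>\<nu>)"
      using m cnt by (intro integral_mono) (auto simp: emeasure_eq_measure)
    also have "\<dots> = N * measure \<nu> (space \<nu>)" by simp
    finally have "sum wt Ann \<le> D * (N * measure \<nu> (space \<nu>))" using assms(3) by simp
    moreover have "sum wt (sublevel (t + K)) \<le> sum wt (sublevel t \<union> Ann)"
      by (rule sum_mono2) (use wt_pos Ann(1) in \<open>auto simp: Ann_def intro: less_imp_le\<close>)
    moreover have "sum wt (sublevel t \<union> Ann) = sum wt (sublevel t) + sum wt Ann"
      by (rule sum.union_disjoint) (auto simp: Ann_def)
    ultimately show ?thesis by simp
  qed
  then show ?thesis by blast
qed

text \<open>If the shadows of \<open>g\<close> and \<open>h\<close> overlap, then the weight of \<open>h\<close> is at most a constant times the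
  product of the weights of \<open>g\<close> and of \<open>g\<inverse> h\<close>, which makes the shadows quasi-independent.\<close>

lemma second_moment:
  assumes "quasi_conformal \<nu>" "e > 0"
  shows "\<exists>M K. M > 0 \<and> (\<forall>S t. finite S \<longrightarrow> S \<subseteq> \<Gamma> \<longrightarrow> (\<forall>g\<in>S. 0 \<le> mag g \<and> mag g \<le> t) \<longrightarrow>
    (\<Sum>g\<in>S. \<Sum>h\<in>S. measure \<nu> (shadow e g \<inter> shadow e h)) \<le> M * sum wt S * sum wt (sublevel (t + K)))"
proof -
  interpret finite_measure \<nu> by (rule quasi_conformalD(1)[OF assms(1)])
  have sp: "sets \<nu> = sets borel" by (rule quasi_conformalD(2)[OF assms(1)])
  obtain F K where K: "K \<ge> 0" "\<And>g h x. g \<in> \<Gamma> \<Longrightarrow> h \<in> \<Gamma> \<Longrightarrow> mag g \<le> mag h \<Longrightarrow> x \<in> shadow e g \<Longrightarrow> x \<in> shadow e h \<Longrightarrow>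
      mag (iv g \<circ> h) \<le> mag h - mag g + K"
    by (rule shadow_transition[OF assms(2)]) (rule that)
  obtain D where D: "D > 0" "\<And>g. g \<in> \<Gamma> \<Longrightarrow> measure \<nu> (shadow e g) \<le> D * wt g"
    by (rule shadow_upper[OF assms]) (rule that)
  define M where "M = D * exp (\<delta> * K)"
  have M: "M > 0" using D(1) by (simp add: M_def)
  have "(\<Sum>g\<in>S. \<Sum>h\<in>S. measure \<nu> (shadow e g \<inter> shadow e h)) \<le> 2 * M * sum wt S * sum wt (sublevel (t + K))"
    if S: "finite S" "S \<subseteq> \<Gamma>" "\<forall>g\<in>S. 0 \<le> mag g \<and> mag g \<le> t" for S t
  proof -
    define f where "f g h = measure \<nu> (shadow e g \<inter> shadow e h)" for g h
    have f_nonneg: "f g h \<ge> 0" for g h by (simp add: f_def)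
    \<comment> \<open>Only pairs ordered by magnitude are treated, as the transition estimate
      requires. For fixed g the translates g^-1 h are distinct and, since mag g is nonnegative, have
      magnitude at most t + K.\<close>
    have half: "(\<Sum>h\<in>S. if mag g \<le> mag h then f g h else 0) \<le> M * wt g * sum wt (sublevel (t + K))"
      if g: "g \<in> S" for g
    proof -
      define H where "H = {h \<in> S. mag g \<le> mag h \<and> shadow e g \<inter> shadow e h \<noteq> {}}"
      have H: "finite H" "H \<subseteq> S" using S(1) by (auto simp: H_def)
      have gG: "g \<in> \<Gamma>" "H \<subseteq> \<Gamma>" using g S(2) H(2) by auto
      have tr: "mag (iv g \<circ> h) \<le> mag h - mag g + K" if h: "h \<in> H" for h
      proof -
        from h obtain x where "x \<in> shadow e g" "x \<in> shadow e h" by (auto simp: H_def)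
        then show ?thesis using K(2)[of g h x] gG h by (auto simp: H_def)
      qed
      have "(\<Sum>h\<in>S. if mag g \<le> mag h then f g h else 0) = (\<Sum>h\<in>H. f g h)"
        by (rule sum.mono_neutral_cong_right) (use S(1) in \<open>auto simp: H_def f_def\<close>)
      also have "\<dots> \<le> (\<Sum>h\<in>H. M * wt g * wt (iv g \<circ> h))"
      proof (rule sum_mono)
        fix h assume h: "h \<in> H"
        have "f g h \<le> measure \<nu> (shadow e h)"
          unfolding f_def using h gG sp borel_shadow by (intro finite_measure_mono) auto
        also have "\<dots> \<le> D * wt h" using D(2) h gG by auto
        also have "\<dots> \<le> D * (exp (\<delta> * K) * wt g * wt (iv g \<circ> h))"
          using D(1) wt_submult[OF tr[OF h]] by (intro mult_left_mono) auto
        finally show "f g h \<le> M * wt g * wt (iv g \<circ> h)" by (simp add: M_def mult_ac)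
      qed
      also have "\<dots> = M * wt g * (\<Sum>h\<in>H. wt (iv g \<circ> h))" by (simp add: sum_distrib_left)
      also have "\<dots> \<le> M * wt g * sum wt (sublevel (t + K))"
      proof (rule mult_left_mono)
        show "(\<Sum>h\<in>H. wt (iv g \<circ> h)) \<le> sum wt (sublevel (t + K))"
        proof (rule sum_translate[OF gG])
          fix h assume h: "h \<in> H"
          have "mag h \<le> t" "0 \<le> mag g" using S(3) g h H(2) by auto
          with tr[OF h] show "mag (iv g \<circ> h) \<le> t + K" by linarith
        qed
      qed (use M wt_pos[of g] in simp)
      finally show ?thesis .
    qed
    \<comment> \<open>Every pair is ordered in at least one way; pairs of equal magnitude are
      counted twice, which only enlarges the bound.\<close>
    have "(\<Sum>g\<in>S. \<Sum>h\<in>S. f g h) \<le>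
        (\<Sum>g\<in>S. \<Sum>h\<in>S. (if mag g \<le> mag h then f g h else 0) + (if mag h \<le> mag g then f h g else 0))"
      by (intro sum_mono) (use f_nonneg in \<open>auto simp: f_def Int_commute\<close>)
    also have "\<dots> = (\<Sum>g\<in>S. \<Sum>h\<in>S. if mag g \<le> mag h then f g h else 0) +
        (\<Sum>g\<in>S. \<Sum>h\<in>S. if mag h \<le> mag g then f h g else 0)"
      by (simp add: sum.distrib)
    also have "(\<Sum>g\<in>S. \<Sum>h\<in>S. if mag h \<le> mag g then f h g else 0) =
        (\<Sum>g\<in>S. \<Sum>h\<in>S. if mag g \<le> mag h then f g h else 0)"
      by (rule sum.swap)
    finally have "(\<Sum>g\<in>S. \<Sum>h\<in>S. f g h) \<le> 2 * (\<Sum>g\<in>S. \<Sum>h\<in>S. if mag g \<le> mag h then f g h else 0)"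
      by simp
    also have "\<dots> \<le> 2 * (\<Sum>g\<in>S. M * wt g * sum wt (sublevel (t + K)))"
      using half by (intro mult_left_mono sum_mono) auto
    also have "\<dots> = 2 * M * sum wt S * sum wt (sublevel (t + K))"
      by (simp add: sum_distrib_left sum_distrib_right mult_ac)
    finally show ?thesis by (simp add: f_def)
  qed
  then show ?thesis using M by (intro exI[of _ "2 * M"] exI[of _ K]) simp
qed

text \<open>If the limsup set were null, the open tails V n would have small measure. The sum Z of
  the indicators of many shadows is supported in V n, and its second moment is at most a constant
  times the square of the total weight Q. Together these make its integral smaller than the lower
  bound Q / D.\<close>

lemma limsup_shadow_positive:
  assumes qc: "quasi_conformal \<nu>" and e: "e > 0" and D: "D > 0"
    and low: "\<And>g. g \<in> \<Gamma> \<Longrightarrow> wt g \<le> D * measure \<nu> (shadow e g)"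
  shows "measure \<nu> (limsup_shadow e) > 0"
proof (rule ccontr)
  assume "\<not> ?thesis"
  then have null: "measure \<nu> (limsup_shadow e) = 0" using measure_nonneg[of \<nu> "limsup_shadow e"] by linarith
  interpret finite_measure \<nu> by (rule quasi_conformalD(1)[OF qc])
  have sp: "sets \<nu> = sets borel" by (rule quasi_conformalD(2)[OF qc])
  obtain M K where M: "M > 0" and mom: "\<forall>S t. finite S \<longrightarrow> S \<subseteq> \<Gamma> \<longrightarrow>
      (\<forall>g\<in>S. 0 \<le> mag g \<and> mag g \<le> t) \<longrightarrow>
    (\<Sum>g\<in>S. \<Sum>h\<in>S. measure \<nu> (shadow e g \<inter> shadow e h)) \<le> M * sum wt S * sum wt (sublevel (t + K))"
    using second_moment[OF qc e] by (elim exE conjE)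
  have "\<exists>A. \<forall>t. sum wt (sublevel (t + K)) \<le> sum wt (sublevel t) + A"
    by (rule annulus_bound[OF qc e D]) (rule low)
  then obtain A where A: "\<forall>t. sum wt (sublevel (t + K)) \<le> sum wt (sublevel t) + A" ..
  define V where "V n = (\<Union>g\<in>{g \<in> \<Gamma>. mag g > real n}. shadow e g)" for n
  have V: "V n \<in> sets \<nu>" for n unfolding V_def using open_tail sp by simp
  \<comment> \<open>Chosen so that the second moment contributes exactly Q / D below; the bound on V
    n is then fitted to make the other term smaller than Q / D.\<close>
  define c where "c = 2 * M * D"
  have lam: "c > 0" using M D by (simp add: c_def)
  have "(\<lambda>n. measure \<nu> (V n)) \<longlonglongrightarrow> measure \<nu> (\<Inter>n. V n)"
  proof (rule finite_Lim_measure_decseq)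
    show "range V \<subseteq> sets \<nu>" using V by blast
    show "decseq V"
      unfolding decseq_def V_def by (intro allI impI UN_mono) auto
  qed
  moreover have "(\<Inter>n. V n) = limsup_shadow e" by (simp add: V_def limsup_shadow_eq)
  ultimately have "(\<lambda>n. measure \<nu> (V n)) \<longlonglongrightarrow> 0" using null by simp
  then have "\<forall>\<^sub>F n in sequentially. measure \<nu> (V n) < 1 / (c * D)"
    by (rule order_tendstoD(2)) (use lam D in simp)
  then obtain n where n: "measure \<nu> (V n) < 1 / (c * D)"
    by (auto simp: eventually_sequentially)
  \<comment> \<open>Large enough that Q dominates both the discarded initial weight and the layer
    constant A, which yields a sum of at most 2 Q up to t + K.\<close>
  define B where "B = 2 * sum wt (sublevel n) + A + 1"
  obtain t where t: "\<bar>B\<bar> + 1 + sum wt (sublevel n) \<le> sum wt (sublevel t)" "t \<ge> n"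
  proof -
    obtain t0 where "\<forall>t\<ge>t0. \<bar>B\<bar> + 1 + sum wt (sublevel n) \<le> sum wt (sublevel t)"
      using partial_sums_unbounded by blast
    then show thesis using that[of "max t0 n"] by simp
  qed
  \<comment> \<open>Discarding magnitudes up to n keeps the shadows inside V n and the remaining
    magnitudes nonnegative.\<close>
  define S where "S = sublevel t - sublevel n"
  define Q where "Q = sum wt S"
  have S: "finite S" "S \<subseteq> \<Gamma>" "\<forall>g\<in>S. 0 \<le> mag g \<and> mag g \<le> t" "\<And>g. g \<in> S \<Longrightarrow> g \<in> \<Gamma> \<and> mag g > n"
    unfolding S_def sublevel_def using finite_mag by auto
  have Qeq: "Q = sum wt (sublevel t) - sum wt (sublevel n)"
    unfolding Q_def S_def by (rule sum_diff[OF finite_sublevel sublevel_mono[OF t(2)]])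
  have Q1: "Q \<ge> 1" using Qeq t(1) by linarith
  have Q2: "sum wt (sublevel (t + K)) \<le> 2 * Q"
    using spec[OF A, of t] t(1) Qeq sum_nonneg[of "sublevel n" wt, OF less_imp_le[OF wt_pos]]
    unfolding B_def by linarith
  have m: "shadow e g \<in> sets \<nu>" if "g \<in> S" for g using that S(2) sp borel_shadow by auto
  define Z where "Z x = (\<Sum>g\<in>S. indicator (shadow e g) x :: real)" for x
  define s where "s = c * Q"
  have s: "s > 0" using lam Q1 by (simp add: s_def)
  \<comment> \<open>The inequality of arithmetic and geometric means, 2 Z s \<le> s^2 + Z^2, divided
    by s; off V n the function Z vanishes. The double sum of indicators is Z squared.\<close>
  have pw: "2 * Z x \<le> s * indicator (V n) x + (\<Sum>g\<in>S. \<Sum>h\<in>S. indicator (shadow e g \<inter> shadow e h) x) / s" for x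
  proof -
    have ZZ: "(\<Sum>g\<in>S. \<Sum>h\<in>S. indicator (shadow e g \<inter> shadow e h) x) = Z x * Z x"
      by (simp add: Z_def sum_product indicator_inter_arith)
    show ?thesis
    proof (cases "x \<in> V n")
      case True
      have "0 \<le> (Z x - s)\<^sup>2" by simp
      then have "2 * Z x * s \<le> s * s + Z x * Z x" by (simp add: power2_eq_square algebra_simps)
      then have "2 * Z x \<le> s + Z x * Z x / s" using s by (simp add: field_simps)
      then show ?thesis using True unfolding ZZ by simp
    next
      case False
      then have "x \<notin> shadow e g" if "g \<in> S" for g using S(4)[OF that] by (auto simp: V_def)
      then have "Z x = 0" by (simp add: Z_def)
      then show ?thesis using s unfolding ZZ by (simp add: False)
    qed
  qed
  have "2 * (\<Sum>g\<in>S. measure \<nu> (shadow e g)) = (\<integral>x. 2 * Z x \<partial>\<nu>)"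
    unfolding Z_def using m by (simp add: emeasure_eq_measure)
  also have "\<dots> \<le> (\<integral>x. s * indicator (V n) x + (\<Sum>g\<in>S. \<Sum>h\<in>S. indicator (shadow e g \<inter> shadow e h) x) / s \<partial>\<nu>)"
    using m V pw unfolding Z_def by (intro integral_mono) (auto simp: emeasure_eq_measure)
  also have "\<dots> = s * measure \<nu> (V n) + (\<Sum>g\<in>S. \<Sum>h\<in>S. measure \<nu> (shadow e g \<inter> shadow e h)) / s"
    using m V by (simp add: emeasure_eq_measure)
  also have "\<dots> \<le> s * measure \<nu> (V n) + M * Q * (2 * Q) / s"
  proof -
    have "(\<Sum>g\<in>S. \<Sum>h\<in>S. measure \<nu> (shadow e g \<inter> shadow e h)) \<le> M * Q * sum wt (sublevel (t + K))"
      unfolding Q_def by (rule mom[THEN spec, THEN spec, THEN mp, THEN mp, THEN mp, OF S(1-3)])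
    also have "\<dots> \<le> M * Q * (2 * Q)" using M Q1 Q2 by (intro mult_left_mono) auto
    finally show ?thesis using s by (simp add: divide_right_mono)
  qed
  also have "M * Q * (2 * Q) / s = Q / D"
    using lam M D Q1 by (simp add: s_def c_def field_simps)
  also have "s * measure \<nu> (V n) < s * (1 / (c * D))"
    by (rule mult_strict_left_mono[OF n s])
  also have "s * (1 / (c * D)) = Q / D" using lam D by (simp add: s_def)
  finally have "(\<Sum>g\<in>S. measure \<nu> (shadow e g)) < Q / D" by simp
  moreover have "Q \<le> D * (\<Sum>g\<in>S. measure \<nu> (shadow e g))"
    unfolding Q_def sum_distrib_left using low S(2) by (intro sum_mono) auto
  ultimately show False using D by (simp add: field_simps)
qed

section \<open>Full measure of the conical limit set\<close>

lemma invariant_complement: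
  assumes "g \<in> \<Gamma>" "g ` A = A"
  shows "g ` (UNIV - A) = UNIV - A"
  using image_set_diff[OF bij_is_inj[OF bij_elem[OF assms(1)]], of UNIV A]
    bij_is_surj[OF bij_elem[OF assms(1)]] assms(2) by simp

text \<open>Positivity at a single size is enough: the restriction to the non-conical points would
  again be quasi-conformal, and it gives mass zero to every limsup set of shadows. The size is
  chosen after restricting, as e0 belongs to the restricted measure.\<close>

lemma conical_full:
  assumes qc: "quasi_conformal \<nu>"
  shows "measure \<nu> (UNIV - conical_limit_set \<Gamma>) = 0"
proof (rule ccontr)
  define B where "B = UNIV - conical_limit_set \<Gamma>"
  assume "measure \<nu> (UNIV - conical_limit_set \<Gamma>) \<noteq> 0"
  then have pos: "measure \<nu> B > 0" by (simp add: B_def zero_less_measure_iff)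
  have B: "B \<in> sets borel" unfolding B_def using borel_conical by (intro sets.Diff) auto
  have inv: "g ` B = B" if "g \<in> \<Gamma>" for g
    unfolding B_def by (rule invariant_complement[OF that conical_invariant[OF that]])
  have qcB: "quasi_conformal (density \<nu> (indicator B))"
    by (rule quasi_conformal_restrict(1)[OF qc B]) (rule inv)
  have mB: "measure (density \<nu> (indicator B)) A = measure \<nu> (A \<inter> B)" if "A \<in> sets borel" for A
    by (rule quasi_conformal_restrict(2)[OF qc B _ that]) (rule inv)
  have posU: "measure (density \<nu> (indicator B)) UNIV > 0" using pos by (simp add: mB)
  obtain e0 where e0: "e0 > 0"
    "\<And>e. 0 < e \<Longrightarrow> e \<le> e0 \<Longrightarrow> \<exists>D>0. \<forall>g\<in>\<Gamma>. wt g \<le> D * measure (density \<nu> (indicator B)) (shadow e g)"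
    by (rule shadow_lower[OF qcB posU]) (rule that)
  obtain n where n: "1 / Suc n < e0" using nat_approx_posE[OF e0(1)] by blast
  then obtain D where D: "D > 0" "\<forall>g\<in>\<Gamma>. wt g \<le> D * measure (density \<nu> (indicator B)) (shadow (1 / Suc n) g)"
    using e0(2)[of "1 / Suc n"] by auto
  have "measure (density \<nu> (indicator B)) (limsup_shadow (1 / Suc n)) > 0"
    by (rule limsup_shadow_positive[OF qcB _ D(1)]) (use D(2) in auto)
  moreover have "limsup_shadow (1 / Suc n) \<inter> B = {}" unfolding B_def conical_eq by blast
  ultimately show False using borel_limsup_shadow by (simp add: mB)
qed

section \<open>Vitali covering and comparison of null sets\<close>

lemma ball_subset:
  assumes "open U" "x \<in> U"
  obtains r where "r > 0" "\<And>y. d (Inr y) (Inr x) < r \<Longrightarrow> y \<in> U"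
proof (rule ccontr)
  assume no: "\<not> thesis"
  have "\<forall>n. \<exists>y. d (Inr y) (Inr x) < 1 / Suc n \<and> y \<notin> U"
  proof (rule allI, rule ccontr)
    fix n assume "\<nexists>y. d (Inr y) (Inr x) < 1 / Suc n \<and> y \<notin> U"
    then have "\<And>y. d (Inr y) (Inr x) < 1 / Suc n \<Longrightarrow> y \<in> U" by blast
    with no that[of "1 / Suc n"] show False by simp
  qed
  from choice[OF this] obtain y where y: "\<forall>n. d (Inr (y n)) (Inr x) < 1 / Suc n \<and> y n \<notin> U" ..
  have "(\<lambda>n. d (Inr (y n)) (Inr x)) \<longlonglongrightarrow> 0"
  proof (rule tendsto_sandwich[OF _ _ tendsto_const LIMSEQ_Suc[OF lim_inverse_n']])
    show "\<forall>\<^sub>F n in sequentially. d (Inr (y n)) (Inr x) \<le> 1 / real (Suc n)"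
      by (rule always_eventually) (use y in \<open>simp add: less_imp_le\<close>)
  qed simp
  then have "lim (\<lambda>n. Inr (y n)) (Inr x)" by (simp add: X.limitin_metric_dist_null)
  then have "y \<longlonglongrightarrow> x" by (simp add: lim_Inr)
  from topological_tendstoD[OF this assms] have "\<forall>\<^sub>F n in sequentially. y n \<in> U" .
  then show False using y by (auto simp: eventually_sequentially)
qed

text \<open>All but finitely many shadows of size e lie within r / 2 of their group element, so
  among the infinitely many that contain x some lies in the r-ball about x.\<close>

lemma limsup_shadow_fine_cover:
  assumes "open U" "x \<in> U" "x \<in> limsup_shadow e" "e > 0"
  shows "\<exists>g\<in>\<Gamma>. x \<in> shadow e g \<and> shadow e g \<subseteq> U"
proof -
  obtain r where r: "r > 0" "\<And>y. d (Inr y) (Inr x) < r \<Longrightarrow> y \<in> U"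
    by (rule ball_subset[OF assms(1,2)]) (rule that)
  have "infinite ({g \<in> \<Gamma>. x \<in> shadow e g} - {g \<in> \<Gamma>. \<exists>y\<in>shadow e g. d (Inr y) (Inl g) \<ge> r / 2})"
    using assms(3) r(1) by (intro Diff_infinite_finite shadow_small assms(4)) (simp_all add: limsup_shadow_def)
  from infinite_imp_nonempty[OF this]
  obtain g where gT: "g \<in> {g \<in> \<Gamma>. x \<in> shadow e g} - {g \<in> \<Gamma>. \<exists>y\<in>shadow e g. d (Inr y) (Inl g) \<ge> r / 2}"
    unfolding ex_in_conv[symmetric] ..
  then have g: "g \<in> \<Gamma>" "x \<in> shadow e g" by simp_all
  have small: "d (Inr y) (Inl g) < r / 2" if "y \<in> shadow e g" for y
  proof (rule ccontr)
    assume n: "\<not> ?thesis"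
    have "g \<in> {g \<in> \<Gamma>. \<exists>y\<in>shadow e g. d (Inr y) (Inl g) \<ge> r / 2}"
      by (intro CollectI conjI bexI[of _ y]) (use that g(1) n in simp_all)
    with gT show False by (simp only: Diff_iff simp_thms)
  qed
  have "shadow e g \<subseteq> U"
  proof
    fix y assume y: "y \<in> shadow e g"
    have X: "Inr y \<in> XX" "Inl g \<in> XX" "Inr x \<in> XX" using g(1) by simp_all
    show "y \<in> U"
      by (rule r(2)) (use X.triangle[OF X] small[OF y] small[OF g(2)] X.commute[of "Inl g" "Inr x"] in linarith)
  qed
  with g show ?thesis by (intro bexI[of _ g] conjI)
qed

text \<open>On the disjoint subfamily G the weights bound \<nu>1 of the enlarged shadows from above
  and are bounded by \<nu>2 of the original ones, which fit disjointly into U. The constant is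
  independent of F and U, as the limiting arguments require.\<close>

lemma measure_shadow_union_le:
  assumes qc1: "quasi_conformal \<nu>1" and qc2: "quasi_conformal \<nu>2" and e: "e > 0"
    and low: "D > 0" "\<And>g. g \<in> \<Gamma> \<Longrightarrow> wt g \<le> D * measure \<nu>2 (shadow e g)"
  shows "\<exists>c\<ge>0. \<forall>F U. finite F \<longrightarrow> F \<subseteq> \<Gamma> \<longrightarrow> U \<in> sets borel \<longrightarrow> (\<forall>g\<in>F. shadow e g \<subseteq> U) \<longrightarrow>
    measure \<nu>1 (\<Union>g\<in>F. shadow e g) \<le> c * measure \<nu>2 U"
proof -
  interpret n1: finite_measure \<nu>1 by (rule quasi_conformalD(1)[OF qc1])
  interpret n2: finite_measure \<nu>2 by (rule quasi_conformalD(1)[OF qc2])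
  have sp: "sets \<nu>1 = sets borel" "sets \<nu>2 = sets borel"
    by (rule quasi_conformalD(2)[OF qc1], rule quasi_conformalD(2)[OF qc2])
  obtain e' where e': "e' > 0" "\<And>g h. g \<in> \<Gamma> \<Longrightarrow> h \<in> \<Gamma> \<Longrightarrow> mag g \<le> mag h \<Longrightarrow> shadow e g \<inter> shadow e h \<noteq> {} \<Longrightarrow>
      shadow e h \<subseteq> shadow e' g"
    by (rule shadow_enlargement[OF e]) (rule that)
  obtain D1 where D1: "D1 > 0" "\<And>g. g \<in> \<Gamma> \<Longrightarrow> measure \<nu>1 (shadow e g) \<le> D1 * wt g"
    by (rule shadow_upper[OF qc1 e]) (rule that)
  obtain D2 where D2: "D2 > 0" "\<And>g. g \<in> \<Gamma> \<Longrightarrow> measure \<nu>1 (shadow e' g) \<le> D2 * wt g"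
    by (rule shadow_upper[OF qc1 e'(1)]) (rule that)
  define c where "c = (D1 + D2) * D"
  have "measure \<nu>1 (\<Union>g\<in>F. shadow e g) \<le> c * measure \<nu>2 U"
    if F: "finite F" "F \<subseteq> \<Gamma>" and U: "U \<in> sets borel" "\<forall>g\<in>F. shadow e g \<subseteq> U" for F U
  proof -
    have "\<exists>G\<subseteq>F. disjoint_family_on (shadow e) G \<and>
        (\<Union>g\<in>F. shadow e g) \<subseteq> (\<Union>g\<in>G. shadow e' g) \<union> (\<Union>g\<in>G. shadow e g)"
      by (rule finite_vitali[OF e'(2) F])
    then obtain G where G: "G \<subseteq> F" "disjoint_family_on (shadow e) G"
      "(\<Union>g\<in>F. shadow e g) \<subseteq> (\<Union>g\<in>G. shadow e' g) \<union> (\<Union>g\<in>G. shadow e g)"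
      by (elim exE conjE)
    have fG: "finite G" "\<And>g. g \<in> G \<Longrightarrow> g \<in> \<Gamma>" using G(1) F finite_subset by auto
    have m: "shadow a g \<in> sets borel" if "g \<in> G" for a g using fG(2)[OF that] by (rule borel_shadow)
    have mU: "(\<Union>g\<in>G. shadow a g) \<in> sets borel" for a using fG(1) m by (intro sets.finite_UN) auto
    have "measure \<nu>1 (\<Union>g\<in>F. shadow e g) \<le> measure \<nu>1 ((\<Union>g\<in>G. shadow e' g) \<union> (\<Union>g\<in>G. shadow e g))"
      using mU sp by (intro n1.finite_measure_mono[OF G(3)]) simp
    also have "\<dots> \<le> measure \<nu>1 (\<Union>g\<in>G. shadow e' g) + measure \<nu>1 (\<Union>g\<in>G. shadow e g)"
      using mU sp by (intro measure_Un_le) simp_all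
    also have "\<dots> \<le> (\<Sum>g\<in>G. measure \<nu>1 (shadow e' g)) + (\<Sum>g\<in>G. measure \<nu>1 (shadow e g))"
      using m sp by (intro add_mono measure_UNION_le fG(1)) simp_all
    also have "\<dots> \<le> (\<Sum>g\<in>G. D2 * wt g) + (\<Sum>g\<in>G. D1 * wt g)"
      using D1(2) D2(2) fG(2) by (intro add_mono sum_mono) simp_all
    also have "\<dots> = (D1 + D2) * (\<Sum>g\<in>G. wt g)"
      by (simp add: sum_distrib_left[symmetric] algebra_simps)
    also have "\<dots> \<le> (D1 + D2) * (\<Sum>g\<in>G. D * measure \<nu>2 (shadow e g))"
      using D1(1) D2(1) low(2) fG(2) by (intro mult_left_mono sum_mono) simp_all
    also have "\<dots> = c * (\<Sum>g\<in>G. measure \<nu>2 (shadow e g))"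
      by (simp add: c_def sum_distrib_left mult_ac)
    also have "(\<Sum>g\<in>G. measure \<nu>2 (shadow e g)) = measure \<nu>2 (\<Union>g\<in>G. shadow e g)"
      using m sp by (intro n2.finite_measure_finite_Union[symmetric] fG(1) G(2)) auto
    also have "c * \<dots> \<le> c * measure \<nu>2 U"
      using U G(1) sp D1(1) D2(1) low(1)
      by (intro mult_left_mono n2.finite_measure_mono) (auto simp: c_def)
    finally show ?thesis .
  qed
  then show ?thesis using D1(1) D2(1) low(1) by (intro exI[of _ c]) (simp add: c_def)
qed

text \<open>Outer regularity puts the \<nu>2-null set E into an open U of small \<nu>2-measure. The
  shadows contained in U cover the points of E lying in infinitely many shadows, so \<nu>1 of these
  is at most c times that measure. The remaining points are null because conical points have full
  \<nu>1-measure.\<close>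

lemma quasi_conformal_null_transfer:
  assumes qc1: "quasi_conformal \<nu>1" and qc2: "quasi_conformal \<nu>2" and pos: "measure \<nu>2 UNIV > 0"
    and E: "E \<in> sets borel" "measure \<nu>2 E = 0"
  shows "measure \<nu>1 E = 0"
proof -
  interpret n1: finite_measure \<nu>1 by (rule quasi_conformalD(1)[OF qc1])
  interpret n2: finite_measure \<nu>2 by (rule quasi_conformalD(1)[OF qc2])
  have sp: "sets \<nu>1 = sets borel" "sets \<nu>2 = sets borel"
    by (rule quasi_conformalD(2)[OF qc1], rule quasi_conformalD(2)[OF qc2])
  obtain e0 where e0: "e0 > 0"
    "\<And>e. 0 < e \<Longrightarrow> e \<le> e0 \<Longrightarrow> \<exists>D>0. \<forall>g\<in>\<Gamma>. wt g \<le> D * measure \<nu>2 (shadow e g)"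
    by (rule shadow_lower[OF qc2 pos]) (rule that)
  have Lnull: "measure \<nu>1 (E \<inter> limsup_shadow e) = 0" if e: "0 < e" "e \<le> e0" for e
  proof -
    obtain D where D: "D > 0" "\<forall>g\<in>\<Gamma>. wt g \<le> D * measure \<nu>2 (shadow e g)"
      using e0(2)[OF e] by (elim exE conjE)
    have "\<exists>c\<ge>0. \<forall>F U. finite F \<longrightarrow> F \<subseteq> \<Gamma> \<longrightarrow> U \<in> sets borel \<longrightarrow> (\<forall>g\<in>F. shadow e g \<subseteq> U) \<longrightarrow>
        measure \<nu>1 (\<Union>g\<in>F. shadow e g) \<le> c * measure \<nu>2 U"
      by (rule measure_shadow_union_le[OF qc1 qc2 e(1) D(1)]) (rule bspec[OF D(2)])
    then obtain c where c: "c \<ge> 0" "\<forall>F U. finite F \<longrightarrow> F \<subseteq> \<Gamma> \<longrightarrow> U \<in> sets borel \<longrightarrow> (\<forall>g\<in>F. shadow e g \<subseteq> U) \<longrightarrow>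
        measure \<nu>1 (\<Union>g\<in>F. shadow e g) \<le> c * measure \<nu>2 U"
      by (elim exE conjE)
    have le: "measure \<nu>1 (E \<inter> limsup_shadow e) \<le> c * measure \<nu>2 U" if U: "open U" "E \<subseteq> U" for U
    proof -
      \<comment> \<open>Finite stages of the family of all shadows inside U: the covering bound
        concerns finite families, and continuity from below passes to their union.\<close>
      define F where "F n = {g \<in> sublevel (real n). shadow e g \<subseteq> U}" for n
      have F: "finite (F n)" "F n \<subseteq> \<Gamma>" "\<forall>g\<in>F n. shadow e g \<subseteq> U" for n
        using sublevel_subset by (simp_all add: F_def) blast
      have m: "(\<Union>g\<in>F n. shadow e g) \<in> sets \<nu>1" for n
        using F(1,2)[of n] sp borel_shadow by (intro sets.finite_UN) auto
      have "measure \<nu>1 (\<Union>g\<in>F n. shadow e g) \<le> c * measure \<nu>2 U" for n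
        by (rule c(2)[THEN spec, THEN spec, THEN mp, THEN mp, THEN mp, THEN mp, OF F(1,2) _ F(3)])
           (use U(1) in simp)
      moreover have "(\<lambda>n. measure \<nu>1 (\<Union>g\<in>F n. shadow e g)) \<longlonglongrightarrow> measure \<nu>1 (\<Union>n. \<Union>g\<in>F n. shadow e g)"
      proof (rule n1.finite_Lim_measure_incseq)
        show "incseq (\<lambda>n. \<Union>g\<in>F n. shadow e g)"
          unfolding incseq_def F_def sublevel_def by (intro allI impI UN_mono) auto
      qed (use m in blast)
      ultimately have 1: "measure \<nu>1 (\<Union>n. \<Union>g\<in>F n. shadow e g) \<le> c * measure \<nu>2 U"
        by (intro LIMSEQ_le_const2) auto
      have "E \<inter> limsup_shadow e \<subseteq> (\<Union>n. \<Union>g\<in>F n. shadow e g)"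
      proof
        fix x assume x: "x \<in> E \<inter> limsup_shadow e"
        then have "x \<in> U" "x \<in> limsup_shadow e" using U(2) by auto
        from limsup_shadow_fine_cover[OF U(1) this e(1)]
        obtain g where g: "g \<in> \<Gamma>" "x \<in> shadow e g" "shadow e g \<subseteq> U" by (elim bexE conjE)
        obtain n :: nat where "mag g \<le> n" using real_arch_simple by blast
        then have "g \<in> F n" using g by (simp add: F_def sublevel_def)
        then show "x \<in> (\<Union>n. \<Union>g\<in>F n. shadow e g)" using g(2) by blast
      qed
      then have "measure \<nu>1 (E \<inter> limsup_shadow e) \<le> measure \<nu>1 (\<Union>n. \<Union>g\<in>F n. shadow e g)"
        using m by (intro n1.finite_measure_mono sets.countable_UN) auto
      with 1 show ?thesis by linarith
    qed
    have "measure \<nu>1 (E \<inter> limsup_shadow e) \<le> 0 + x" if "x > 0" for x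
    proof -
      \<comment> \<open>Division by c + 1, since c may be zero.\<close>
      define y where "y = x / (c + 1)"
      have y: "y > 0" using that c(1) by (simp add: y_def)
      have "(INF U \<in> {U. E \<subseteq> U \<and> open U}. emeasure \<nu>2 U) = 0"
        using outer_regular[OF sp(2) _ E(1)] E(2) by (simp add: n2.emeasure_eq_measure)
      then have "(INF U \<in> {U. E \<subseteq> U \<and> open U}. emeasure \<nu>2 U) < ennreal y" using y by simp
      then obtain U where U: "E \<subseteq> U" "open U" "emeasure \<nu>2 U < ennreal y"
        unfolding INF_less_iff by blast
      then have "measure \<nu>2 U < y"
        using y by (simp add: n2.emeasure_eq_measure ennreal_less_iff)
      then have "c * measure \<nu>2 U \<le> c * y" using c(1) by (intro mult_left_mono) auto
      also have "\<dots> \<le> x" using that c(1) by (simp add: y_def field_simps)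
      finally show ?thesis using le[OF U(2,1)] by simp
    qed
    then have "measure \<nu>1 (E \<inter> limsup_shadow e) \<le> 0" by (rule field_le_epsilon)
    then show ?thesis using measure_nonneg[of \<nu>1] by (simp add: antisym)
  qed
  obtain k where k: "1 / Suc k < e0" using nat_approx_posE[OF e0(1)] by blast
  \<comment> \<open>The shift by k brings the size below e0. Limsup sets grow as the size decreases,
    so the shifted sequence still exhausts the conical limit set.\<close>
  have N1: "E \<inter> limsup_shadow (1 / Suc (n + k)) \<in> null_sets \<nu>1" for n
  proof -
    have "1 / real (Suc (n + k)) \<le> 1 / real (Suc k)" by (intro divide_left_mono) auto
    then have "measure \<nu>1 (E \<inter> limsup_shadow (1 / Suc (n + k))) = 0" using k by (intro Lnull) auto
    then show ?thesis using E(1) borel_limsup_shadow sp by (intro null_setsI) (simp_all add: n1.emeasure_eq_measure)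
  qed
  have N2: "UNIV - conical_limit_set \<Gamma> \<in> null_sets \<nu>1"
    using conical_full[OF qc1] borel_conical sp
    by (intro null_setsI) (simp_all add: n1.emeasure_eq_measure)
  have "(\<Union>n. E \<inter> limsup_shadow (1 / Suc (n + k))) \<union> (UNIV - conical_limit_set \<Gamma>) \<in> null_sets \<nu>1"
    using N1 N2 by (intro null_sets.Un null_sets_UN)
  moreover have "E \<subseteq> (\<Union>n. E \<inter> limsup_shadow (1 / Suc (n + k))) \<union> (UNIV - conical_limit_set \<Gamma>)"
  proof
    fix x assume x: "x \<in> E"
    show "x \<in> (\<Union>n. E \<inter> limsup_shadow (1 / Suc (n + k))) \<union> (UNIV - conical_limit_set \<Gamma>)"
    proof (cases "x \<in> conical_limit_set \<Gamma>")
      case True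
      then obtain n where "x \<in> limsup_shadow (1 / Suc n)" using conical_limsup_shadow by blast
      moreover have "1 / real (Suc (n + k)) \<le> 1 / real (Suc n)" by (intro divide_left_mono) auto
      ultimately have "x \<in> limsup_shadow (1 / Suc (n + k))" using limsup_shadow_mono by blast
      then show ?thesis using x by blast
    qed simp
  qed
  ultimately have "E \<in> null_sets \<nu>1" using null_sets_subset E(1) sp(1) by metis
  then show ?thesis by (simp add: null_setsD1 measure_def)
qed

text \<open>A is null for the restriction to its complement. If that restriction is nonzero, null
  sets transfer to the restriction to A, so A is null for \<nu> as well.\<close>

lemma quasi_conformal_ergodic:
  assumes qc: "quasi_conformal \<nu>" and A: "A \<in> sets borel" "\<And>g. g \<in> \<Gamma> \<Longrightarrow> g ` A = A"
  shows "measure \<nu> A = 0 \<or> measure \<nu> (UNIV - A) = 0"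
proof (rule disjCI)
  assume "measure \<nu> (UNIV - A) \<noteq> 0"
  then have pos: "measure \<nu> (UNIV - A) > 0" using measure_nonneg[of \<nu> "UNIV - A"] by linarith
  have B: "UNIV - A \<in> sets borel" using A(1) by simp
  have inv: "g ` (UNIV - A) = UNIV - A" if "g \<in> \<Gamma>" for g
    by (rule invariant_complement[OF that A(2)[OF that]])
  have qcA: "quasi_conformal (density \<nu> (indicator A))"
    by (rule quasi_conformal_restrict(1)[OF qc A(1)]) (rule A(2))
  have mA: "measure (density \<nu> (indicator A)) A = measure \<nu> (A \<inter> A)"
    by (rule quasi_conformal_restrict(2)[OF qc A(1) _ A(1)]) (rule A(2))
  have qcB: "quasi_conformal (density \<nu> (indicator (UNIV - A)))"
    by (rule quasi_conformal_restrict(1)[OF qc B]) (rule inv)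
  have mB: "measure (density \<nu> (indicator (UNIV - A))) X = measure \<nu> (X \<inter> (UNIV - A))"
    if "X \<in> sets borel" for X
    by (rule quasi_conformal_restrict(2)[OF qc B _ that]) (rule inv)
  have "measure (density \<nu> (indicator A)) A = 0"
    by (rule quasi_conformal_null_transfer[OF qcA qcB _ A(1)]) (use pos A(1) mB in simp_all)
  then show "measure \<nu> A = 0" using mA by simp
qed

subsection \<open>Patterson--Sullivan measures\<close>

lemma patterson_sullivanD:
  assumes "patterson_sullivan \<Gamma> \<sigma> C \<delta> \<mu>"
  shows "prob_space \<mu>" "sets \<mu> = sets borel"
    and "g \<in> \<Gamma> \<Longrightarrow> absolutely_continuous \<mu> (distr \<mu> borel g)"
    and "g \<in> \<Gamma> \<Longrightarrow> AE x in \<mu>.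
       ennreal (exp (- C - \<delta> * \<sigma> (iv g) x)) \<le> RN_deriv \<mu> (distr \<mu> borel g) x \<and>
       RN_deriv \<mu> (distr \<mu> borel g) x \<le> ennreal (exp (C - \<delta> * \<sigma> (iv g) x))"
  using assms by (simp_all add: patterson_sullivan_def)

lemma measurable_elem:
  assumes "g \<in> \<Gamma>" "sets \<mu> = sets borel"
  shows "g \<in> measurable \<mu> borel"
  unfolding measurable_cong_sets[OF assms(2) refl]
  by (rule borel_measurable_continuous_onI[OF cont_elem[OF assms(1)]])

lemma density_pushforward:
  assumes ps: "patterson_sullivan \<Gamma> \<sigma> C \<delta> \<mu>" and g: "g \<in> \<Gamma>"
  shows "density \<mu> (RN_deriv \<mu> (distr \<mu> borel g)) = distr \<mu> borel g"
proof -
  interpret prob_space \<mu> by (rule patterson_sullivanD(1)[OF ps])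
  show ?thesis
    by (rule density_RN_deriv[OF patterson_sullivanD(3)[OF ps g]])
       (simp add: patterson_sullivanD(2)[OF ps])
qed

text \<open>The image of A under g has the mass that the pushforward by \<open>iv g\<close> gives to
  A. The density of this pushforward is controlled by \<sigma>(g, .), which on points away from g^-1
  is the magnitude up to a constant.\<close>

lemma patterson_sullivan_quasi_conformal:
  assumes ps: "patterson_sullivan \<Gamma> \<sigma> C \<delta> \<mu>"
  shows "quasi_conformal \<mu>"
proof -
  interpret prob_space \<mu> by (rule patterson_sullivanD(1)[OF ps])
  note sp = patterson_sullivanD(2)[OF ps]
  have fin: "finite_measure \<mu>" by unfold_locales
  have spc: "space \<mu> = UNIV" using sets_eq_imp_space_eq[OF sp] by simp
  have img: "emeasure \<mu> (g ` A) = emeasure (distr \<mu> borel (iv g)) A" if "g \<in> \<Gamma>" "A \<in> sets borel" for g A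
    using that measurable_elem[OF inv_mem[OF that(1)] sp]
    by (simp add: emeasure_distr spc image_eq_vimage)
  have null: "measure \<mu> (g ` A) = 0"
    if g: "g \<in> \<Gamma>" and A: "A \<in> sets borel" and z: "measure \<mu> A = 0" for g A
  proof -
    have "A \<in> null_sets \<mu>" using A z sp by (intro null_setsI) (simp_all add: emeasure_eq_measure)
    then have "A \<in> null_sets (distr \<mu> borel (iv g))"
      by (rule subsetD[OF patterson_sullivanD(3)[OF ps inv_mem[OF g], unfolded absolutely_continuous_def]])
    then show ?thesis
      using img[OF g A] by (simp add: null_setsD1 measure_def)
  qed
  have bound: "\<exists>D>0. \<forall>g\<in>\<Gamma>. \<forall>A\<in>sets borel. A \<subseteq> {y. d (Inr y) (Inl (iv g)) > e} \<longrightarrow>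
      measure \<mu> (g ` A) \<le> D * wt g * measure \<mu> A \<and> wt g * measure \<mu> A \<le> D * measure \<mu> (g ` A)"
    if epos: "e > 0" for e
  proof -
    obtain Ce where Ce: "Ce > 0"
      "\<And>g x. g \<in> \<Gamma> \<Longrightarrow> d (Inr x) (Inl (iv g)) > e \<Longrightarrow> \<bar>\<sigma> g x - mag g\<bar> \<le> Ce"
      by (rule mag_bound[OF epos]) (rule that)
    define D where "D = exp (\<bar>C\<bar> + \<delta> * Ce)"
    have D: "D > 0" by (simp add: D_def)
    have "measure \<mu> (g ` A) \<le> D * wt g * measure \<mu> A \<and> wt g * measure \<mu> A \<le> D * measure \<mu> (g ` A)"
      if g: "g \<in> \<Gamma>" and A: "A \<in> sets borel" and far: "A \<subseteq> {y. d (Inr y) (Inl (iv g)) > e}" for g A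
    proof -
      define h where "h = RN_deriv \<mu> (distr \<mu> borel (iv g))"
      have h: "h \<in> borel_measurable \<mu>" by (simp add: h_def)
      have E: "emeasure \<mu> (g ` A) = (\<integral>\<^sup>+x. h x * indicator A x \<partial>\<mu>)"
      proof -
        have "emeasure \<mu> (g ` A) = emeasure (density \<mu> h) A"
          unfolding h_def density_pushforward[OF ps inv_mem[OF g]] by (rule img[OF g A])
        then show ?thesis using A sp h by (simp add: emeasure_density)
      qed
      have bd: "AE x in \<mu>. x \<in> A \<longrightarrow> ennreal (wt g / D) \<le> h x \<and> h x \<le> ennreal (D * wt g)"
        using patterson_sullivanD(4)[OF ps inv_mem[OF g]]
      proof eventually_elim
        case (elim x)
        show ?case
        proof
          assume x: "x \<in> A"
          have "\<bar>\<sigma> g x - mag g\<bar> \<le> Ce" by (rule Ce(2)[OF g]) (use subsetD[OF far x] in simp)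
          then have "\<delta> * (mag g - Ce) \<le> \<delta> * \<sigma> g x" "\<delta> * \<sigma> g x \<le> \<delta> * (mag g + Ce)"
            using delta_nonneg by (intro mult_left_mono; linarith)+
          then have "wt g / D \<le> exp (- C - \<delta> * \<sigma> g x)" "exp (C - \<delta> * \<sigma> g x) \<le> D * wt g"
            unfolding wt_def D_def exp_diff[symmetric] exp_add[symmetric]
            by (simp_all add: algebra_simps)
          then have 1: "ennreal (wt g / D) \<le> ennreal (exp (- C - \<delta> * \<sigma> g x))"
            and 2: "ennreal (exp (C - \<delta> * \<sigma> g x)) \<le> ennreal (D * wt g)"
            by (simp_all only: ennreal_leI)
          have 3: "ennreal (exp (- C - \<delta> * \<sigma> g x)) \<le> h x" and 4: "h x \<le> ennreal (exp (C - \<delta> * \<sigma> g x))"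
            using elim g by (simp_all add: h_def)
          show "ennreal (wt g / D) \<le> h x \<and> h x \<le> ennreal (D * wt g)"
            using order_trans[OF 1 3] order_trans[OF 4 2] ..
        qed
      qed
      have "emeasure \<mu> (g ` A) \<le> (\<integral>\<^sup>+x. ennreal (D * wt g) * indicator A x \<partial>\<mu>)"
        unfolding E
      proof (rule nn_integral_mono_AE)
        show "AE x in \<mu>. h x * indicator A x \<le> ennreal (D * wt g) * indicator A x"
          using bd by eventually_elim (auto simp: indicator_def)
      qed
      also have "\<dots> = ennreal (D * wt g) * emeasure \<mu> A"
        using A sp by (simp add: nn_integral_cmult_indicator)
      finally have 1: "measure \<mu> (g ` A) \<le> D * wt g * measure \<mu> A"
        using D wt_pos[of g] by (simp add: emeasure_eq_measure flip: ennreal_mult')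
      have "ennreal (wt g / D) * emeasure \<mu> A = (\<integral>\<^sup>+x. ennreal (wt g / D) * indicator A x \<partial>\<mu>)"
        using A sp by (simp add: nn_integral_cmult_indicator)
      also have "\<dots> \<le> emeasure \<mu> (g ` A)"
        unfolding E
      proof (rule nn_integral_mono_AE)
        show "AE x in \<mu>. ennreal (wt g / D) * indicator A x \<le> h x * indicator A x"
          using bd by eventually_elim (auto simp: indicator_def)
      qed
      finally have "wt g / D * measure \<mu> A \<le> measure \<mu> (g ` A)"
        using D wt_pos[of g] by (simp add: emeasure_eq_measure flip: ennreal_mult')
      then have "wt g * measure \<mu> A \<le> D * measure \<mu> (g ` A)" using D by (simp add: field_simps)
      with 1 show ?thesis by simp
    qed
    with D show ?thesis by (intro exI[of _ D] conjI[of "D > 0"] ballI impI)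
  qed
  show ?thesis
    unfolding quasi_conformal_def by (intro conjI ballI allI impI fin sp null bound)
qed

section \<open>Density of one Patterson-Sullivan measure against another\<close>

text \<open>At the identity the lower and upper bounds on the derivative hold at a common point, and
  the cocycle terms in them coincide.\<close>

lemma patterson_sullivan_const_nonneg:
  assumes ps: "patterson_sullivan \<Gamma> \<sigma> C \<delta> \<mu>"
  shows "C \<ge> 0"
proof -
  interpret prob_space \<mu> by (rule patterson_sullivanD(1)[OF ps])
  have "AE x in \<mu>. C \<ge> 0"
    using patterson_sullivanD(4)[OF ps id_mem]
  proof eventually_elim
    fix x assume "ennreal (exp (- C - \<delta> * \<sigma> (iv id) x)) \<le> RN_deriv \<mu> (distr \<mu> borel id) x \<and>
      RN_deriv \<mu> (distr \<mu> borel id) x \<le> ennreal (exp (C - \<delta> * \<sigma> (iv id) x))"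
    from order_trans[OF conjunct1[OF this] conjunct2[OF this]] show "C \<ge> 0" by simp
  qed
  then show ?thesis by simp
qed

lemma patterson_sullivan_abs_cont:
  assumes "patterson_sullivan \<Gamma> \<sigma> C \<delta> \<mu>" "patterson_sullivan \<Gamma> \<sigma> C \<delta> \<nu>"
  shows "absolutely_continuous \<mu> \<nu>"
  unfolding absolutely_continuous_def
proof
  fix A assume A: "A \<in> null_sets \<mu>"
  interpret m: prob_space \<mu> by (rule patterson_sullivanD(1)[OF assms(1)])
  interpret n: prob_space \<nu> by (rule patterson_sullivanD(1)[OF assms(2)])
  note sp = patterson_sullivanD(2)[OF assms(1)] patterson_sullivanD(2)[OF assms(2)]
  have "measure \<mu> UNIV = 1" using m.prob_space sets_eq_imp_space_eq[OF sp(1)] by simp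
  then have "measure \<nu> A = 0"
    using A sp
    by (intro quasi_conformal_null_transfer[OF patterson_sullivan_quasi_conformal[OF assms(2)]
          patterson_sullivan_quasi_conformal[OF assms(1)]])
       (auto simp: null_sets_def m.emeasure_eq_measure)
  then show "A \<in> null_sets \<nu>"
    using A sp by (intro null_setsI) (auto simp: n.emeasure_eq_measure)
qed

text \<open>Both measures transform by the same cocycle, so their density is invariant up to the factor
  \<open>e\<^sup>2\<^sup>C\<close>.\<close>

lemma density_coarsely_invariant:
  assumes ps: "patterson_sullivan \<Gamma> \<sigma> C \<delta> \<mu>" "patterson_sullivan \<Gamma> \<sigma> C \<delta> \<nu>"
    and g: "g \<in> \<Gamma>"
  shows "AE x in \<mu>. RN_deriv \<mu> \<nu> (iv g x) \<le> ennreal (exp (2 * C)) * RN_deriv \<mu> \<nu> x"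
proof -
  interpret m: prob_space \<mu> by (rule patterson_sullivanD(1)[OF ps(1)])
  interpret n: prob_space \<nu> by (rule patterson_sullivanD(1)[OF ps(2)])
  note sp = patterson_sullivanD(2)[OF ps(1)] patterson_sullivanD(2)[OF ps(2)]
  define f where "f = RN_deriv \<mu> \<nu>"
  define h where "h = RN_deriv \<mu> (distr \<mu> borel g)"
  define k where "k = RN_deriv \<nu> (distr \<nu> borel g)"
  have f: "f \<in> borel_measurable borel" and h: "h \<in> borel_measurable borel" and k: "k \<in> borel_measurable borel"
    unfolding f_def h_def k_def
    using borel_measurable_RN_deriv[of \<mu>] borel_measurable_RN_deriv[of \<nu>]
    unfolding measurable_cong_sets[OF sp(1) refl] measurable_cong_sets[OF sp(2) refl] by simp_all
  have fg: "(\<lambda>x. f (iv g x)) \<in> borel_measurable borel"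
    using measurable_compose[OF measurable_elem[OF inv_mem[OF g] refl] f] .
  have fm: "f \<in> borel_measurable \<mu>" "h \<in> borel_measurable \<mu>" "k \<in> borel_measurable \<mu>"
    "(\<lambda>x. f (iv g x)) \<in> borel_measurable \<mu>"
    unfolding measurable_cong_sets[OF sp(1) refl] by (fact f h k fg)+
  have nu: "density \<mu> f = \<nu>"
    unfolding f_def
    by (rule m.density_RN_deriv[OF patterson_sullivan_abs_cont[OF ps]]) (simp add: sp)
  \<comment> \<open>The density of the pushforward of \<nu> against \<mu> is computed in two ways,
    through \<nu> and through the pushforward of \<mu>. Uniqueness of densities then gives f k = h
    (f \<circ> \<open>iv g\<close>).\<close>
  have "density \<mu> (\<lambda>x. f x * k x) = density (density \<mu> f) k"
    using fm by (simp add: density_density_eq)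
  also have "\<dots> = distr \<nu> borel g"
    unfolding nu k_def by (rule density_pushforward[OF ps(2) g])
  also have "\<dots> = density (distr \<mu> borel g) (\<lambda>x. f (iv g x))"
  proof (rule measure_eqI)
    fix A assume "A \<in> sets (distr \<nu> borel g)"
    then have A: "A \<in> sets borel" by simp
    have gA: "g -` A \<in> sets borel" using measurable_sets[OF measurable_elem[OF g refl] A] by simp
    have spc: "space \<nu> = UNIV" using sets_eq_imp_space_eq[OF sp(2)] by simp
    have "emeasure (distr \<nu> borel g) A = emeasure \<nu> (g -` A)"
      using A measurable_elem[OF g sp(2)] spc by (simp add: emeasure_distr)
    also have "\<dots> = (\<integral>\<^sup>+x. f x * indicator (g -` A) x \<partial>\<mu>)"
      using gA sp fm(1) unfolding nu[symmetric] by (simp add: emeasure_density)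
    also have "\<dots> = (\<integral>\<^sup>+x. f (iv g (g x)) * indicator A (g x) \<partial>\<mu>)"
      using g by (intro nn_integral_cong) (simp add: indicator_def)
    also have "\<dots> = (\<integral>\<^sup>+x. f (iv g x) * indicator A x \<partial>(distr \<mu> borel g))"
      using measurable_elem[OF g sp(1)] fg A by (subst nn_integral_distr) auto
    also have "\<dots> = emeasure (density (distr \<mu> borel g) (\<lambda>x. f (iv g x))) A"
      using fg A by (subst emeasure_density) auto
    finally show "emeasure (distr \<nu> borel g) A = emeasure (density (distr \<mu> borel g) (\<lambda>x. f (iv g x))) A" .
  qed simp
  also have "distr \<mu> borel g = density \<mu> h"
    unfolding h_def by (rule density_pushforward[OF ps(1) g, symmetric])
  also have "density (density \<mu> h) (\<lambda>x. f (iv g x)) = density \<mu> (\<lambda>x. h x * f (iv g x))"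
    using fm by (simp add: density_density_eq)
  finally have eq: "density \<mu> (\<lambda>x. f x * k x) = density \<mu> (\<lambda>x. h x * f (iv g x))" .
  have AEeq: "AE x in \<mu>. f x * k x = h x * f (iv g x)"
    by (rule m.density_unique[OF _ _ eq]) (use fm in measurable)
  \<comment> \<open>The bound on k holds \<nu>-almost everywhere, which in terms of \<mu> means
    almost everywhere on the set where f is positive; where f vanishes the product f k is zero
    anyway.\<close>
  have "AE x in density \<mu> f. k x \<le> ennreal (exp (C - \<delta> * \<sigma> (iv g) x))"
    using patterson_sullivanD(4)[OF ps(2) g] unfolding nu k_def by eventually_elim simp
  then have AEk: "AE x in \<mu>. 0 < f x \<longrightarrow> k x \<le> ennreal (exp (C - \<delta> * \<sigma> (iv g) x))"
    unfolding AE_density[OF fm(1)] .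
  have AEh: "AE x in \<mu>. ennreal (exp (- C - \<delta> * \<sigma> (iv g) x)) \<le> h x"
    using patterson_sullivanD(4)[OF ps(1) g] unfolding h_def by eventually_elim simp
  show ?thesis
    unfolding f_def[symmetric] using AEeq AEk AEh
  proof eventually_elim
    case (elim x)
    define s where "s = \<delta> * \<sigma> (iv g) x"
    have "ennreal (exp (- C - s)) * f (iv g x) \<le> h x * f (iv g x)"
      using elim(3) by (intro mult_right_mono) (simp_all add: s_def)
    also have "\<dots> = f x * k x" using elim(1) by simp
    also have "\<dots> \<le> f x * ennreal (exp (C - s))"
      using elim(2) by (cases "f x = 0") (auto simp: s_def zero_less_iff_neq_zero intro!: mult_left_mono)
    finally have "ennreal (exp (C + s)) * (ennreal (exp (- C - s)) * f (iv g x)) \<le>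
        ennreal (exp (C + s)) * (f x * ennreal (exp (C - s)))"
      by (rule mult_left_mono) simp
    moreover have "ennreal (exp (C + s)) * (ennreal (exp (- C - s)) * f (iv g x)) = f (iv g x)"
      by (simp add: mult.assoc[symmetric] ennreal_mult[symmetric] exp_add[symmetric])
    moreover have "ennreal (exp (C + s)) * (f x * ennreal (exp (C - s))) = ennreal (exp (2 * C)) * f x"
    proof -
      have "ennreal (exp (C + s)) * ennreal (exp (C - s)) = ennreal (exp (2 * C))"
        by (simp add: ennreal_mult[symmetric] exp_add[symmetric])
      then show ?thesis by (metis mult.assoc mult.commute)
    qed
    ultimately show ?case by simp
  qed
qed

text \<open>Ergodicity applies to the saturation A of the superlevel set of the density under the
  group. If A is null, so is the superlevel set; if A is conull, almost every point has a translate
  where the density exceeds s, and coarse invariance brings this back at the cost of exp(2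
  C).\<close>

lemma density_dichotomy:
  assumes ps: "patterson_sullivan \<Gamma> \<sigma> C \<delta> \<mu>" "patterson_sullivan \<Gamma> \<sigma> C \<delta> \<nu>"
  shows "(AE x in \<mu>. RN_deriv \<mu> \<nu> x \<le> s) \<or>
    (AE x in \<mu>. s \<le> ennreal (exp (2 * C)) * RN_deriv \<mu> \<nu> x)"
proof -
  interpret m: prob_space \<mu> by (rule patterson_sullivanD(1)[OF ps(1)])
  note sp = patterson_sullivanD(2)[OF ps(1)] patterson_sullivanD(2)[OF ps(2)]
  define f where "f = RN_deriv \<mu> \<nu>"
  have f: "f \<in> borel_measurable borel"
    unfolding f_def using borel_measurable_RN_deriv[of \<mu>]
    unfolding measurable_cong_sets[OF sp(1) refl] by simp
  define E where "E = {x. f x > s}"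
  have E: "E \<in> sets borel"
    unfolding E_def using f by measurable
  define A where "A = (\<Union>g\<in>\<Gamma>. g ` E)"
  have A: "A \<in> sets borel"
    unfolding A_def using countable_Gamma borel_image[OF _ E] by (intro sets.countable_UN') auto
  have inv: "g ` A = A" if "g \<in> \<Gamma>" for g
  proof (rule invariantI[OF _ that])
    fix h x assume h: "h \<in> \<Gamma>" and "x \<in> A"
    then obtain g y where g: "g \<in> \<Gamma>" "y \<in> E" "x = g y" by (auto simp: A_def)
    then show "h x \<in> A" unfolding A_def using h by (intro UN_I[of "h \<circ> g"]) auto
  qed
  have "measure \<mu> A = 0 \<or> measure \<mu> (UNIV - A) = 0"
    by (rule quasi_conformal_ergodic[OF patterson_sullivan_quasi_conformal[OF ps(1)] A]) (rule inv)
  then show ?thesis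
  proof
    assume "measure \<mu> A = 0"
    then have "A \<in> null_sets \<mu>" using A sp by (intro null_setsI) (simp_all add: m.emeasure_eq_measure)
    then have "AE x in \<mu>. x \<notin> A" by (rule AE_not_in)
    then have "AE x in \<mu>. f x \<le> s"
    proof eventually_elim
      fix x assume "x \<notin> A"
      moreover have "E \<subseteq> A" unfolding A_def by (rule order_trans[OF _ UN_upper[OF id_mem]]) simp
      ultimately have "x \<notin> E" by blast
      then show "f x \<le> s" by (simp add: E_def not_less)
    qed
    then show ?thesis by (simp add: f_def)
  next
    assume "measure \<mu> (UNIV - A) = 0"
    then have "UNIV - A \<in> null_sets \<mu>"
      using A sp by (intro null_setsI) (simp_all add: m.emeasure_eq_measure)
    then have 1: "AE x in \<mu>. x \<notin> UNIV - A" by (rule AE_not_in)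
    \<comment> \<open>One exceptional null set for all group elements at once, by countability of
      the group.\<close>
    have 2: "AE x in \<mu>. \<forall>g\<in>\<Gamma>. f (iv g x) \<le> ennreal (exp (2 * C)) * f x"
      unfolding f_def using density_coarsely_invariant[OF ps] countable_Gamma by (rule AE_ball_countable')
    have "AE x in \<mu>. s \<le> ennreal (exp (2 * C)) * f x"
      using 1 2
    proof eventually_elim
      case (elim x)
      then obtain g y where g: "g \<in> \<Gamma>" "y \<in> E" "x = g y" by (auto simp: A_def)
      then have "s \<le> f (iv g x)" by (simp add: E_def less_imp_le)
      from order_trans[OF this bspec[OF elim(2) g(1)]] show ?case .
    qed
    then show ?thesis by (simp add: f_def)
  qed
qed

text \<open>Both measures have total mass 1, which decides the dichotomy: the density cannot be
  almost everywhere at most s < 1, nor at least exp(-2 C) s with s > exp(2 C). The limiting values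
  of s follow by approximation.\<close>

lemma patterson_sullivan_comparison:
  assumes ps: "patterson_sullivan \<Gamma> \<sigma> C \<delta> \<mu>" "patterson_sullivan \<Gamma> \<sigma> C \<delta> \<nu>"
    and A: "A \<in> sets borel"
  shows "measure \<nu> A \<le> exp (2 * C) * measure \<mu> A" "measure \<mu> A \<le> exp (2 * C) * measure \<nu> A"
proof -
  interpret m: prob_space \<mu> by (rule patterson_sullivanD(1)[OF ps(1)])
  interpret n: prob_space \<nu> by (rule patterson_sullivanD(1)[OF ps(2)])
  note sp = patterson_sullivanD(2)[OF ps(1)] patterson_sullivanD(2)[OF ps(2)]
  define f where "f = RN_deriv \<mu> \<nu>"
  have fm: "f \<in> borel_measurable \<mu>" by (simp add: f_def)
  have nu: "density \<mu> f = \<nu>"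
    unfolding f_def
    by (rule m.density_RN_deriv[OF patterson_sullivan_abs_cont[OF ps]]) (simp add: sp)
  have nuB: "emeasure \<nu> B = (\<integral>\<^sup>+x. f x * indicator B x \<partial>\<mu>)" if "B \<in> sets borel" for B
    using that sp fm unfolding nu[symmetric] by (simp add: emeasure_density)
  have upper: "measure \<nu> B \<le> s * measure \<mu> B"
    if "AE x in \<mu>. f x \<le> ennreal s" "s \<ge> 0" "B \<in> sets borel" for s B
  proof -
    have "emeasure \<nu> B \<le> (\<integral>\<^sup>+x. ennreal s * indicator B x \<partial>\<mu>)"
      unfolding nuB[OF that(3)]
    proof (rule nn_integral_mono_AE)
      show "AE x in \<mu>. f x * indicator B x \<le> ennreal s * indicator B x"
        using that(1) by eventually_elim (auto simp: indicator_def)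
    qed
    also have "\<dots> = ennreal s * emeasure \<mu> B" using that(3) sp by (simp add: nn_integral_cmult_indicator)
    finally show ?thesis using that(2)
      by (simp add: m.emeasure_eq_measure n.emeasure_eq_measure flip: ennreal_mult')
  qed
  have lower: "s * measure \<mu> B \<le> exp (2 * C) * measure \<nu> B"
    if "AE x in \<mu>. ennreal s \<le> ennreal (exp (2 * C)) * f x" "s \<ge> 0" "B \<in> sets borel" for s B
  proof -
    have "ennreal s * emeasure \<mu> B = (\<integral>\<^sup>+x. ennreal s * indicator B x \<partial>\<mu>)"
      using that(3) sp by (simp add: nn_integral_cmult_indicator)
    also have "\<dots> \<le> (\<integral>\<^sup>+x. ennreal (exp (2 * C)) * (f x * indicator B x) \<partial>\<mu>)"
    proof (rule nn_integral_mono_AE)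
      show "AE x in \<mu>. ennreal s * indicator B x \<le> ennreal (exp (2 * C)) * (f x * indicator B x)"
        using that(1) by eventually_elim (auto simp: indicator_def)
    qed
    also have "\<dots> = ennreal (exp (2 * C)) * emeasure \<nu> B"
      unfolding nuB[OF that(3)] using fm that(3) sp by (intro nn_integral_cmult) simp
    finally show ?thesis using that(2)
      by (simp add: m.emeasure_eq_measure n.emeasure_eq_measure flip: ennreal_mult')
  qed
  have one: "measure \<mu> UNIV = 1" "measure \<nu> UNIV = 1"
    using m.prob_space n.prob_space sets_eq_imp_space_eq[OF sp(1)] sets_eq_imp_space_eq[OF sp(2)]
    by simp_all
  have U: "measure \<nu> A \<le> s * measure \<mu> A" if "s > exp (2 * C)" for s
  proof -
    have s: "s \<ge> 0" using that exp_ge_zero[of "2 * C"] by linarith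
    from density_dichotomy[OF ps, of "ennreal s"] show ?thesis
    proof
      assume "AE x in \<mu>. RN_deriv \<mu> \<nu> x \<le> ennreal s"
      from upper[OF this[folded f_def] s A] show ?thesis .
    next
      assume "AE x in \<mu>. ennreal s \<le> ennreal (exp (2 * C)) * RN_deriv \<mu> \<nu> x"
      from lower[OF this[folded f_def] s, of UNIV] show ?thesis using that one by simp
    qed
  qed
  have L: "s * measure \<mu> A \<le> exp (2 * C) * measure \<nu> A" if "0 \<le> s" "s < 1" for s
    using density_dichotomy[OF ps, of "ennreal s"]
  proof
    assume "AE x in \<mu>. RN_deriv \<mu> \<nu> x \<le> ennreal s"
    from upper[OF this[folded f_def] that(1), of UNIV] show ?thesis using that one by simp
  next
    assume "AE x in \<mu>. ennreal s \<le> ennreal (exp (2 * C)) * RN_deriv \<mu> \<nu> x"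
    from lower[OF this[folded f_def] that(1) A] show ?thesis .
  qed
  show "measure \<nu> A \<le> exp (2 * C) * measure \<mu> A"
  proof (rule field_le_epsilon)
    fix x :: real assume x: "x > 0"
    have "measure \<nu> A \<le> (exp (2 * C) + x) * measure \<mu> A" by (rule U) (use x in simp)
    also have "\<dots> = exp (2 * C) * measure \<mu> A + x * measure \<mu> A" by (simp add: distrib_right)
    also have "x * measure \<mu> A \<le> x" using x m.prob_le_1[of A] by (simp add: mult_left_le)
    finally show "measure \<nu> A \<le> exp (2 * C) * measure \<mu> A + x" by simp
  qed
  show "measure \<mu> A \<le> exp (2 * C) * measure \<nu> A"
    by (rule field_le_mult_one_interval) (rule L, simp_all)
qed

end

theorem theorem1p3:
  fixes \<Gamma> :: "('m::polish_space \<Rightarrow> 'm) set"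
    and d :: "('m \<Rightarrow> 'm) + 'm \<Rightarrow> ('m \<Rightarrow> 'm) + 'm \<Rightarrow> real"
    and \<sigma> :: "('m \<Rightarrow> 'm) \<Rightarrow> 'm \<Rightarrow> real"
    and mag :: "('m \<Rightarrow> 'm) \<Rightarrow> real"
    and \<delta> C :: real
    and \<mu> :: "'m measure"
  assumes "compact (UNIV :: 'm set)"
    and "convergence_group \<Gamma>"
    and "non_elementary \<Gamma>"
    and "compatible_metric \<Gamma> d"
    and "expanding_coarse_cocycle \<Gamma> d \<sigma>"
    and "magnitude \<Gamma> d \<sigma> mag"
    and "critical_exponent \<Gamma> mag = ereal \<delta>"
    and "patterson_sullivan \<Gamma> \<sigma> C \<delta> \<mu>"
    and "poincare_series \<Gamma> mag \<delta> = \<infinity>"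
  shows "acts_ergodically \<Gamma> \<mu> \<and>
    (\<forall>\<nu>. patterson_sullivan \<Gamma> \<sigma> C \<delta> \<nu> \<longrightarrow>
       (\<forall>A\<in>sets borel. ennreal (exp (- 4 * C)) * emeasure \<mu> A \<le> emeasure \<nu> A \<and>
          emeasure \<nu> A \<le> ennreal (exp (4 * C)) * emeasure \<mu> A)) \<and>
    emeasure \<mu> (conical_limit_set \<Gamma>) = 1"
proof -
  interpret divergent_group \<Gamma> d \<sigma> mag \<delta>
    by unfold_locales (use assms in simp_all)
  note ps = assms(8)
  interpret m: prob_space \<mu> by (rule patterson_sullivanD(1)[OF ps])
  note sp = patterson_sullivanD(2)[OF ps]
  have spc: "space \<mu> = UNIV" using sets_eq_imp_space_eq[OF sp] by simp
  note qc = patterson_sullivan_quasi_conformal[OF ps]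
  have "acts_ergodically \<Gamma> \<mu>"
    unfolding acts_ergodically_def spc
  proof (intro ballI impI)
    fix A assume A: "A \<in> sets \<mu>" and inv: "\<forall>\<gamma>\<in>\<Gamma>. \<gamma> ` A = A"
    then have "A \<in> sets borel" using sp by simp
    then have "measure \<mu> A = 0 \<or> measure \<mu> (UNIV - A) = 0"
      by (rule quasi_conformal_ergodic[OF qc]) (rule bspec[OF inv])
    then show "A \<in> null_sets \<mu> \<or> UNIV - A \<in> null_sets \<mu>"
      using A sp by (auto simp: null_sets_def m.emeasure_eq_measure)
  qed
  moreover have "ennreal (exp (- 4 * C)) * emeasure \<mu> A \<le> emeasure \<nu> A \<and>
      emeasure \<nu> A \<le> ennreal (exp (4 * C)) * emeasure \<mu> A"
    if nu: "patterson_sullivan \<Gamma> \<sigma> C \<delta> \<nu>" and A: "A \<in> sets borel" for \<nu> A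
  proof -
    interpret n: prob_space \<nu> by (rule patterson_sullivanD(1)[OF nu])
    have C: "C \<ge> 0" by (rule patterson_sullivan_const_nonneg[OF ps])
    note cmp = patterson_sullivan_comparison[OF ps nu A]
    \<comment> \<open>The comparison holds with the factor exp(2 C), which is at most exp(4 C)
      because C is nonnegative.\<close>
    have "exp (- 4 * C) * measure \<mu> A \<le> exp (- 2 * C) * measure \<mu> A"
      using C by (intro mult_right_mono) auto
    also have "\<dots> \<le> exp (- 2 * C) * (exp (2 * C) * measure \<nu> A)"
      using cmp(2) by (intro mult_left_mono) auto
    also have "\<dots> = measure \<nu> A" by (simp add: mult.assoc[symmetric] exp_add[symmetric])
    finally have 1: "exp (- 4 * C) * measure \<mu> A \<le> measure \<nu> A" .
    have "exp (2 * C) * measure \<mu> A \<le> exp (4 * C) * measure \<mu> A"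
      using C by (intro mult_right_mono) auto
    with cmp(1) have 2: "measure \<nu> A \<le> exp (4 * C) * measure \<mu> A" by linarith
    from 1 2 show ?thesis
      by (simp add: m.emeasure_eq_measure n.emeasure_eq_measure ennreal_leI flip: ennreal_mult')
  qed
  moreover have "emeasure \<mu> (conical_limit_set \<Gamma>) = 1"
  proof -
    have "UNIV - conical_limit_set \<Gamma> \<in> null_sets \<mu>"
      using conical_full[OF qc] borel_conical sp
      by (intro null_setsI) (simp_all add: m.emeasure_eq_measure)
    from AE_not_in[OF this] have "AE x in \<mu>. x \<in> conical_limit_set \<Gamma>"
      by eventually_elim simp
    then show ?thesis
      using borel_conical sp by (intro m.emeasure_eq_1_AE) simp_all
  qed
  ultimately show ?thesis by blast
qed

end
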